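(* For every integer $s\ge0$, the fifth cohomological transfer $$(Tr_5^{\mathcal A_2})^*:\big((QP_5)_{n}^{GL_5}\big)^*\to H^{5,5+n}(\mathcal A_2,\mathbb Z_2)=\mathrm{Ext}_{\mathcal A_2}^{5,5+n}(\mathbb Z_2,\mathbb Z_2),\qquad n=5(2^s-1)+42\cdot2^s,$$ is a monomorphism.
   Context: $\mathbb Z_2$ is the field with two elements, $\mathcal A_2$ the mod 2 Steenrod algebra, and $P_t=\mathbb Z_2[x_1,\dots,x_t]$ with $\deg x_i=1$, a left $\mathcal A_2$-module via $Sq^i(x_j^a)=\binom{a}{i}x_j^{a+i}$ and the Cartan formula. $(P_t)_n$ is the degree-$n$ part and $(QP_t)_n=(\mathbb Z_2\otimes_{\mathcal A_2}P_t)_n=(P_t)_n/\sum_{i>0}\mathrm{Im}(Sq^i)$. The group $GL_t=GL_t(\mathbb Z_2)$ acts on $P_t$ by linear substitution of variables; this commutes with the $\mathcal A_2$-action and induces an action on $(QP_t)_n$; $(QP_t)_n^{GL_t}$ is the subspace of invariants, and $(-)^*$ denotes the $\mathbb Z_2$-linear dual. Singer's transfer: for a graded left $\mathcal A_2$-module $U$, $S^tU$ is the suspension, $(S^tU)^n=U^{n-t}$, with $\theta(S^tu)=S^t(\theta u)$. The action on $P_1=\mathbb Z_2[x_1]$ extends to $\mathbb Z_2[x_1,x_1^{-1}]$ (by $Sq^i(x_1^a)=\binom aix_1^{a+i}$ for all $a\in\mathbb Z$), and $\overline P=\langle x_1^a: a\ge-1\rangle$ is an $\mathcal A_2$-submodule.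 There is a short exact sequence $0\to P_1\to\overline P\xrightarrow{\pi}S^{-1}\mathbb Z_2\to0$ with $\pi(x_1^{a})=0$ for $a\ne-1$ and $\pi(x_1^{-1})=1$; let $e_1\in\mathrm{Ext}^1_{\mathcal A_2}(S^{-1}\mathbb Z_2,P_1)$ be its class. Let $e_t=(e_1\times P_{t-1})\circ\cdots\circ(e_1\times P_1)\circ e_1\in\mathrm{Ext}^t_{\mathcal A_2}(S^{-t}\mathbb Z_2,P_t)$, using cross products (tensoring the short exact sequence with $P_k$) and Yoneda products, with appropriate suspensions. Cap product with $e_t$ gives $\mathrm{Tor}_{t}^{\mathcal A_2}(\mathbb Z_2,S^{-t}\mathbb Z_2)\to\mathrm{Tor}_0^{\mathcal A_2}(\mathbb Z_2,P_t)=QP_t$, $z\mapsto e_t\cap z$, whose image lies in the $GL_t$-invariants. Via the isomorphism $\mathrm{Tor}^{\mathcal A_2}_{t,n}(\mathbb Z_2,S^{-t}\mathbb Z_2)\cong H_{t,t+n}(\mathcal A_2,\mathbb Z_2)=\mathrm{Tor}^{\mathcal A_2}_{t,t+n}(\mathbb Z_2,\mathbb Z_2)$ this gives $Tr_t^{\mathcal A_2}:H_{t,t+n}(\mathcal A_2,\mathbb Z_2)\to(QP_t)_n^{GL_t}$. Its dual $(Tr_t^{\mathcal A_2})^*:((QP_t)_n^{GL_t})^*\to H^{t,t+n}(\mathcal A_2,\mathbb Z_2)$ is the $t$-th cohomological transfer. *)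

theory Defs
  imports
    "HOL-Library.Poly_Mapping"
    "HOL-Library.Z2"
    "HOL-Library.FuncSet"
    "HOL-Computational_Algebra.Group_Closure"
    "Jordan_Normal_Form.Matrix"
begin

text \<open>
  The field with two elements is \<^typ>\<open>bit\<close>. Over it, linear subspaces are the same as additive
  subgroups, linear maps are the same as additive maps, and every nonzero coefficient is 1. So spans
  are written with \<^const>\<open>group_closure\<close>, and the linear extension of a map \<open>f\<close> given on
  basis elements is \<open>p \<mapsto> (\<Sum>x\<in>keys p. f x)\<close>. No signs occur.
\<close>

abbreviation keys :: "('a \<Rightarrow>\<^sub>0 'b::zero) \<Rightarrow> 'a set" where
  "keys \<equiv> Poly_Mapping.keys"

abbreviation lookup :: "('a \<Rightarrow>\<^sub>0 'b::zero) \<Rightarrow> 'a \<Rightarrow> 'b" where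
  "lookup \<equiv> Poly_Mapping.lookup"

abbreviation single :: "'a \<Rightarrow> 'b::zero \<Rightarrow> 'a \<Rightarrow>\<^sub>0 'b" where
  "single \<equiv> Poly_Mapping.single"

definition cong_mod :: "'a::ab_group_add set \<Rightarrow> 'a set \<Rightarrow> ('a \<times> 'a) set" where
  "cong_mod V W = {(p, q). p \<in> V \<and> q \<in> V \<and> p - q \<in> W}"


section \<open>The mod 2 Steenrod algebra\<close>

text \<open>\<open>Word [i\<^sub>1, \<dots>, i\<^sub>k]\<close> is the word \<open>Sq\<^sup>i\<^sup>1 \<dots> Sq\<^sup>i\<^sup>k\<close>. The additive notation
  for concatenation is what makes \<open>sq_word \<Rightarrow>\<^sub>0 bit\<close> the free associative algebra, with
  the convolution product of \<^theory>\<open>HOL-Library.Poly_Mapping\<close>.\<close>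

datatype sq_word = Word (letters: "nat list")

instantiation sq_word :: monoid_add
begin
definition zero_sq_word :: sq_word where "zero_sq_word = Word []"
definition plus_sq_word :: "sq_word \<Rightarrow> sq_word \<Rightarrow> sq_word" where
  "plus_sq_word v w = Word (letters v @ letters w)"
instance by standard (auto simp: zero_sq_word_def plus_sq_word_def)
end

type_synonym free_sq = "sq_word \<Rightarrow>\<^sub>0 bit"

abbreviation free_gen :: "nat list \<Rightarrow> free_sq" where
  "free_gen is \<equiv> single (Word is) 1"

definition adem_rel :: "nat \<Rightarrow> nat \<Rightarrow> free_sq" where
  "adem_rel a b = free_gen [a, b] -
     (\<Sum>c\<le>a div 2. of_nat ((b - c - 1) choose (a - 2 * c)) * free_gen [a + b - c, c])"

definition steenrod_rels :: "free_sq set" where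
  "steenrod_rels = insert (free_gen [0] - 1) {adem_rel a b | a b. 0 < a \<and> a < 2 * b}"

definition steenrod_ideal :: "free_sq set" where
  "steenrod_ideal = group_closure {u * r * v | u r v. r \<in> steenrod_rels}"

lemma steenrod_ideal_zero: "0 \<in> steenrod_ideal"
  by (simp add: steenrod_ideal_def)

lemma steenrod_ideal_diff: "p \<in> steenrod_ideal \<Longrightarrow> q \<in> steenrod_ideal \<Longrightarrow> p - q \<in> steenrod_ideal"
  unfolding steenrod_ideal_def by (rule group_closure.diff)

lemma steenrod_ideal_minus: "p \<in> steenrod_ideal \<Longrightarrow> - p \<in> steenrod_ideal"
  by (simp add: steenrod_ideal_def)

lemma steenrod_ideal_add: "p \<in> steenrod_ideal \<Longrightarrow> q \<in> steenrod_ideal \<Longrightarrow> p + q \<in> steenrod_ideal"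
  unfolding steenrod_ideal_def by (rule group_closure_add)

lemma steenrod_ideal_mult:
  assumes "p \<in> steenrod_ideal"
  shows "x * p * y \<in> steenrod_ideal"
  using assms unfolding steenrod_ideal_def
proof (induction rule: group_closure.induct)
  case (base s)
  show ?case
  proof (cases "s = 0")
    case False
    with base obtain u r v where s: "s = u * r * v" and r: "r \<in> steenrod_rels" by auto
    have "x * s * y = (x * u) * r * (v * y)" by (simp add: s mult.assoc)
    then show ?thesis using r by (intro group_closure.base) blast
  qed simp
next
  case (diff s t)
  then show ?case
    by (simp add: right_diff_distrib left_diff_distrib group_closure.diff)
qed

text \<open>The augmentation, sending \<open>Sq\<^sup>0\<close> to 1 and \<open>Sq\<^sup>i\<close> to 0 for \<open>i > 0\<close>.\<close>

definition word_counit :: "sq_word \<Rightarrow> bit" where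
  "word_counit w = (if set (letters w) \<subseteq> {0} then 1 else 0)"

definition free_counit :: "free_sq \<Rightarrow> bit" where
  "free_counit p = (\<Sum>w\<in>keys p. lookup p w * word_counit w)"

lemma free_counit_superset:
  assumes "finite A" "keys p \<subseteq> A"
  shows "free_counit p = (\<Sum>w\<in>A. lookup p w * word_counit w)"
  unfolding free_counit_def using assms
  by (intro sum.mono_neutral_left) (auto simp: in_keys_iff)

lemma free_counit_add: "free_counit (p + q) = free_counit p + free_counit q"
proof -
  let ?A = "keys p \<union> keys q"
  have "keys (p + q) \<subseteq> ?A" by (rule Poly_Mapping.keys_add)
  then show ?thesis
    by (simp only: free_counit_superset[of ?A] finite_Un finite_keys Un_upper1 Un_upper2
        lookup_add distrib_right sum.distrib)
qed

lemma free_counit_zero [simp]: "free_counit 0 = 0"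
  by (simp add: free_counit_def)

lemma free_counit_single: "free_counit (single w c) = c * word_counit w"
  by (cases "c = 0") (simp_all add: free_counit_def)

lemma free_counit_uminus: "free_counit (- p) = - free_counit p"
  by (metis add.right_inverse add_eq_0_iff free_counit_add free_counit_zero)

lemma free_counit_diff: "free_counit (p - q) = free_counit p - free_counit q"
  by (metis diff_conv_add_uminus free_counit_add free_counit_uminus)

lemma free_counit_sum: "free_counit (sum f A) = (\<Sum>x\<in>A. free_counit (f x))"
  by (induction A rule: infinite_finite_induct) (simp_all add: free_counit_add)

lemma poly_mapping_as_sum: "(p :: free_sq) = (\<Sum>w\<in>keys p. single w (lookup p w))"
  by (rule poly_mapping_eqI) (simp add: lookup_sum lookup_single when_def in_keys_iff)

lemma free_counit_mult: "free_counit (p * q) = free_counit p * free_counit q"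
proof -
  have w: "word_counit (v + w) = word_counit v * word_counit w" for v w
    by (auto simp: word_counit_def plus_sq_word_def)
  have "p * q = (\<Sum>v\<in>keys p. \<Sum>w\<in>keys q. single (v + w) (lookup p v * lookup q w))"
    by (subst poly_mapping_as_sum[of p], subst poly_mapping_as_sum[of q])
       (simp only: sum_product mult_single)
  then have "free_counit (p * q) =
      (\<Sum>v\<in>keys p. \<Sum>w\<in>keys q. (lookup p v * word_counit v) * (lookup q w * word_counit w))"
    by (simp only: free_counit_sum free_counit_single w mult_ac)
  then show ?thesis
    by (simp only: free_counit_def sum_product)
qed

lemma free_counit_rels:
  assumes "r \<in> steenrod_rels"
  shows "free_counit r = 0"
proof -
  have "free_counit (adem_rel a b) = 0" if "0 < a" "a < 2 * b" for a b
  proof -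
    have "free_counit (free_gen [a + b - c, c]) = 0" if "c \<in> {..a div 2}" for c
    proof -
      have "a + b - c > 0" using that \<open>0 < a\<close> by auto
      then show ?thesis by (simp add: free_counit_single word_counit_def)
    qed
    then show ?thesis
      using \<open>0 < a\<close> unfolding adem_rel_def
      by (simp add: free_counit_diff free_counit_sum free_counit_mult)
         (simp add: free_counit_single word_counit_def)
  qed
  moreover have "free_counit 1 = 1"
    by (simp add: free_counit_single word_counit_def zero_sq_word_def flip: single_one)
  ultimately show ?thesis
    using assms by (auto simp: steenrod_rels_def free_counit_diff free_counit_single word_counit_def)
qed

lemma free_counit_ideal: "p \<in> steenrod_ideal \<Longrightarrow> free_counit p = 0"
  unfolding steenrod_ideal_def
proof (induction rule: group_closure.induct)
  case (base s)
  then show ?case by (auto simp: free_counit_mult free_counit_rels)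
qed (simp add: free_counit_diff)

definition steenrod_eq :: "free_sq \<Rightarrow> free_sq \<Rightarrow> bool" where
  "steenrod_eq p q \<longleftrightarrow> p - q \<in> steenrod_ideal"

quotient_type steenrod = free_sq / steenrod_eq
proof (rule equivpI)
  show "reflp steenrod_eq"
    by (simp add: reflp_def steenrod_eq_def steenrod_ideal_zero)
  show "symp steenrod_eq"
    unfolding symp_def steenrod_eq_def by (metis minus_diff_eq steenrod_ideal_minus)
  show "transp steenrod_eq"
    unfolding transp_def steenrod_eq_def by (metis diff_add_cancel add_diff_eq steenrod_ideal_add)
qed

instantiation steenrod :: ring_1
begin
lift_definition zero_steenrod :: steenrod is 0 .
lift_definition one_steenrod :: steenrod is 1 .
lift_definition plus_steenrod :: "steenrod \<Rightarrow> steenrod \<Rightarrow> steenrod" is "(+)"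
  unfolding steenrod_eq_def by (simp add: add_diff_add steenrod_ideal_add)
lift_definition minus_steenrod :: "steenrod \<Rightarrow> steenrod \<Rightarrow> steenrod" is "(-)"
  unfolding steenrod_eq_def by (metis diff_diff_eq2 diff_add_eq diff_diff_eq add.commute steenrod_ideal_diff)
lift_definition uminus_steenrod :: "steenrod \<Rightarrow> steenrod" is uminus
  unfolding steenrod_eq_def by (metis minus_diff_eq minus_diff_minus steenrod_ideal_minus)
lift_definition times_steenrod :: "steenrod \<Rightarrow> steenrod \<Rightarrow> steenrod" is "(*)"
proof -
  fix p p' q q' :: free_sq
  assume "steenrod_eq p p'" "steenrod_eq q q'"
  moreover have "p * q - p' * q' = 1 * (p - p') * q + p' * (q - q') * 1"
    by (simp add: algebra_simps)
  ultimately show "steenrod_eq (p * q) (p' * q')"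
    unfolding steenrod_eq_def by (metis steenrod_ideal_add steenrod_ideal_mult)
qed
instance
proof
  show "(0 :: steenrod) \<noteq> 1"
  proof
    assume "(0 :: steenrod) = 1"
    then have "(0 - 1 :: free_sq) \<in> steenrod_ideal"
      by (simp add: zero_steenrod_def one_steenrod_def steenrod.abs_eq_iff steenrod_eq_def)
    then have "free_counit (0 - 1) = 0" by (rule free_counit_ideal)
    then have "free_counit (1 :: free_sq) = 0" by (simp only: free_counit_diff free_counit_zero) simp
    then show False
      by (simp add: free_counit_single word_counit_def zero_sq_word_def flip: single_one)
  qed
qed (transfer; simp add: steenrod_eq_def steenrod_ideal_zero algebra_simps)+
end

lift_definition counit :: "steenrod \<Rightarrow> bit" is free_counit
  unfolding steenrod_eq_def using free_counit_diff free_counit_ideal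
  by (metis eq_iff_diff_eq_0)

definition steenrod_comp :: "nat \<Rightarrow> steenrod set" where
  "steenrod_comp d = abs_steenrod ` {p. \<forall>w\<in>keys p. sum_list (letters w) = d}"


section \<open>Polynomials and Laurent polynomials\<close>

text \<open>
  All polynomial modules live in the ring of Laurent polynomials over \<^typ>\<open>bit\<close> in the variables
  \<open>x\<^sub>0, x\<^sub>1, x\<^sub>2, \<dots>\<close>; a monomial is its exponent vector. Variables are counted from 0, so
  \<open>P\<^sub>t\<close> is the polynomial ring in \<open>x\<^sub>0, \<dots>, x\<^sub>t\<^sub>-\<^sub>1\<close>.
\<close>

type_synonym monom = "nat \<Rightarrow>\<^sub>0 int"
type_synonym laurent = "monom \<Rightarrow>\<^sub>0 bit"

definition monom_deg :: "monom \<Rightarrow> int" where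
  "monom_deg m = (\<Sum>j\<in>keys m. lookup m j)"

definition int_choose :: "int \<Rightarrow> nat \<Rightarrow> int" where
  "int_choose a k = (\<Prod>i<k. a - int i) div fact k"

text \<open>The iterated Cartan formula applied to \<open>Sq\<^sup>i(x\<^sub>j\<^sup>a) = (a choose i) x\<^sub>j\<^sup>a\<^sup>+\<^sup>i\<close>:
  the sum runs over all ways \<open>e\<close> to distribute \<open>i\<close> over the variables of the monomial.\<close>

definition sq_monom :: "nat \<Rightarrow> monom \<Rightarrow> laurent" where
  "sq_monom i m =
     (\<Sum>e | keys e \<subseteq> keys m \<and> (\<forall>j. 0 \<le> lookup e j) \<and> monom_deg e = int i.
        single (m + e) (\<Prod>j\<in>keys m. of_int (int_choose (lookup m j) (nat (lookup e j)))))"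

definition Sq :: "nat \<Rightarrow> laurent \<Rightarrow> laurent" where
  "Sq i p = (\<Sum>m\<in>keys p. sq_monom i m)"

definition free_act :: "free_sq \<Rightarrow> laurent \<Rightarrow> laurent" where
  "free_act a p = (\<Sum>w\<in>keys a. foldr Sq (letters w) p)"

text \<open>Since the operations \<^const>\<open>Sq\<close> satisfy the Adem relations on Laurent polynomials, the
  choice of representative is immaterial.\<close>

definition steenrod_act :: "steenrod \<Rightarrow> laurent \<Rightarrow> laurent" where
  "steenrod_act a p = free_act (rep_steenrod a) p"

definition poly_comp :: "nat \<Rightarrow> int \<Rightarrow> laurent set" where
  "poly_comp t n = {p. \<forall>m\<in>keys p.
     keys m \<subseteq> {..<t} \<and> (\<forall>j. 0 \<le> lookup m j) \<and> monom_deg m = n}"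

text \<open>\<open>P\<^bold>\<bar> \<otimes> P\<^sub>k\<close>, where \<open>P\<^sub>k\<close> uses \<open>x\<^sub>0, \<dots>, x\<^sub>k\<^sub>-\<^sub>1\<close> and the tensor
  factor with exponents \<open>\<ge> -1\<close> uses the new variable \<open>x\<^sub>k\<close>. Accordingly \<open>P\<^sub>1 \<otimes> P\<^sub>k\<close>
  is \<open>P\<^sub>k\<^sub>+\<^sub>1\<close>, as a submodule. Numbering the new variable last rather than first
  only permutes variables, which the invariants do not see.\<close>

definition pbar_tensor_comp :: "nat \<Rightarrow> int \<Rightarrow> laurent set" where
  "pbar_tensor_comp k n = {p. \<forall>m\<in>keys p.
     keys m \<subseteq> {..k} \<and> -1 \<le> lookup m k \<and> (\<forall>j<k. 0 \<le> lookup m j) \<and> monom_deg m = n}"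

text \<open>\<open>\<pi> \<otimes> P\<^sub>k\<close>: the coefficient of \<open>x\<^sub>k\<^sup>-\<^sup>1\<close>.\<close>

definition pbar_proj :: "nat \<Rightarrow> laurent \<Rightarrow> laurent" where
  "pbar_proj k p = (\<Sum>m | m \<in> keys p \<and> lookup m k = -1. single (m + single k 1) 1)"


section \<open>The invariants of the indecomposables\<close>

definition hits :: "nat \<Rightarrow> int \<Rightarrow> laurent set" where
  "hits t n = group_closure {Sq i u | i u. 0 < i \<and> u \<in> poly_comp t (n - int i)}"

abbreviation hit_eq :: "nat \<Rightarrow> int \<Rightarrow> (laurent \<times> laurent) set" where
  "hit_eq t n \<equiv> cong_mod (poly_comp t n) (hits t n)"

definition QP :: "nat \<Rightarrow> int \<Rightarrow> laurent set set" where
  "QP t n = poly_comp t n // hit_eq t n"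

definition GL :: "nat \<Rightarrow> bit mat set" where
  "GL t = {g \<in> carrier_mat t t. invertible_mat g}"

text \<open>The substitution \<open>x\<^sub>i \<mapsto> \<Sum>\<^sub>j g\<^sub>i\<^sub>j x\<^sub>j\<close> on \<open>P\<^sub>t\<close>.\<close>

definition lin_subst :: "nat \<Rightarrow> bit mat \<Rightarrow> laurent \<Rightarrow> laurent" where
  "lin_subst t g p =
     (\<Sum>m\<in>keys p. \<Prod>i<t. (\<Sum>j<t. single (single j 1) (g $$ (i, j))) ^ nat (lookup m i))"

definition QP_inv :: "nat \<Rightarrow> int \<Rightarrow> laurent set set" where
  "QP_inv t n = {X \<in> QP t n. \<forall>g\<in>GL t. \<forall>p\<in>X. lin_subst t g p \<in> X}"

text \<open>Linear functionals on the invariants, made unique as functions by \<^const>\<open>extensional\<close>.\<close>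

definition QP_inv_dual :: "nat \<Rightarrow> int \<Rightarrow> (laurent set \<Rightarrow> bit) set" where
  "QP_inv_dual t n = {l \<in> extensional (QP_inv t n). \<forall>p q.
     hit_eq t n `` {p} \<in> QP_inv t n \<longrightarrow> hit_eq t n `` {q} \<in> QP_inv t n \<longrightarrow>
     l (hit_eq t n `` {p + q}) = l (hit_eq t n `` {p}) + l (hit_eq t n `` {q})}"


section \<open>Graded modules, Tor and Ext\<close>

text \<open>A graded left module is given by its homogeneous components inside an ambient group,
  together with the action of the Steenrod algebra.\<close>

record 'm gmod =
  gcomp :: "int \<Rightarrow> 'm set"
  gact :: "steenrod \<Rightarrow> 'm \<Rightarrow> 'm"

definition susp :: "int \<Rightarrow> 'm gmod \<Rightarrow> 'm gmod" where
  "susp s M = \<lparr>gcomp = (\<lambda>n. gcomp M (n - s)), gact = gact M\<rparr>"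

definition Z2 :: "bit gmod" where
  "Z2 = \<lparr>gcomp = (\<lambda>n. if n = 0 then UNIV else {0}), gact = (\<lambda>a c. counit a * c)\<rparr>"

definition poly_mod :: "nat \<Rightarrow> laurent gmod" where
  "poly_mod t = \<lparr>gcomp = poly_comp t, gact = steenrod_act\<rparr>"

definition pbar_tensor :: "nat \<Rightarrow> laurent gmod" where
  "pbar_tensor k = \<lparr>gcomp = pbar_tensor_comp k, gact = steenrod_act\<rparr>"

text \<open>
  Tor and Ext are computed by the (unnormalised) bar resolution. Its tensor powers over \<^typ>\<open>bit\<close>
  are presented by generators and relations: \<open>(as, x)\<close> stands for the tensor
  \<open>a\<^sub>1 \<otimes> \<dots> \<otimes> a\<^sub>k \<otimes> x\<close> of homogeneous elements of total degree \<open>u\<close>, and the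
  relations \<open>bar_rels\<close> express additivity in each slot. Thus \<open>bar_chains k N u\<close> modulo
  \<open>bar_rels k N u\<close> is the degree \<open>u\<close> part of
  \<open>\<A>\<^sup>\<otimes>\<^sup>k \<otimes> N\<close>, the bar resolution of \<open>N\<close> tensored with the right module
  \<open>\<int>\<^sub>2\<close>; dually, an \<open>\<A>\<close>-linear map from the bar resolution to \<open>M\<close> is a slotwise
  additive function on generators.
\<close>

type_synonym 'n bar = "steenrod list \<times> 'n"

definition bar_gens :: "nat \<Rightarrow> 'n gmod \<Rightarrow> int \<Rightarrow> 'n bar set" where
  "bar_gens k N u = {(as, x). length as = k \<and>
     (\<exists>ds e. list_all2 (\<lambda>a d. a \<in> steenrod_comp d) as ds \<and> x \<in> gcomp N e \<and>
       int (sum_list ds) + e = u)}"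

text \<open>Triples of generators of which the first is the sum of the other two in one slot.\<close>

definition slot_sums ::
  "nat \<Rightarrow> ('n::ab_group_add) gmod \<Rightarrow> int \<Rightarrow> ('n bar \<times> 'n bar \<times> 'n bar) set" where
  "slot_sums k N u =
     ({((as @ (a + b) # bs, x), (as @ a # bs, x), (as @ b # bs, x)) | as a b bs x.
         \<exists>d. a \<in> steenrod_comp d \<and> b \<in> steenrod_comp d} \<union>
      {((as, x + y), (as, x), (as, y)) | as x y. \<exists>e. x \<in> gcomp N e \<and> y \<in> gcomp N e})
     \<inter> (bar_gens k N u \<times> bar_gens k N u \<times> bar_gens k N u)"

definition merge_at :: "nat \<Rightarrow> steenrod list \<Rightarrow> steenrod list" where
  "merge_at i as = take i as @ (as ! i * as ! Suc i) # drop (Suc (Suc i)) as"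


subsection \<open>Tor\<close>

type_synonym 'n chain = "'n bar \<Rightarrow>\<^sub>0 bit"

definition bar_chains :: "nat \<Rightarrow> 'n gmod \<Rightarrow> int \<Rightarrow> 'n chain set" where
  "bar_chains k N u = {c. keys c \<subseteq> bar_gens k N u}"

definition bar_rels :: "nat \<Rightarrow> ('n::ab_group_add) gmod \<Rightarrow> int \<Rightarrow> 'n chain set" where
  "bar_rels k N u =
     group_closure {single x 1 - single y 1 - single z 1 | x y z. (x, y, z) \<in> slot_sums k N u}"

definition bar_diff_gen :: "'n gmod \<Rightarrow> 'n bar \<Rightarrow> 'n chain" where
  "bar_diff_gen N = (\<lambda>(as, x). if as = [] then 0 else
     single (tl as, x) (counit (hd as)) +
     (\<Sum>i<length as - 1. single (merge_at i as, x) 1) +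
     single (butlast as, gact N (last as) x) 1)"

definition bar_diff :: "'n gmod \<Rightarrow> 'n chain \<Rightarrow> 'n chain" where
  "bar_diff N c = (\<Sum>g\<in>keys c. bar_diff_gen N g)"

definition bar_cycles :: "nat \<Rightarrow> ('n::ab_group_add) gmod \<Rightarrow> int \<Rightarrow> 'n chain set" where
  "bar_cycles k N u = {c \<in> bar_chains k N u. bar_diff N c \<in> bar_rels (k - 1) N u}"

definition bar_boundaries :: "nat \<Rightarrow> ('n::ab_group_add) gmod \<Rightarrow> int \<Rightarrow> 'n chain set" where
  "bar_boundaries k N u = group_closure (bar_diff N ` bar_chains (Suc k) N u \<union> bar_rels k N u)"

text \<open>\<open>Tor k N u\<close> is \<open>Tor\<^sub>k\<^sub>,\<^sub>u(\<int>\<^sub>2, N)\<close>. In this model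
  \<open>Tor k (susp s N) u = Tor k N (u - s)\<close> holds as an equality of sets, which is the
  suspension isomorphism.\<close>

definition Tor :: "nat \<Rightarrow> ('n::ab_group_add) gmod \<Rightarrow> int \<Rightarrow> 'n chain set set" where
  "Tor k N u = bar_cycles k N u // cong_mod (bar_cycles k N u) (bar_boundaries k N u)"


subsection \<open>Ext\<close>

text \<open>\<open>Ext k N M\<close> is \<open>Ext\<^sup>k(N, M)\<close> formed with maps preserving the degree; hence
  \<open>Ext\<^sup>k\<^sup>,\<^sup>u(N, M)\<close> is \<open>Ext k N (susp u M)\<close>. The values of a cochain off the
  generators are irrelevant and are disregarded by \<open>cohomologous\<close>. Suspending both arguments
  changes neither the cochains nor the relation, so suspension of classes is the identity.\<close>

definition cochains ::
  "nat \<Rightarrow> ('n::ab_group_add) gmod \<Rightarrow> ('m::ab_group_add) gmod \<Rightarrow> ('n bar \<Rightarrow> 'm) set" where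
  "cochains k N M = {f. \<forall>u. (\<forall>g\<in>bar_gens k N u. f g \<in> gcomp M u) \<and>
     (\<forall>(x, y, z)\<in>slot_sums k N u. f x = f y + f z)}"

definition codiff ::
  "'n gmod \<Rightarrow> ('m::ab_group_add) gmod \<Rightarrow> ('n bar \<Rightarrow> 'm) \<Rightarrow> 'n bar \<Rightarrow> 'm" where
  "codiff N M f = (\<lambda>(as, x).
     gact M (hd as) (f (tl as, x)) +
     (\<Sum>i<length as - 1. f (merge_at i as, x)) +
     f (butlast as, gact N (last as) x))"

definition cocycles ::
  "nat \<Rightarrow> ('n::ab_group_add) gmod \<Rightarrow> ('m::ab_group_add) gmod \<Rightarrow> ('n bar \<Rightarrow> 'm) set" where
  "cocycles k N M = {f \<in> cochains k N M. \<forall>u. \<forall>g\<in>bar_gens (Suc k) N u. codiff N M f g = 0}"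

definition cohomologous ::
  "nat \<Rightarrow> ('n::ab_group_add) gmod \<Rightarrow> ('m::ab_group_add) gmod \<Rightarrow>
    (('n bar \<Rightarrow> 'm) \<times> ('n bar \<Rightarrow> 'm)) set" where
  "cohomologous k N M = {(f, f'). f \<in> cocycles k N M \<and> f' \<in> cocycles k N M \<and>
     (case k of
        0 \<Rightarrow> \<forall>u. \<forall>g\<in>bar_gens 0 N u. f g = f' g
      | Suc j \<Rightarrow> \<exists>h\<in>cochains j N M. \<forall>u. \<forall>g\<in>bar_gens k N u. f g - f' g = codiff N M h g)}"

definition Ext ::
  "nat \<Rightarrow> ('n::ab_group_add) gmod \<Rightarrow> ('m::ab_group_add) gmod \<Rightarrow> ('n bar \<Rightarrow> 'm) set set" where
  "Ext k N M = cocycles k N M // cohomologous k N M"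

text \<open>The class of a short exact sequence \<open>0 \<rightarrow> M \<rightarrow> E \<rightarrow> N \<rightarrow> 0\<close>, with maps \<open>\<iota>\<close> and
  \<open>\<pi>\<close>, consists of the cocycles \<open>(a, x) \<mapsto> a \<sigma>(x) - \<sigma>(a x)\<close> obtained from the
  linear sections \<open>\<sigma>\<close> of \<open>\<pi>\<close>.\<close>

definition extension_class ::
  "('m::ab_group_add) gmod \<Rightarrow> ('m \<Rightarrow> 'e) \<Rightarrow> ('e::ab_group_add) gmod \<Rightarrow> ('e \<Rightarrow> 'n) \<Rightarrow>
    ('n::ab_group_add) gmod \<Rightarrow> ('n bar \<Rightarrow> 'm) set" where
  "extension_class M \<iota> E \<pi> N = {f \<in> cochains 1 N M. \<exists>\<sigma>.
     (\<forall>n. \<forall>x\<in>gcomp N n. \<sigma> x \<in> gcomp E n \<and> \<pi> (\<sigma> x) = x) \<and>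
     (\<forall>n. \<forall>x\<in>gcomp N n. \<forall>y\<in>gcomp N n. \<sigma> (x + y) = \<sigma> x + \<sigma> y) \<and>
     (\<forall>u a x. ([a], x) \<in> bar_gens 1 N u \<longrightarrow> \<iota> (f ([a], x)) = gact E a (\<sigma> x) - \<sigma> (gact N a x))}"

text \<open>The Yoneda product of \<open>F \<in> Ext\<^sup>p(L, M)\<close> and \<open>G \<in> Ext\<^sup>q(N, L)\<close>. The lift of a
  cocycle \<open>g\<close> to a chain map of bar resolutions is
  \<open>[a\<^sub>1|\<dots>|a\<^sub>p|b\<^sub>1|\<dots>|b\<^sub>q] x \<mapsto> [a\<^sub>1|\<dots>|a\<^sub>p] g([b\<^sub>1|\<dots>|b\<^sub>q] x)\<close>.\<close>

definition yoneda_cochain :: "nat \<Rightarrow> ('l bar \<Rightarrow> 'm) \<Rightarrow> ('n bar \<Rightarrow> 'l) \<Rightarrow> 'n bar \<Rightarrow> 'm" where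
  "yoneda_cochain p f g = (\<lambda>(as, x). f (take p as, g (drop p as, x)))"

definition yoneda ::
  "nat \<Rightarrow> nat \<Rightarrow> ('n::ab_group_add) gmod \<Rightarrow> ('m::ab_group_add) gmod \<Rightarrow>
    ('l bar \<Rightarrow> 'm) set \<Rightarrow> ('n bar \<Rightarrow> 'l) set \<Rightarrow> ('n bar \<Rightarrow> 'm) set" where
  "yoneda p q N M F G =
     cohomologous (p + q) N M `` {yoneda_cochain p f g | f g. f \<in> F \<and> g \<in> G}"

text \<open>The cap product of \<open>Ext\<^sup>k(N, M)\<close> with \<open>Tor\<^sub>k(\<int>\<^sub>2, N)\<close> on representatives; the value
  represents an element of \<open>Tor\<^sub>0(\<int>\<^sub>2, M) = \<int>\<^sub>2 \<otimes> M\<close>.\<close>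

definition cap :: "('n bar \<Rightarrow> 'm::ab_group_add) \<Rightarrow> 'n chain \<Rightarrow> 'm" where
  "cap f c = (\<Sum>g\<in>keys c. f g)"

text \<open>For \<open>M = S\<^sup>u\<int>\<^sub>2\<close> this is the pairing that identifies \<open>Ext\<^sup>k\<^sup>,\<^sup>u(\<int>\<^sub>2, \<int>\<^sub>2)\<close>
  with the dual of \<open>Tor\<^sub>k\<^sub>,\<^sub>u(\<int>\<^sub>2, \<int>\<^sub>2)\<close>.\<close>

definition ext_tor_pairing :: "('n bar \<Rightarrow> bit) set \<Rightarrow> 'n chain set \<Rightarrow> bit" where
  "ext_tor_pairing F C = (THE v. \<forall>f\<in>F. \<forall>c\<in>C. cap f c = v)"


section \<open>The algebraic transfer\<close>

text \<open>\<open>e\<^sub>1 \<times> P\<^sub>k \<in> Ext\<^sup>1(S\<^sup>-\<^sup>1P\<^sub>k, P\<^sub>k\<^sub>+\<^sub>1)\<close>\<close>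

definition e_cross :: "nat \<Rightarrow> (laurent bar \<Rightarrow> laurent) set" where
  "e_cross k = extension_class (poly_mod (Suc k)) id (pbar_tensor k) (pbar_proj k)
     (susp (-1) (poly_mod k))"

text \<open>\<open>e\<^sub>t \<in> Ext\<^sup>t(S\<^sup>-\<^sup>t\<int>\<^sub>2, P\<^sub>t)\<close>. The recursion starts with the identification
  \<open>\<int>\<^sub>2 = P\<^sub>0\<close> as an element of \<open>Ext\<^sup>0\<close>.\<close>

fun e_class :: "nat \<Rightarrow> (bit bar \<Rightarrow> laurent) set" where
  "e_class 0 = cohomologous 0 Z2 (poly_mod 0) `` {\<lambda>(as, c). single 0 c}"
| "e_class (Suc k) =
     yoneda 1 k (susp (- int (Suc k)) Z2) (poly_mod (Suc k)) (e_cross k) (e_class k)"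

text \<open>\<open>Tr\<^sub>t\<close> on \<open>H\<^sub>t\<^sub>,\<^sub>t\<^sub>+\<^sub>n = Tor t Z2 (t + n) = Tor t (susp (-t) Z2) n\<close>.\<close>

definition transfer :: "nat \<Rightarrow> int \<Rightarrow> bit chain set \<Rightarrow> laurent set" where
  "transfer t n C = (THE X. X \<in> QP t n \<and> (\<forall>f\<in>e_class t. \<forall>c\<in>C. cap f c \<in> X))"

definition Ext_Z2 :: "nat \<Rightarrow> int \<Rightarrow> (bit bar \<Rightarrow> bit) set set" where
  "Ext_Z2 t u = Ext t Z2 (susp u Z2)"

definition cohomological_transfer ::
  "nat \<Rightarrow> int \<Rightarrow> (laurent set \<Rightarrow> bit) \<Rightarrow> (bit bar \<Rightarrow> bit) set" where
  "cohomological_transfer t n l = (THE F. F \<in> Ext_Z2 t (int t + n) \<and>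
     (\<forall>C \<in> Tor t Z2 (int t + n). ext_tor_pairing F C = l (transfer t n C)))"

end

(*
After extending scalars from the field with two elements to its algebraic closure, the Singer cycle of
order 31 acts diagonally in conjugate coordinates y_0, ..., y_4, in which the total square becomes
y_i + y_(i-1)^2. In degree 42 (the case s = 0) a class that is invariant under the Singer cycle and under
Frobenius is its own average over these 31 * 5 substitutions, hence a combination of orbit sums of monomials
of weight 0. An explicit list of hit relations leaves seventeen of these. Evaluating linear functionals that
vanish on hit polynomials (coefficients of spikes, ordinary and twisted) on the images under permutations
and a transvection gives seventeen independent equations, so the coefficients vanish.
The case s + 1 follows from the case s by Kameko's squaring x -> x_1 ... x_5 x^2, since by Wood's criterion
every monomial of the higher degree with an even exponent is hit. Thus the space of invariants is zero for
all s, and a map on its dual is injective.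
*)
theory Submission
  imports Defs "HOL-Algebra.Algebraic_Closure_Type" "HOL-Library.Code_Binary_Nat"
begin

section \<open>Polynomials in characteristic two\<close>

text \<open>The Singer cycle has no eigenvector over the field with two elements; this forces the
  passage to the algebraic closure, and a linear functional sending 1 to 1 brings hit equations back
  at the end. Single squares are replaced by the total square because it is an algebra homomorphism:
  a linear substitution preserves hit polynomials as soon as it commutes with it on the variables.
  Averaging loses nothing since 31 * 5 = 155 is odd, but it exploits only the normaliser of the
  Singer cycle; further group elements have to supply the final equations. The coefficients of the
  seventeen classes are a priori arbitrary elements of the closure. Each of three permutations
  yields an equation over the field with 32 elements together with its conjugates, hence five
  equations over the prime field; two ordinary spikes, compared through the transvection, yield one
  each, and 3 * 5 + 2 = 17.\<close>

class char2 = comm_ring_1 +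
  assumes one_add_one_zero: "1 + 1 = 0"
begin

lemma add_self [simp]: "x + x = 0"
  by (metis distrib_left local.mult_1_right local.mult_zero_right one_add_one_zero)

lemma uminus_char2 [simp]: "- x = x"
  by (metis add_self local.add.inverse_unique)

lemma diff_char2 [simp]: "x - y = x + y"
  by (metis local.diff_conv_add_uminus uminus_char2)

lemma add_cancel_char2 [simp]: "x + (x + y) = y" "x + (y + x) = y"
  by (simp_all add: local.add.commute local.add.left_commute flip: local.add.assoc)

lemma add_eq_0_char2: "x + y = 0 \<longleftrightarrow> x = y"
  by (metis diff_char2 local.eq_iff_diff_eq_0)

lemma square_add: "(x + y)\<^sup>2 = x\<^sup>2 + y\<^sup>2"
  by (simp add: power2_eq_square algebra_simps)

lemma square_sum: "(sum f A)\<^sup>2 = (\<Sum>a\<in>A. (f a)\<^sup>2)"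
  by (induction A rule: infinite_finite_induct) (simp_all add: square_add)

lemma of_nat_char2: "of_nat n = (if even n then 0 else 1)"
  by (induction n) (auto simp: one_add_one_zero)

end

lemma power_2_power_add: "(x + y :: 'a :: char2) ^ 2 ^ k = x ^ 2 ^ k + y ^ 2 ^ k"
proof (induction k)
  case (Suc k)
  have "z ^ 2 ^ Suc k = (z ^ 2 ^ k)\<^sup>2" for z :: 'a
    by (simp add: mult.commute flip: power_mult)
  then show ?case by (simp only: Suc square_add)
qed simp

instance bit :: char2
  by standard simp

instance alg_closure :: ("{field, char2}") char2
  by standard (metis one_add_one_zero to_ac_0 to_ac_1 to_ac_add)

instance poly_mapping :: (comm_monoid_add, char2) char2
  by standard (metis one_add_one_zero single_add single_one single_zero)

text \<open>The closure supplies both the root \<open>beta\<close> and the square roots of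
  coefficients in the Kameko decomposition. The polynomials below have infinitely many variables;
  \<open>proj\<close> later cuts them down to five.\<close>

type_synonym F = "bit alg_closure"
type_synonym pol = "(nat \<Rightarrow>\<^sub>0 nat) \<Rightarrow>\<^sub>0 F"

definition C :: "F \<Rightarrow> pol" where "C c = single 0 c"
definition V :: "nat \<Rightarrow> pol" where "V i = single (single i 1) 1"
definition mon :: "(nat \<Rightarrow>\<^sub>0 nat) \<Rightarrow> pol" where "mon m = single m 1"
definition deg :: "(nat \<Rightarrow>\<^sub>0 nat) \<Rightarrow> nat" where "deg m = (\<Sum>i\<in>keys m. lookup m i)"

lemma C_0 [simp]: "C 0 = 0" and C_1 [simp]: "C 1 = 1"
  and C_add: "C (a + b) = C a + C b" and C_mult: "C (a * b) = C a * C b"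
  by (simp_all add: C_def single_add mult_single)

lemma C_sum: "C (sum f A) = (\<Sum>a\<in>A. C (f a))"
  by (induction A rule: infinite_finite_induct) (simp_all add: C_add)

lemma C_power: "C (a ^ n) = C a ^ n"
  by (induction n) (simp_all add: C_mult)

lemma C_mult_single: "C a * single m b = single m (a * b)"
  by (simp add: C_def mult_single)

lemma C_mult_mon: "C a * mon m = single m a"
  by (simp add: mon_def C_mult_single)

lemma mon_0 [simp]: "mon 0 = 1" and mon_add: "mon (m + n) = mon m * mon n"
  by (simp_all add: mon_def mult_single)

lemma mon_single: "mon (single i k) = V i ^ k"
proof (induction k)
  case (Suc k)
  have "single i (Suc k) = single i 1 + single i k" by (simp flip: single_add)
  then show ?case using Suc by (simp only: mon_add power_Suc) (simp add: V_def mon_def)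
qed simp

lemma lookup_mon: "lookup (mon m) n = (if m = n then 1 else 0)"
  by (simp add: mon_def lookup_single when_def)

lemma keys_mon [simp]: "keys (mon m) = {m}"
  by (simp add: mon_def)

lemma pol_as_sum: "p = (\<Sum>m\<in>keys p. C (lookup p m) * mon m)" for p :: pol
  by (rule poly_mapping_eqI) (simp add: C_mult_mon lookup_sum lookup_single when_def in_keys_iff)

lemma monom_as_sum: "m = (\<Sum>i\<in>keys m. single i (lookup m i))" for m :: "nat \<Rightarrow>\<^sub>0 nat"
  by (rule poly_mapping_eqI) (simp add: lookup_sum lookup_single when_def in_keys_iff)

lemma mon_sum: "mon (sum f A) = (\<Prod>i\<in>A. mon (f i))"
  by (induction A rule: infinite_finite_induct) (simp_all add: mon_add)

lemma pol_induct [case_names zero add mon]: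
  fixes p :: pol
  assumes "P 0" "\<And>p q. P p \<Longrightarrow> P q \<Longrightarrow> P (p + q)" "\<And>c m. P (C c * mon m)"
  shows "P p"
proof -
  have "P (\<Sum>m\<in>A. C (lookup p m) * mon m)" for A
    by (induction A rule: infinite_finite_induct) (use assms in auto)
  then show ?thesis using pol_as_sum by metis
qed

lemma lookup_C_mult: "lookup (C a * p) m = a * lookup p m"
  by (induction p rule: pol_induct)
     (simp_all add: distrib_left lookup_add C_mult_mon C_mult_single lookup_single when_def)

lemma deg_superset: "finite A \<Longrightarrow> keys m \<subseteq> A \<Longrightarrow> deg m = (\<Sum>i\<in>A. lookup m i)"
  unfolding deg_def by (rule sum.mono_neutral_left) (auto simp: in_keys_iff)

lemma deg_add: "deg (m + n) = deg m + deg n"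
proof -
  let ?A = "keys m \<union> keys n"
  have "keys (m + n) \<subseteq> ?A" by (rule Poly_Mapping.keys_add)
  then show ?thesis
    by (simp add: deg_superset[of ?A] lookup_add sum.distrib)
qed

lemma deg_0 [simp]: "deg 0 = 0" and deg_single [simp]: "deg (single i k) = k"
  by (auto simp: deg_def)

lemma deg_sum: "deg (sum f A) = (\<Sum>a\<in>A. deg (f a))"
  by (induction A rule: infinite_finite_induct) (simp_all add: deg_add)

subsection \<open>Linear extension of maps on monomials\<close>

definition lin :: "((nat \<Rightarrow>\<^sub>0 nat) \<Rightarrow> pol) \<Rightarrow> pol \<Rightarrow> pol" where
  "lin h p = (\<Sum>m\<in>keys p. C (lookup p m) * h m)"

lemma lin_superset: "finite A \<Longrightarrow> keys p \<subseteq> A \<Longrightarrow> lin h p = (\<Sum>m\<in>A. C (lookup p m) * h m)"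
  unfolding lin_def by (rule sum.mono_neutral_left) (auto simp: in_keys_iff)

lemma lin_0 [simp]: "lin h 0 = 0"
  by (simp add: lin_def)

lemma lin_add: "lin h (p + q) = lin h p + lin h q"
proof -
  let ?A = "keys p \<union> keys q"
  have "keys (p + q) \<subseteq> ?A" by (rule Poly_Mapping.keys_add)
  then show ?thesis
    by (simp add: lin_superset[of ?A] lookup_add sum.distrib C_add distrib_right)
qed

lemma lin_sum: "lin h (sum f A) = (\<Sum>a\<in>A. lin h (f a))"
  by (induction A rule: infinite_finite_induct) (simp_all add: lin_add)

lemma lin_single: "lin h (single m c) = C c * h m"
  by (cases "c = 0") (simp_all add: lin_def)

lemma lin_mon [simp]: "lin h (mon m) = h m"
  by (simp add: mon_def lin_single)

lemma lin_C_mult: "lin h (C c * p) = C c * lin h p"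
  by (induction p rule: pol_induct)
     (simp_all add: distrib_left lin_add C_mult_mon C_mult_single lin_single C_mult mult.assoc)

text \<open>The name stands for homogeneous component.\<close>

definition hom :: "nat \<Rightarrow> pol \<Rightarrow> pol" where
  "hom n = lin (\<lambda>m. if deg m = n then mon m else 0)"

lemma hom_0 [simp]: "hom n 0 = 0"
  and hom_add: "hom n (p + q) = hom n p + hom n q"
  and hom_sum: "hom n (sum f A) = (\<Sum>a\<in>A. hom n (f a))"
  and hom_C_mult: "hom n (C c * p) = C c * hom n p"
  and hom_mon: "hom n (mon m) = (if deg m = n then mon m else 0)"
  by (simp_all add: hom_def lin_add lin_sum lin_C_mult)

lemma lookup_hom: "lookup (hom n p) m = (if deg m = n then lookup p m else 0)"
  by (induction p rule: pol_induct)
     (auto simp: hom_add lookup_add hom_C_mult hom_mon lookup_C_mult lookup_mon)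

definition subst :: "(nat \<Rightarrow> pol) \<Rightarrow> pol \<Rightarrow> pol" where
  "subst \<sigma> = lin (\<lambda>m. \<Prod>i\<in>keys m. \<sigma> i ^ lookup m i)"

lemma subst_0 [simp]: "subst \<sigma> 0 = 0"
  and subst_add: "subst \<sigma> (p + q) = subst \<sigma> p + subst \<sigma> q"
  and subst_sum: "subst \<sigma> (sum f A) = (\<Sum>a\<in>A. subst \<sigma> (f a))"
  and subst_C_mult: "subst \<sigma> (C c * p) = C c * subst \<sigma> p"
  by (simp_all add: subst_def lin_add lin_sum lin_C_mult)

lemma subst_mon: 
  assumes "finite A" "keys m \<subseteq> A"
  shows "subst \<sigma> (mon m) = (\<Prod>i\<in>A. \<sigma> i ^ lookup m i)"
  unfolding subst_def lin_mon using assms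
  by (intro prod.mono_neutral_left) (auto simp: in_keys_iff)

lemma subst_mon_add: "subst \<sigma> (mon (m + n)) = subst \<sigma> (mon m) * subst \<sigma> (mon n)"
proof -
  let ?A = "keys m \<union> keys n"
  have "keys (m + n) \<subseteq> ?A" by (rule Poly_Mapping.keys_add)
  then show ?thesis
    by (simp add: subst_mon[of ?A] lookup_add power_add prod.distrib)
qed

lemma subst_mult: "subst \<sigma> (p * q) = subst \<sigma> p * subst \<sigma> q"
proof (induction p rule: pol_induct)
  case (mon c m)
  show ?case
  proof (induction q rule: pol_induct)
    case (mon d n)
    have "C c * mon m * (C d * mon n) = C (c * d) * mon (m + n)"
      by (simp only: C_mult mon_add mult_ac)
    then show ?case by (simp only: subst_C_mult subst_mon_add C_mult mult_ac)
  qed (simp_all add: distrib_left subst_add)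
qed (simp_all add: distrib_right subst_add)

lemma subst_C [simp]: "subst \<sigma> (C c) = C c"
  using subst_C_mult[of \<sigma> c "mon 0"] subst_mon[of "{}" 0 \<sigma>] by simp

lemma subst_1 [simp]: "subst \<sigma> 1 = 1"
  using subst_C[of \<sigma> 1] by simp

lemma subst_V [simp]: "subst \<sigma> (V i) = \<sigma> i"
  using subst_mon[of "{i}" "single i 1" \<sigma>] by (simp add: mon_single)

lemma subst_power: "subst \<sigma> (p ^ n) = subst \<sigma> p ^ n"
  by (induction n) (simp_all add: subst_mult)

lemma subst_prod: "subst \<sigma> (prod f A) = (\<Prod>a\<in>A. subst \<sigma> (f a))"
  by (induction A rule: infinite_finite_induct) (simp_all add: subst_mult)

lemmas subst_simps = subst_add subst_mult subst_power subst_sum subst_prod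

lemma mon_as_prod: "mon m = (\<Prod>i\<in>keys m. V i ^ lookup m i)"
  by (subst monom_as_sum) (simp add: mon_sum mon_single)

lemma subst_subst: "subst \<sigma> (subst \<tau> p) = subst (\<lambda>i. subst \<sigma> (\<tau> i)) p"
proof (induction p rule: pol_induct)
  case (mon c m)
  then show ?case
    by (simp add: subst_C_mult subst_mult subst_mon[of "keys m"] subst_simps)
qed (simp_all add: subst_add)

lemma subst_V_id [simp]: "subst V p = p"
proof (induction p rule: pol_induct)
  case (mon c m)
  then show ?case by (simp add: subst_C_mult subst_mon[of "keys m"] flip: mon_as_prod)
qed (simp_all add: subst_add)

lemma subst_cong_vars:
  assumes "\<forall>m\<in>keys p. keys m \<subseteq> A" "\<And>i. i \<in> A \<Longrightarrow> \<sigma> i = \<tau> i"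
  shows "subst \<sigma> p = subst \<tau> p"
  unfolding subst_def lin_def using assms
  by (intro sum.cong refl arg_cong2[of _ _ _ _ "(*)"] prod.cong) (metis subset_iff)

subsection \<open>Degrees\<close>

definition lowdeg :: "nat \<Rightarrow> pol \<Rightarrow> bool" where
  "lowdeg d p \<longleftrightarrow> (\<forall>m\<in>keys p. deg m \<le> d)"

definition highdeg :: "nat \<Rightarrow> pol \<Rightarrow> bool" where
  "highdeg d p \<longleftrightarrow> (\<forall>m\<in>keys p. d \<le> deg m)"

lemma keys_add_cases: "m \<in> keys (p + q) \<Longrightarrow> m \<in> keys p \<or> m \<in> keys q"
  for p q :: "'a \<Rightarrow>\<^sub>0 'b::monoid_add"
  using Poly_Mapping.keys_add[of p q] by auto

lemma keys_mult_cases: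
  fixes p q :: pol
  assumes "m \<in> keys (p * q)"
  obtains a b where "a \<in> keys p" "b \<in> keys q" "m = a + b"
  using assms keys_mult[of p q] by auto

lemma keys_sum_cases:
  fixes f :: "'c \<Rightarrow> 'a \<Rightarrow>\<^sub>0 'b::comm_monoid_add"
  shows "m \<in> keys (sum f A) \<Longrightarrow> \<exists>a\<in>A. m \<in> keys (f a)"
proof (induction A rule: infinite_finite_induct)
  case (insert x A)
  then show ?case using keys_add_cases[of m "f x" "sum f A"] by auto
qed simp_all

lemma lowdeg_add: "lowdeg d p \<Longrightarrow> lowdeg d q \<Longrightarrow> lowdeg d (p + q)"
  by (auto simp: lowdeg_def dest: keys_add_cases)

lemma lowdeg_mult: "lowdeg d p \<Longrightarrow> lowdeg e q \<Longrightarrow> lowdeg (d + e) (p * q)"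
  by (auto simp: lowdeg_def deg_add add_mono elim!: keys_mult_cases)

lemma highdeg_add: "highdeg d p \<Longrightarrow> highdeg d q \<Longrightarrow> highdeg d (p + q)"
  by (auto simp: highdeg_def dest: keys_add_cases)

lemma highdeg_mult: "highdeg d p \<Longrightarrow> highdeg e q \<Longrightarrow> highdeg (d + e) (p * q)"
  by (auto simp: highdeg_def deg_add add_mono elim!: keys_mult_cases)

lemma lowdeg_V: "1 \<le> d \<Longrightarrow> lowdeg d (V i)" and highdeg_V: "highdeg 1 (V i)"
  and lowdeg_1: "lowdeg d 1" and highdeg_1: "highdeg 0 p"
  by (auto simp: lowdeg_def highdeg_def V_def)

lemma lowdeg_power: "lowdeg d p \<Longrightarrow> lowdeg (d * n) (p ^ n)"
  by (induction n) (simp_all add: lowdeg_1 lowdeg_mult)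

lemma highdeg_power: "highdeg d p \<Longrightarrow> highdeg (d * n) (p ^ n)"
  by (induction n) (simp_all add: highdeg_1 highdeg_mult)

lemma hom_eq_0: "(\<And>m. m \<in> keys p \<Longrightarrow> deg m \<noteq> n) \<Longrightarrow> hom n p = 0"
  by (rule poly_mapping_eqI) (auto simp: lookup_hom in_keys_iff)

lemma hom_eq_self: "(\<And>m. m \<in> keys p \<Longrightarrow> deg m = n) \<Longrightarrow> hom n p = p"
  by (rule poly_mapping_eqI) (auto simp: lookup_hom in_keys_iff)

lemma keys_hom: "keys (hom n p) = {m \<in> keys p. deg m = n}"
  by (auto simp: in_keys_iff lookup_hom split: if_splits)

lemma hom_mult_left:
  assumes "\<And>m. m \<in> keys p \<Longrightarrow> deg m = k"
  shows "hom (k + n) (p * q) = p * hom n q"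
proof (induction q rule: pol_induct)
  case (mon c m)
  have "deg a = k + deg m" if a: "a \<in> keys (p * (C c * mon m))" for a
  proof -
    obtain x y where "x \<in> keys p" "y \<in> keys (single m c)" "a = x + y"
      using a unfolding C_mult_mon by (rule keys_mult_cases)
    then show ?thesis using assms[of x] by (auto simp: deg_add split: if_splits)
  qed
  then have "hom (k + n) (p * (C c * mon m)) = (if deg m = n then p * (C c * mon m) else 0)"
    using hom_eq_self[of "p * (C c * mon m)" "k + n"] hom_eq_0[of "p * (C c * mon m)" "k + n"] by auto
  then show ?case
    by (simp add: hom_C_mult hom_mon)
qed (simp_all add: distrib_left hom_add)

text \<open>After splitting off its part of degree \<open>d\<close>, the rest of \<open>p\<close>
  has degree below \<open>d\<close>, so its products with \<open>q\<close> stay below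
  \<open>d + e\<close>.\<close>

lemma hom_mult_top:
  assumes "lowdeg d p" "lowdeg e q"
  shows "hom (d + e) (p * q) = hom d p * hom e q"
proof -
  have p: "p = hom d p + (p + hom d p)" by simp
  have "hom (d + e) ((p + hom d p) * q) = 0"
  proof (rule hom_eq_0)
    fix m assume "m \<in> keys ((p + hom d p) * q)"
    then obtain a b where a: "a \<in> keys (p + hom d p)" and b: "b \<in> keys q" and m: "m = a + b"
      by (rule keys_mult_cases)
    from a have "a \<in> keys p" "deg a \<noteq> d"
      by (auto simp: in_keys_iff lookup_add lookup_hom split: if_splits)
    then have "deg a < d" "deg b \<le> e"
      using assms b by (auto simp: lowdeg_def le_neq_implies_less)
    then show "deg m \<noteq> d + e" by (simp add: m deg_add)
  qed
  then have "hom (d + e) (hom d p * q + (p + hom d p) * q) = hom (d + e) (hom d p * q)"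
    by (simp only: hom_add add_0_right)
  then have "hom (d + e) (p * q) = hom (d + e) (hom d p * q)"
    by (simp only: p[symmetric] flip: distrib_right)
  also have "\<dots> = hom d p * hom e q"
    by (rule hom_mult_left) (simp add: keys_hom)
  finally show ?thesis .
qed

lemma hom_power_top: "lowdeg d p \<Longrightarrow> hom (d * n) (p ^ n) = hom d p ^ n"
proof (induction n)
  case 0
  then show ?case using hom_mon[of 0 0] by simp
next
  case (Suc n)
  then show ?case using hom_mult_top[of d p "d * n" "p ^ n"] by (simp add: lowdeg_power)
qed

lemma hom_prod_top:
  assumes "\<And>i. i \<in> A \<Longrightarrow> lowdeg (d i) (p i)"
  shows "hom (sum d A) (prod p A) = (\<Prod>i\<in>A. hom (d i) (p i)) \<and> lowdeg (sum d A) (prod p A)"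
  using assms
proof (induction A rule: infinite_finite_induct)
  case (infinite A)
  then show ?case using hom_mon[of 0 0] by (simp add: lowdeg_1)
next
  case empty
  then show ?case using hom_mon[of 0 0] by (simp add: lowdeg_1)
next
  case (insert x A)
  then show ?case by (simp add: hom_mult_top lowdeg_mult)
qed

definition lform :: "nat \<Rightarrow> (nat \<Rightarrow> F) \<Rightarrow> pol" where
  "lform t c = (\<Sum>k<t. C (c k) * V k)"

lemma keys_lform: "m \<in> keys (lform t c) \<Longrightarrow> \<exists>k<t. m = single k 1"
  unfolding lform_def by (auto dest!: keys_sum_cases simp: V_def C_mult_single split: if_splits)

lemma keys_power_deg:
  fixes p :: pol
  shows "(\<And>m. m \<in> keys p \<Longrightarrow> deg m = d) \<Longrightarrow> m \<in> keys (p ^ n) \<Longrightarrow> deg m = d * n"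
proof (induction n arbitrary: m)
  case (Suc n)
  from Suc.prems(2) obtain a b where "a \<in> keys p" "b \<in> keys (p ^ n)" "m = a + b"
    unfolding power_Suc by (rule keys_mult_cases)
  then show ?case using Suc.IH[OF Suc.prems(1)] Suc.prems(1) by (simp add: deg_add)
qed simp

lemma keys_prod_deg:
  fixes f :: "'c \<Rightarrow> pol"
  shows "(\<And>i m. i \<in> A \<Longrightarrow> m \<in> keys (f i) \<Longrightarrow> deg m = d i) \<Longrightarrow> m \<in> keys (prod f A) \<Longrightarrow> deg m = sum d A"
proof (induction A arbitrary: m rule: infinite_finite_induct)
  case (insert x A)
  from insert.prems(2) insert.hyps obtain a b where "a \<in> keys (f x)" "b \<in> keys (prod f A)" "m = a + b"
    by (auto elim: keys_mult_cases)
  then show ?case using insert by (simp add: deg_add)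
qed simp_all

lemma keys_subst_mon_deg:
  assumes "\<And>i m. m \<in> keys (\<sigma> i) \<Longrightarrow> deg m = 1" "n \<in> keys (subst \<sigma> (mon m))"
  shows "deg n = deg m"
proof -
  have "n \<in> keys (\<Prod>i\<in>keys m. \<sigma> i ^ lookup m i)"
    using assms(2) subst_mon[of "keys m" m \<sigma>] by simp
  then have "deg n = (\<Sum>i\<in>keys m. 1 * lookup m i)"
    by (rule keys_prod_deg[rotated]) (metis keys_power_deg assms(1))
  then show ?thesis by (simp add: deg_def)
qed

lemma hom_subst:
  assumes "\<And>i m. m \<in> keys (\<sigma> i) \<Longrightarrow> deg m = 1"
  shows "hom n (subst \<sigma> p) = subst \<sigma> (hom n p)"
proof (induction p rule: pol_induct)
  case (mon c m)
  have d: "deg n' = deg m" if "n' \<in> keys (subst \<sigma> (mon m))" for n'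
    using that assms keys_subst_mon_deg by blast
  have "hom n (subst \<sigma> (mon m)) = (if deg m = n then subst \<sigma> (mon m) else 0)"
  proof (cases "deg m = n")
    case True
    then show ?thesis using d by (simp add: hom_eq_self)
  next
    case False
    then show ?thesis using d by (simp add: hom_eq_0)
  qed
  then show ?case
    by (simp add: subst_C_mult hom_C_mult hom_mon)
qed (simp_all add: subst_add hom_add)

section \<open>The total square and the hit polynomials\<close>

text \<open>
  The total square \<open>\<Sum>\<^sub>k Sq\<^sup>k\<close> is the algebra homomorphism \<open>x\<^sub>i \<mapsto> x\<^sub>i + x\<^sub>i\<^sup>2\<close>. After
  an extension of scalars we also use coordinates that are permuted by the Frobenius map \<open>\<pi>\<close>; in these
  it becomes \<open>y\<^sub>i \<mapsto> y\<^sub>i + y\<^bsub>\<pi> i\<^esub>\<^sup>2\<close>.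
\<close>

definition tsq :: "(nat \<Rightarrow> nat) \<Rightarrow> pol \<Rightarrow> pol" where
  "tsq \<pi> = subst (\<lambda>i. V i + V (\<pi> i) ^ 2)"

text \<open>The polynomial \<open>u\<close> need not be homogeneous: its part of degree
  \<open>d\<close> contributes the square of index \<open>n - d\<close> applied to it, so a single
  \<open>u\<close> encodes a whole sum of hit terms.\<close>

definition hit :: "(nat \<Rightarrow> nat) \<Rightarrow> nat \<Rightarrow> pol set" where
  "hit \<pi> n = {hom n (tsq \<pi> u) | u. \<forall>m\<in>keys u. deg m < n}"

lemma hitI: "(\<And>m. m \<in> keys u \<Longrightarrow> deg m < n) \<Longrightarrow> p = hom n (tsq \<pi> u) \<Longrightarrow> p \<in> hit \<pi> n"
  by (auto simp: hit_def)

lemma hit_0 [simp]: "0 \<in> hit \<pi> n"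
  by (rule hitI[of 0]) (auto simp: tsq_def)

lemma hit_add: "p \<in> hit \<pi> n \<Longrightarrow> q \<in> hit \<pi> n \<Longrightarrow> p + q \<in> hit \<pi> n"
proof -
  assume "p \<in> hit \<pi> n" "q \<in> hit \<pi> n"
  then obtain u v where "\<forall>m\<in>keys u. deg m < n" "p = hom n (tsq \<pi> u)"
    "\<forall>m\<in>keys v. deg m < n" "q = hom n (tsq \<pi> v)" by (auto simp: hit_def)
  then show ?thesis
    by (intro hitI[of "u + v"]) (auto simp: tsq_def subst_add hom_add dest: keys_add_cases)
qed

lemma hit_C_mult: "p \<in> hit \<pi> n \<Longrightarrow> C c * p \<in> hit \<pi> n"
proof -
  assume "p \<in> hit \<pi> n"
  then obtain u where "\<forall>m\<in>keys u. deg m < n" "p = hom n (tsq \<pi> u)" by (auto simp: hit_def)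
  then show ?thesis
    by (intro hitI[of "C c * u"])
       (auto simp: tsq_def subst_C_mult hom_C_mult in_keys_iff lookup_C_mult)
qed

lemma hit_sum: "(\<And>a. a \<in> A \<Longrightarrow> f a \<in> hit \<pi> n) \<Longrightarrow> sum f A \<in> hit \<pi> n"
  by (induction A rule: infinite_finite_induct) (auto intro: hit_add)

lemma hit_cancel: "p + q \<in> hit \<pi> n \<Longrightarrow> q \<in> hit \<pi> n \<Longrightarrow> p \<in> hit \<pi> n"
  using hit_add[of "p + q" \<pi> n q] by (simp only: add.assoc add_self add_0_right)

text \<open>Both sides of the commutation are algebra homomorphisms, so it suffices to check it on
  variables. Allowing two different twists covers the passage between the ordinary and the conjugate
  coordinates.\<close>

lemma hit_subst:
  assumes lin: "\<And>i m. m \<in> keys (\<sigma> i) \<Longrightarrow> deg m = 1"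
    and comm: "\<And>i. \<sigma> i + \<sigma> (\<pi> i) ^ 2 = tsq \<rho> (\<sigma> i)"
    and p: "p \<in> hit \<pi> n"
  shows "subst \<sigma> p \<in> hit \<rho> n"
proof -
  obtain u where u: "\<forall>m\<in>keys u. deg m < n" and p: "p = hom n (tsq \<pi> u)"
    using p by (auto simp: hit_def)
  have "subst \<sigma> (tsq \<pi> u) = tsq \<rho> (subst \<sigma> u)"
    unfolding tsq_def subst_subst by (simp add: subst_simps comm[unfolded tsq_def])
  then have "subst \<sigma> p = hom n (tsq \<rho> (subst \<sigma> u))"
    by (simp add: p flip: hom_subst[OF lin])
  moreover have "deg m < n" if m: "m \<in> keys (subst \<sigma> u)" for m
  proof -
    have "lookup (hom (deg m) (subst \<sigma> u)) m \<noteq> 0"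
      using m by (simp add: lookup_hom in_keys_iff)
    then have "hom (deg m) u \<noteq> 0"
      by (auto simp: hom_subst[OF lin])
    then obtain k where "k \<in> keys u" "deg k = deg m"
      using hom_eq_0[of u "deg m"] by blast
    then show ?thesis using u by auto
  qed
  ultimately show ?thesis by (intro hitI)
qed

text \<open>Above the degree \<open>n\<close> nothing contributes, since the total square does not lower degrees.\<close>

lemma highdeg_tsq_mon: "highdeg (deg m) (tsq \<pi> (mon m))"
proof -
  have "highdeg (\<Sum>i\<in>A. lookup m i) (\<Prod>i\<in>A. (V i + V (\<pi> i) ^ 2) ^ lookup m i)" for A
  proof (induction A rule: infinite_finite_induct)
    case (insert x A)
    have "highdeg 1 (V (\<pi> x) ^ 2)"
      using highdeg_power[OF highdeg_V[of "\<pi> x"], of 2] by (auto simp: highdeg_def)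
    then have "highdeg (1 * lookup m x) ((V x + V (\<pi> x) ^ 2) ^ lookup m x)"
      by (intro highdeg_power highdeg_add highdeg_V)
    then show ?case using insert by (simp add: highdeg_mult del: power_Suc)
  qed (simp_all add: highdeg_1)
  then show ?thesis by (simp add: tsq_def deg_def subst_mon[of "keys m"])
qed

lemma hom_tsq_mon_0: "n < deg m \<Longrightarrow> hom n (tsq \<pi> (mon m)) = 0"
  using highdeg_tsq_mon[of m \<pi>] by (intro hom_eq_0) (auto simp: highdeg_def)

lemma tsq_as_sum: "tsq \<pi> u = (\<Sum>m\<in>keys u. C (lookup u m) * tsq \<pi> (mon m))"
  by (subst pol_as_sum) (simp add: tsq_def subst_sum subst_C_mult)

text \<open>Monomials of degree above \<open>n\<close> contribute nothing in degree
  \<open>n\<close>, so only degree \<open>n\<close> itself, where the total square acts as the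
  identity, has to be avoided.\<close>

lemma hit_tsq:
  assumes "\<And>m. m \<in> keys u \<Longrightarrow> deg m \<noteq> n"
  shows "hom n (tsq \<pi> u) \<in> hit \<pi> n"
  unfolding tsq_as_sum[of \<pi> u] hom_sum hom_C_mult
proof (intro hit_sum hit_C_mult)
  fix m assume "m \<in> keys u"
  with assms have "deg m < n \<or> n < deg m" by (metis nat_neq_iff)
  then show "hom n (tsq \<pi> (mon m)) \<in> hit \<pi> n"
    by (auto simp: hom_tsq_mon_0 intro: hitI[of "mon m"])
qed

subsection \<open>Wood's criterion\<close>

fun popcount :: "nat \<Rightarrow> nat" where
  "popcount n = (if n = 0 then 0 else n mod 2 + popcount (n div 2))"

declare popcount.simps [simp del]

lemma popcount_0 [simp]: "popcount 0 = 0"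
  by (simp add: popcount.simps)

lemma popcount_double [simp]: "popcount (2 * n) = popcount n"
  by (cases "n = 0") (simp_all add: popcount.simps[of "2 * n"])

lemma popcount_Suc_double [simp]: "popcount (Suc (2 * n)) = Suc (popcount n)"
  by (simp add: popcount.simps[of "Suc (2 * n)"])

lemma popcount_1 [simp]: "popcount (Suc 0) = 1"
  using popcount_Suc_double[of 0] by simp

lemma popcount_power_2 [simp]: "popcount (2 ^ k) = 1"
  by (induction k) simp_all

text \<open>Carries can only reduce the number of binary ones. In consequence a sum of
  \<open>k\<close> powers of two has at most \<open>k\<close> ones.\<close>

lemma popcount_add: "popcount (a + b) \<le> popcount a + popcount b"
proof (induction "a + b" arbitrary: a b rule: less_induct)
  case less
  obtain x where x: "a = 2 * x \<or> a = Suc (2 * x)" using oddE evenE by (metis Suc_eq_plus1)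
  obtain y where y: "b = 2 * y \<or> b = Suc (2 * y)" using oddE evenE by (metis Suc_eq_plus1)
  consider "a + b = 0" | "a + b > 0" "a = 2 * x" "b = 2 * y" | "a = Suc (2 * x)" "b = 2 * y"
    | "a = 2 * x" "b = Suc (2 * y)" | "a = Suc (2 * x)" "b = Suc (2 * y)"
    using x y by fastforce
  then show ?case
  proof cases
    case 2
    then have "popcount (x + y) \<le> popcount x + popcount y" by (intro less) auto
    then show ?thesis using 2 popcount_double[of "x + y"] by (simp add: distrib_left)
  next
    case 3
    then have "popcount (x + y) \<le> popcount x + popcount y" by (intro less) auto
    then show ?thesis using 3 popcount_Suc_double[of "x + y"] by (simp add: distrib_left)
  next
    case 4
    then have "popcount (x + y) \<le> popcount x + popcount y" by (intro less) auto
    then show ?thesis using 4 popcount_Suc_double[of "x + y"] by (simp add: distrib_left)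
  next
    case 5
    \<comment> \<open>Two odd summands produce a carry, which is absorbed into
      \<open>y\<close>.\<close>
    then have "popcount (x + (y + 1)) \<le> popcount x + popcount (y + 1)" by (intro less) auto
    moreover have "popcount (y + 1) \<le> popcount y + popcount 1" using 5 by (intro less) auto
    ultimately show ?thesis using 5 popcount_double[of "x + (y + 1)"] by (simp add: distrib_left)
  qed simp
qed

definition odds :: "(nat \<Rightarrow>\<^sub>0 nat) \<Rightarrow> nat set" where
  "odds m = {i. odd (lookup m i)}"

lemma odds_subset: "odds m \<subseteq> keys m"
  by (auto simp: odds_def in_keys_iff dest: odd_pos)

lemma finite_odds [simp]: "finite (odds m)"
  using odds_subset finite_subset finite_keys by metis

lemma odds_add_double [simp]: "odds (m + (n + n)) = odds m"
  by (auto simp: odds_def lookup_add)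

lemma odds_0 [simp]: "odds 0 = {}"
  by (simp add: odds_def)

lemma odds_double [simp]: "odds (n + n) = {}"
  by (auto simp: odds_def lookup_add)

definition ind :: "nat set \<Rightarrow> (nat \<Rightarrow>\<^sub>0 nat)" where
  "ind S = (\<Sum>i\<in>S. single i 1)"

lemma lookup_ind: "finite S \<Longrightarrow> lookup (ind S) i = (if i \<in> S then 1 else 0)"
  by (simp add: ind_def lookup_sum lookup_single when_def)

lemma deg_ind: "deg (ind S) = card S"
  by (simp add: ind_def deg_sum)

lemma mon_ind: "mon (ind S) = (\<Prod>i\<in>S. V i)"
  using mon_single[of _ 1] by (simp add: ind_def mon_sum)

lemma monom_split: obtains h where "m = ind (odds m) + (h + h)"
proof
  define h where "h = Poly_Mapping.map (\<lambda>k. k div 2) m"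
  have "lookup h i = lookup m i div 2" for i
    by (simp add: h_def map.rep_eq when_def)
  moreover have "lookup (ind (odds m)) i = lookup m i mod 2" for i
    by (auto simp: lookup_ind) (auto simp: odds_def odd_iff_mod_2_eq_one)
  ultimately have "lookup (ind (odds m) + (h + h)) i = lookup m i" for i
    by (simp add: lookup_add) presburger
  then show "m = ind (odds m) + (h + h)" by (metis poly_mapping_eqI)
qed

lemma highdeg_mult_right: "highdeg d p \<Longrightarrow> highdeg d (p * q)"
  using highdeg_mult[of d p 0 q] highdeg_1 by simp

text \<open>Expanding the first product, every term other than the second product contains some
  \<open>r i\<close>.\<close>

lemma highdeg_prod_diff:
  assumes "finite A" "\<And>i. i \<in> A \<Longrightarrow> highdeg d (r i)"
  shows "highdeg d ((\<Prod>i\<in>A. p i + r i) + (\<Prod>i\<in>A. p i))"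
  using assms
proof (induction A rule: finite_induct)
  case empty
  then show ?case by (simp add: highdeg_def)
next
  case (insert x A)
  let ?P = "\<Prod>i\<in>A. p i + r i" and ?Q = "\<Prod>i\<in>A. p i"
  have "(p x + r x) * ?P + p x * ?Q = (?P + ?Q) * p x + r x * ?P"
    by (simp add: algebra_simps)
  moreover have "highdeg d ((?P + ?Q) * p x)" "highdeg d (r x * ?P)"
    by (rule highdeg_mult_right; use insert in auto)+
  ultimately show ?case using insert highdeg_add by simp
qed

text \<open>The element \<open>\<chi>(y\<^sub>i) = y\<^sub>i + y\<^bsub>\<pi> i\<^esub>\<^sup>2 + \<dots>\<close>; its total square telescopes to \<open>y\<^sub>i\<close>
  up to a term of high degree.\<close>

definition conj_var :: "(nat \<Rightarrow> nat) \<Rightarrow> nat \<Rightarrow> nat \<Rightarrow> pol" where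
  "conj_var \<pi> N i = (\<Sum>a<N. V ((\<pi> ^^ a) i) ^ 2 ^ a)"

lemma tsq_conj_var: "tsq \<pi> (conj_var \<pi> N i) = V i + V ((\<pi> ^^ N) i) ^ 2 ^ N"
proof (induction N)
  case 0
  then show ?case by (simp add: conj_var_def tsq_def)
next
  case (Suc N)
  let ?a = "V ((\<pi> ^^ N) i) ^ 2 ^ N"
  have "tsq \<pi> ?a = ?a + V ((\<pi> ^^ Suc N) i) ^ 2 ^ Suc N"
    by (simp add: tsq_def subst_simps power_2_power_add flip: power_mult)
  moreover have "conj_var \<pi> (Suc N) i = conj_var \<pi> N i + ?a"
    by (simp add: conj_var_def)
  ultimately have "tsq \<pi> (conj_var \<pi> (Suc N) i)
      = (V i + ?a) + (?a + V ((\<pi> ^^ Suc N) i) ^ 2 ^ Suc N)"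
    using Suc by (simp only: tsq_def subst_add)
  then show ?case by (simp only: add.assoc add_cancel_char2)
qed

text \<open>Each factor contributes one power of two to the degree of a monomial.\<close>

lemma popcount_deg_conj:
  "finite A \<Longrightarrow> m \<in> keys (\<Prod>i\<in>A. conj_var \<pi> N i) \<Longrightarrow> popcount (deg m) \<le> card A"
proof (induction A arbitrary: m rule: finite_induct)
  case (insert x A)
  from insert.prems insert.hyps obtain a b where
    a: "a \<in> keys (conj_var \<pi> N x)" and b: "b \<in> keys (\<Prod>i\<in>A. conj_var \<pi> N i)" and m: "m = a + b"
    by (auto elim: keys_mult_cases)
  from a obtain k where "a \<in> keys (V ((\<pi> ^^ k) x) ^ 2 ^ k)"
    unfolding conj_var_def by (blast dest: keys_sum_cases)
  then have "deg a = 2 ^ k" by (simp flip: mon_single)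
  then show ?case
    using insert.IH[OF b] popcount_add[of "deg a" "deg b"] insert.hyps by (simp add: m deg_add)
qed simp

text \<open>The top square of a monomial is its square. With a twist the squared variables are also
  moved by \<open>\<pi>\<close>, so \<open>h'\<close> is \<open>h\<close> with its exponents
  relabelled to undo this.\<close>

lemma top_tsq_mon:
  assumes "bij \<pi>"
  obtains h' where "deg h' = deg h" "hom (2 * deg h) (tsq \<pi> (mon h')) = mon (h + h)"
proof
  define h' where "h' = Poly_Mapping.map_key \<pi> h"
  have inj: "inj \<pi>" using assms by (simp add: bij_is_inj)
  have l: "lookup h' i = lookup h (\<pi> i)" for i
    by (simp add: h'_def map_key.rep_eq inj)
  have "keys h' = \<pi> -` keys h" by (auto simp: in_keys_iff l)
  then have k: "keys h = \<pi> ` keys h'"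
    using assms by (simp add: bij_is_surj surj_image_vimage_eq)
  have injk: "inj_on \<pi> (keys h')" using inj inj_on_subset by blast
  show d: "deg h' = deg h"
    unfolding deg_def k using injk by (simp add: sum.reindex l)
  let ?p = "\<lambda>i. V i + V (\<pi> i) ^ 2"
  have V2: "V j ^ 2 = mon (single j 2)" for j by (simp add: mon_single)
  have V1: "V j = mon (single j 1)" for j by (simp add: mon_single)
  have low: "lowdeg 2 (?p i)" for i
    by (intro lowdeg_add lowdeg_V; simp add: V2 lowdeg_def)
  have "hom 2 (V i) = 0" "hom 2 (V (\<pi> i) ^ 2) = V (\<pi> i) ^ 2" for i
    by (simp_all only: V2 hom_mon) (simp_all add: V1 hom_mon)
  then have top: "hom 2 (?p i) = V (\<pi> i) ^ 2" for i
    by (simp add: hom_add)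
  have "tsq \<pi> (mon h') = (\<Prod>i\<in>keys h'. ?p i ^ lookup h' i)"
    by (simp add: tsq_def subst_mon[of "keys h'"])
  then have "hom (\<Sum>i\<in>keys h'. 2 * lookup h' i) (tsq \<pi> (mon h'))
      = (\<Prod>i\<in>keys h'. hom (2 * lookup h' i) (?p i ^ lookup h' i))"
    using hom_prod_top[of "keys h'" "\<lambda>i. 2 * lookup h' i" "\<lambda>i. ?p i ^ lookup h' i"]
    by (simp add: lowdeg_power low)
  also have "\<dots> = (\<Prod>i\<in>keys h'. (V (\<pi> i) ^ 2) ^ lookup h (\<pi> i))"
    by (simp add: hom_power_top[OF low] top l)
  also have "\<dots> = (\<Prod>j\<in>keys h. (V j ^ 2) ^ lookup h j)"
    unfolding k using injk by (simp add: prod.reindex)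
  also have "\<dots> = mon h * mon h"
    by (simp add: mon_as_prod power_mult_distrib power2_eq_square flip: prod.distrib)
  finally show "hom (2 * deg h) (tsq \<pi> (mon h')) = mon (h + h)"
    by (simp add: mon_add deg_def[of h'] flip: d sum_distrib_left)
qed

text \<open>
  Since \<open>y\<^sub>S h\<^sup>2 = y\<^sub>S Sq\<^sup>d(h)\<close> with \<open>d = deg h\<close> is congruent to \<open>\<chi>(Sq\<^sup>d)(y\<^sub>S) h\<close> modulo hit polynomials,
  it is hit unless \<open>d + |S|\<close> is a sum of \<open>|S|\<close> powers of two.
\<close>

lemma hit_mon:
  assumes "bij \<pi>" and pc: "card (odds e) < popcount ((deg e + card (odds e)) div 2)"
  shows "mon e \<in> hit \<pi> (deg e)"
proof -
  let ?S = "odds e"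
  obtain h where e: "e = ind ?S + (h + h)" by (rule monom_split)
  obtain h' where h': "deg h' = deg h" "hom (2 * deg h) (tsq \<pi> (mon h')) = mon (h + h)"
    using top_tsq_mon[OF assms(1)] by metis
  define n where "n = deg e"
  have n: "n = card ?S + 2 * deg h"
    unfolding n_def by (subst e) (simp add: deg_add deg_ind)
  define u where "u = (\<Prod>i\<in>?S. conj_var \<pi> n i) * mon h'"
  let ?r = "\<lambda>i. V ((\<pi> ^^ n) i) ^ 2 ^ n" and ?T = "tsq \<pi> (mon h')"
  let ?R = "(\<Prod>i\<in>?S. V i + ?r i) + (\<Prod>i\<in>?S. V i)"
  have "tsq \<pi> u = (\<Prod>i\<in>?S. V i + ?r i) * ?T"
    unfolding u_def tsq_def subst_mult subst_prod using tsq_conj_var by (simp add: tsq_def)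
  then have tsq: "tsq \<pi> u = (\<Prod>i\<in>?S. V i) * ?T + ?R * ?T"
    by (simp add: distrib_right)
  \<comment> \<open>Because \<open>2 ^ n\<close> exceeds \<open>n\<close>, cutting
    \<open>conj_var\<close> off after \<open>n\<close> terms leaves an error that is invisible in
    degree \<open>n\<close>.\<close>
  have "highdeg (2 ^ n) (?r i)" for i
    using highdeg_power[OF highdeg_V[of "(\<pi> ^^ n) i"], of "2 ^ n"] by simp
  then have high: "highdeg (2 ^ n) (?R * ?T)"
    by (intro highdeg_mult_right highdeg_prod_diff) auto
  have "deg m \<noteq> n" if "m \<in> keys (?R * ?T)" for m
    using bspec[OF high[unfolded highdeg_def] that] less_exp[of n] by linarith
  then have "hom n (?R * ?T) = 0"
    by (rule hom_eq_0)
  moreover have "hom n ((\<Prod>i\<in>?S. V i) * ?T) = (\<Prod>i\<in>?S. V i) * hom (2 * deg h) ?T"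
    unfolding n by (rule hom_mult_left) (simp add: deg_ind flip: mon_ind)
  ultimately have "hom n (tsq \<pi> u) = mon e"
    by (subst e) (simp add: tsq hom_add h' mon_add mon_ind)
  moreover have "deg m \<noteq> n" if m: "m \<in> keys u" for m
  proof -
    obtain a where "a \<in> keys (\<Prod>i\<in>?S. conj_var \<pi> n i)" "m = a + h'"
      using m unfolding u_def by (auto elim: keys_mult_cases)
    then have "popcount (deg m - deg h) \<le> card ?S"
      using popcount_deg_conj[of ?S a \<pi> n] h' by (simp add: deg_add)
    \<comment> \<open>This is the degree that the conjugate factor would need for \<open>m\<close>
      to have degree \<open>n\<close>; by \<open>pc\<close> it has too many binary ones.\<close>
    moreover have "(n + card ?S) div 2 = n - deg h" using n by simp
    ultimately show ?thesis using pc by (auto simp flip: n_def)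
  qed
  ultimately show ?thesis
    using hit_tsq[of u n \<pi>] by (simp add: n_def)
qed

section \<open>Monomials in five variables\<close>

text \<open>Exponents as tuples, so that the finite checks on monomials can be evaluated.\<close>

type_synonym e5 = "nat \<times> nat \<times> nat \<times> nat \<times> nat"

fun mx :: "e5 \<Rightarrow> nat \<Rightarrow>\<^sub>0 nat" where
  "mx (a0, a1, a2, a3, a4) = single 0 a0 + single 1 a1 + single 2 a2 + single 3 a3 + single 4 a4"

declare mx.simps [simp del]

abbreviation mono :: "e5 \<Rightarrow> pol" where "mono t \<equiv> mon (mx t)"

fun deg5 :: "e5 \<Rightarrow> nat" where "deg5 (a0, a1, a2, a3, a4) = a0 + a1 + a2 + a3 + a4"

fun odds5 :: "e5 \<Rightarrow> nat" where
  "odds5 (a0, a1, a2, a3, a4) = a0 mod 2 + a1 mod 2 + a2 mod 2 + a3 mod 2 + a4 mod 2"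

lemma mono_eq: "mono (a0, a1, a2, a3, a4) = V 0 ^ a0 * V 1 ^ a1 * V 2 ^ a2 * V 3 ^ a3 * V 4 ^ a4"
  by (simp add: mx.simps mon_add mon_single)

lemma lookup_mx: "lookup (mx (a0, a1, a2, a3, a4)) i =
    (if i = 0 then a0 else if i = 1 then a1 else if i = 2 then a2 else if i = 3 then a3
     else if i = 4 then a4 else 0)"
  by (simp add: mx.simps lookup_add lookup_single when_def)

lemma less5: "(i::nat) < 5 \<longleftrightarrow> i = 0 \<or> i = 1 \<or> i = 2 \<or> i = 3 \<or> i = 4"
  by auto

lemma lessThan5: "{..<5::nat} = {0, 1, 2, 3, 4}"
  by auto

lemma mx_lookup:
  assumes "keys m \<subseteq> {..<5}"
  shows "m = mx (lookup m 0, lookup m 1, lookup m 2, lookup m 3, lookup m 4)"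
proof (rule poly_mapping_eqI)
  fix i
  show "lookup m i = lookup (mx (lookup m 0, lookup m 1, lookup m 2, lookup m 3, lookup m 4)) i"
  proof (cases "i < 5")
    case True
    then show ?thesis unfolding lookup_mx less5 by auto
  next
    case False
    then have "i \<notin> keys m" using assms by auto
    with False show ?thesis unfolding lookup_mx less5 by (simp add: in_keys_iff)
  qed
qed

lemma mx_eq_iff [simp]: "mx s = mx t \<longleftrightarrow> s = t"
proof
  assume eq: "mx s = mx t"
  obtain a0 a1 a2 a3 a4 b0 b1 b2 b3 b4 where st: "s = (a0, a1, a2, a3, a4)" "t = (b0, b1, b2, b3, b4)"
    by (metis prod_cases5)
  have "lookup (mx s) i = lookup (mx t) i" for i by (simp add: eq)
  from this[of 0] this[of 1] this[of 2] this[of 3] this[of 4] show "s = t"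
    by (simp add: st lookup_mx)
qed simp

lemma keys_mx: "keys (mx t) \<subseteq> {..<5}"
  by (cases t) (auto simp: in_keys_iff lookup_mx split: if_splits)

lemma deg_mx [simp]: "deg (mx t) = deg5 t"
  by (cases t) (simp add: mx.simps deg_add)

lemma card_odds_mx [simp]: "card (odds (mx t)) = odds5 t"
proof -
  obtain a0 a1 a2 a3 a4 where t: "t = (a0, a1, a2, a3, a4)" by (metis prod_cases5)
  have "odds (mx t) \<subseteq> {..<5}" using odds_subset keys_mx by blast
  then have "card (odds (mx t)) = (\<Sum>i<5. if i \<in> odds (mx t) then 1 else 0)"
    by (simp add: sum.If_cases Int_absorb1)
  also have "\<dots> = (\<Sum>i<5. lookup (mx t) i mod 2)"
    by (rule sum.cong) (auto simp: odds_def odd_iff_mod_2_eq_one)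
  also have "\<dots> = odds5 t"
    by (simp add: t lookup_mx lessThan5)
  finally show ?thesis .
qed

fun add_double :: "e5 \<Rightarrow> e5 \<Rightarrow> e5" where
  "add_double (a0, a1, a2, a3, a4) (b0, b1, b2, b3, b4) =
    (a0 + 2 * b0, a1 + 2 * b1, a2 + 2 * b2, a3 + 2 * b3, a4 + 2 * b4)"

declare add_double.simps [simp del]

lemma mx_add_double: "mx (add_double s t) = mx s + (mx t + mx t)"
  by (cases s; cases t; rule poly_mapping_eqI) (simp add: lookup_mx lookup_add add_double.simps)

lemma mono_add_double: "mono (add_double s t) = mono s * mono t ^ 2"
  by (simp add: mx_add_double mon_add power2_eq_square)

section \<open>The total square in conjugate coordinates\<close>

text \<open>The identity beyond the five variables makes it a bijection of all indices, which Wood's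
  criterion in the form \<open>hit_mon\<close> requires.\<close>

definition frob :: "nat \<Rightarrow> nat" where "frob i = (if i < 5 then (i + 4) mod 5 else i)"
definition rot :: "nat \<Rightarrow> nat" where "rot i = (if i < 5 then (i + 1) mod 5 else i)"

lemma frob_simps [simp]: "frob 0 = 4" "frob 1 = 0" "frob (Suc 0) = 0" "frob 2 = 1" "frob 3 = 2" "frob 4 = 3"
  by (simp_all add: frob_def)

lemma rot_simps [simp]: "rot 0 = 1" "rot 1 = 2" "rot (Suc 0) = 2" "rot 2 = 3" "rot 3 = 4" "rot 4 = 0"
  by (simp_all add: rot_def)

lemma rot_frob [simp]: "rot (frob i) = i" and frob_rot [simp]: "frob (rot i) = i"
  by (cases "i < 5"; (unfold less5, auto simp: frob_def rot_def)[])+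

lemma bij_frob: "bij frob"
  by (rule o_bij[of rot]) (auto simp: fun_eq_iff)

text \<open>The \<open>j \<le> a\<close> for which the binomial coefficient \<open>a choose j\<close> is odd.\<close>

fun odd_binomials :: "nat \<Rightarrow> nat list" where
  "odd_binomials a = (if a = 0 then [0] else
     let js = map ((*) 2) (odd_binomials (a div 2)) in js @ (if odd a then map Suc js else []))"

declare odd_binomials.simps [simp del]

lemma square_sum_list: "(sum_list xs)\<^sup>2 = (\<Sum>x\<leftarrow>xs. x\<^sup>2)" for xs :: "'a::char2 list"
  by (induction xs) (simp_all add: square_add)

text \<open>Lucas's theorem, one binary digit at a time: the power is the square of the power with
  exponent \<open>a div 2\<close>, times \<open>x + y\<close> when \<open>a\<close> is odd, and
  squaring is additive.\<close>

lemma power_add_char2: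
  "set (odd_binomials a) \<subseteq> {..a} \<and> (x + y :: 'a::char2) ^ a = (\<Sum>j\<leftarrow>odd_binomials a. x ^ (a - j) * y ^ j)"
proof (induction a rule: less_induct)
  case (less a)
  show ?case
  proof (cases "a = 0")
    case False
    let ?js = "odd_binomials (a div 2)" and ?b = "a div 2"
    have IH: "set ?js \<subseteq> {..?b}" "(x + y) ^ ?b = (\<Sum>j\<leftarrow>?js. x ^ (?b - j) * y ^ j)"
      using less.IH[of ?b] False by auto
    have "(x ^ (?b - j) * y ^ j)\<^sup>2 = x ^ (2 * ?b - 2 * j) * y ^ (2 * j)" for j
      by (simp add: power_mult_distrib diff_mult_distrib diff_mult_distrib2 mult.commute flip: power_mult)
    then have "((x + y) ^ ?b)\<^sup>2 = (\<Sum>j\<leftarrow>?js. x ^ (2 * ?b - 2 * j) * y ^ (2 * j))"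
      unfolding IH(2) square_sum_list by (simp add: o_def)
    then have sq: "(x + y) ^ (2 * ?b) = (\<Sum>j\<leftarrow>?js. x ^ (2 * ?b - 2 * j) * y ^ (2 * j))"
      by (metis mult.commute power_mult)
    show ?thesis
    proof (cases "odd a")
      case True
      then have a: "a = Suc (2 * ?b)" by simp
      have "(x + y) ^ a = x * (x + y) ^ (2 * ?b) + (x + y) ^ (2 * ?b) * y"
        by (subst a) (simp add: algebra_simps)
      also have "x * (x + y) ^ (2 * ?b) = (\<Sum>j\<leftarrow>?js. x ^ (a - 2 * j) * y ^ (2 * j))"
        unfolding sq sum_list_const_mult[symmetric]
      proof (intro arg_cong[of _ _ sum_list] map_cong refl)
        fix j assume "j \<in> set ?js"
        then have "j \<le> ?b" using IH(1) by auto
        then have "a - 2 * j = Suc (2 * ?b - 2 * j)" using a by linarith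
        then show "x * (x ^ (2 * ?b - 2 * j) * y ^ (2 * j)) = x ^ (a - 2 * j) * y ^ (2 * j)"
          by (simp add: mult.assoc)
      qed
      also have "(x + y) ^ (2 * ?b) * y = (\<Sum>j\<leftarrow>?js. x ^ (a - Suc (2 * j)) * y ^ Suc (2 * j))"
        unfolding sq sum_list_mult_const[symmetric]
      proof (intro arg_cong[of _ _ sum_list] map_cong refl)
        fix j
        have "a - Suc (2 * j) = 2 * ?b - 2 * j" using a by linarith
        then show "x ^ (2 * ?b - 2 * j) * y ^ (2 * j) * y = x ^ (a - Suc (2 * j)) * y ^ Suc (2 * j)"
          by (simp add: mult_ac)
      qed
      finally have eq: "(x + y) ^ a = (\<Sum>j\<leftarrow>?js. x ^ (a - 2 * j) * y ^ (2 * j)) +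
          (\<Sum>j\<leftarrow>?js. x ^ (a - Suc (2 * j)) * y ^ Suc (2 * j))" .
      have "j \<in> set ?js \<Longrightarrow> Suc (2 * j) \<le> a" for j
        using IH(1) a by (metis Suc_le_mono atMost_iff mult_le_mono2 subset_iff)
      then show ?thesis
        using eq True False by (subst (1 2) odd_binomials.simps) (auto simp: Let_def o_def dest: Suc_leD)
    next
      case even: False
      then have "2 * ?b = a" by simp
      then show ?thesis
        using IH(1) sq even False by (subst (1 2) odd_binomials.simps) (auto simp: Let_def o_def)
    qed
  qed (simp add: odd_binomials.simps)
qed

text \<open>Choosing \<open>j1\<close> in the expansion of the power of \<open>y_1\<close> adds
  \<open>2 * j1\<close> to the exponent of \<open>y_0\<close>, since \<open>frob 1 = 0\<close>;
  hence every slot involves the next index. Repeated entries cancel in pairs when the list is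
  summed.\<close>

fun sq_terms :: "e5 \<Rightarrow> e5 list" where
  "sq_terms (a0, a1, a2, a3, a4) =
    [(a0 - j0 + 2 * j1, a1 - j1 + 2 * j2, a2 - j2 + 2 * j3, a3 - j3 + 2 * j4, a4 - j4 + 2 * j0).
      j0 \<leftarrow> odd_binomials a0, j1 \<leftarrow> odd_binomials a1, j2 \<leftarrow> odd_binomials a2,
      j3 \<leftarrow> odd_binomials a3, j4 \<leftarrow> odd_binomials a4]"

declare sq_terms.simps [simp del]

lemma sum_list_concat_map: "sum_list (map f (concat (map g xs))) = (\<Sum>x\<leftarrow>xs. sum_list (map f (g x)))"
  by (induction xs) simp_all

lemma tsq_mono: "tsq frob (mono t) = (\<Sum>s\<leftarrow>sq_terms t. mono s)"
proof -
  obtain a0 a1 a2 a3 a4 where t: "t = (a0, a1, a2, a3, a4)" by (metis prod_cases5)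
  have *: "tsq frob (V i ^ a) = (\<Sum>j\<leftarrow>odd_binomials a. V i ^ (a - j) * (V (frob i) ^ 2) ^ j)" for i a
    using power_add_char2[of a "V i" "V (frob i) ^ 2"] by (simp add: tsq_def subst_power)
  have "tsq frob (mono t) = tsq frob (V 0 ^ a0) * (tsq frob (V 1 ^ a1) * (tsq frob (V 2 ^ a2) *
      (tsq frob (V 3 ^ a3) * tsq frob (V 4 ^ a4))))"
    unfolding t mono_eq by (simp add: tsq_def subst_mult mult.assoc)
  also have "\<dots> = (\<Sum>j0\<leftarrow>odd_binomials a0. \<Sum>j1\<leftarrow>odd_binomials a1. \<Sum>j2\<leftarrow>odd_binomials a2.
      \<Sum>j3\<leftarrow>odd_binomials a3. \<Sum>j4\<leftarrow>odd_binomials a4.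
        mono (a0 - j0 + 2 * j1, a1 - j1 + 2 * j2, a2 - j2 + 2 * j3, a3 - j3 + 2 * j4, a4 - j4 + 2 * j0))"
  proof -
    have f: "mono (a0 - j0 + 2 * j1, a1 - j1 + 2 * j2, a2 - j2 + 2 * j3, a3 - j3 + 2 * j4, a4 - j4 + 2 * j0) =
        (V 0 ^ (a0 - j0) * (V (frob 0) ^ 2) ^ j0) * ((V 1 ^ (a1 - j1) * (V (frob 1) ^ 2) ^ j1) *
        ((V 2 ^ (a2 - j2) * (V (frob 2) ^ 2) ^ j2) * ((V 3 ^ (a3 - j3) * (V (frob 3) ^ 2) ^ j3) *
        (V 4 ^ (a4 - j4) * (V (frob 4) ^ 2) ^ j4))))" for j0 j1 j2 j3 j4
      unfolding mono_eq by (simp add: power_add mult_ac flip: power_mult)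
    show ?thesis
      unfolding * f by (simp only: sum_list_const_mult sum_list_mult_const)
  qed
  also have "\<dots> = (\<Sum>s\<leftarrow>sq_terms t. mono s)"
    by (simp add: t sq_terms.simps sum_list_concat_map o_def)
  finally show ?thesis .
qed

section \<open>Squares as cofactors and hit polynomials in degree 42\<close>

lemma hom_sum_list: "hom n (sum_list ps) = (\<Sum>p\<leftarrow>ps. hom n p)"
  by (induction ps) (simp_all add: hom_add)

lemma hom_mono_list: "hom n (\<Sum>t\<leftarrow>ts. mono t) = (\<Sum>t\<leftarrow>filter (\<lambda>t. deg5 t = n) ts. mono t)"
  by (induction ts) (simp_all add: hom_add hom_mon)

lemma square_term: "(C c * mon m)\<^sup>2 = C (c\<^sup>2) * mon (m + m)"
  by (simp only: power2_eq_square C_mult mon_add mult_ac)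

lemma square_pol: "p\<^sup>2 = (\<Sum>m\<in>keys p. C ((lookup p m)\<^sup>2) * mon (m + m))"
  by (subst pol_as_sum) (simp only: square_sum square_term)

lemma keys_square: "k \<in> keys (p\<^sup>2) \<Longrightarrow> \<exists>m\<in>keys p. k = m + m" for p :: pol
  unfolding square_pol by (drule keys_sum_cases) (auto simp: C_mult_mon split: if_splits)

lemma hom_square: "hom (2 * n) (p\<^sup>2) = (hom n p)\<^sup>2"
proof (induction p rule: pol_induct)
  case (mon c m)
  then show ?case by (simp add: square_term hom_C_mult hom_mon deg_add)
qed (simp_all add: square_add hom_add)

lemma even_deg_odds: "even (deg m + card (odds m))"
proof -
  obtain h where "m = ind (odds m) + (h + h)" by (rule monom_split)
  then have "deg m = card (odds m) + 2 * deg h" by (metis deg_add deg_ind mult_2)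
  then show ?thesis by simp
qed

text \<open>The number of odd exponents has the parity of the degree, so it is 0 or 2. The halves 21
  = 16 + 4 + 1 and 22 = 16 + 4 + 2 have three binary ones, and Wood's criterion applies.\<close>

lemma hit_few_odds:
  assumes "\<And>m. m \<in> keys p \<Longrightarrow> deg m = 42 \<and> card (odds m) \<le> 3"
  shows "p \<in> hit frob 42"
proof (subst pol_as_sum, intro hit_sum hit_C_mult)
  fix m assume m: "m \<in> keys p"
  then have "even (card (odds m))" "card (odds m) \<le> 3"
    using even_deg_odds[of m] assms by auto
  then have "card (odds m) = 0 \<or> card (odds m) = 2" by presburger
  moreover have "popcount 21 = 3" "popcount 22 = 3" by code_simp+
  ultimately have "card (odds m) < popcount ((deg m + card (odds m)) div 2)"
    using assms[OF m] by auto
  then have "mon m \<in> hit frob (deg m)" by (intro hit_mon bij_frob)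
  then show "mon m \<in> hit frob 42" using assms[OF m] by simp
qed

lemma hom_tsq_bottom: "hom (deg m) (tsq \<pi> (mon m)) = mon m"
proof (induction "deg m" arbitrary: m)
  case 0
  then have "lookup m i = 0" for i by (cases "i \<in> keys m") (auto simp: deg_def in_keys_iff)
  then have "m = 0" by (simp add: poly_mapping_eqI)
  then show ?case using hom_mon[of 0 0] by (simp add: tsq_def)
next
  case (Suc d)
  then obtain i where i: "lookup m i \<noteq> 0" by (metis deg_0 lookup_zero nat.distinct(1) poly_mapping_eqI)
  define n where "n = m - single i 1"
  have m: "m = single i 1 + n"
    using i by (intro poly_mapping_eqI) (auto simp: n_def lookup_add lookup_minus lookup_single when_def)
  then have d: "deg n = d" "deg m = 1 + d" using Suc(2) by (simp_all add: deg_add)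
  let ?s = "tsq \<pi> (mon n)"
  have "tsq \<pi> (mon m) = V i * ?s + V (\<pi> i) ^ 2 * ?s"
    by (simp add: m mon_add mon_single tsq_def subst_mult distrib_right)
  moreover have "hom (1 + d) (V i * ?s) = V i * mon n"
    using hom_mult_left[of "V i" 1 d ?s] Suc(1)[of n] d by (simp add: V_def)
  moreover have "highdeg (2 + d) (V (\<pi> i) ^ 2 * ?s)"
    using highdeg_mult[OF highdeg_power[OF highdeg_V[of "\<pi> i"], of 2] highdeg_tsq_mon[of n \<pi>]] d by simp
  then have "hom (1 + d) (V (\<pi> i) ^ 2 * ?s) = 0"
    by (intro hom_eq_0) (auto simp: highdeg_def)
  ultimately have "hom (1 + d) (tsq \<pi> (mon m)) = V i * mon n"
    by (simp add: hom_add)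
  moreover have "mon m = V i * mon n" by (simp add: m mon_add mon_single)
  ultimately show ?case by (simp only: d(2))
qed

text \<open>After \<open>hit_few_odds\<close>, five variables in degree 42 leave only monomials with
  four odd exponents. Up to a cyclic shift the even one belongs to \<open>y_0\<close>, and such a
  monomial is \<open>X0\<close> times the square of one of degree 19.\<close>

definition X0 :: pol where "X0 = mono (0, 1, 1, 1, 1)"

text \<open>The total square of \<open>X0\<close> is \<open>X0\<close> plus terms with at most three
  odd exponents. A square factor does not change the number of odd exponents, so
  \<open>hit_few_odds\<close> disposes of everything except \<open>X0\<close> times the square of a
  hit polynomial.\<close>

lemma hit_X0_square:
  assumes "v \<in> hit frob 19"
  shows "X0 * v\<^sup>2 \<in> hit frob 42"
proof -
  obtain u where u: "\<forall>m\<in>keys u. deg m < 19" and v: "v = hom 19 (tsq frob u)"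
    using assms by (auto simp: hit_def)
  let ?s = "tsq frob u"
  obtain ts where ts: "sq_terms (0, 1, 1, 1, 1) = (0, 1, 1, 1, 1) # ts" "\<forall>t\<in>set ts. odds5 t \<le> 3"
    by (simp add: sq_terms.simps odd_binomials.simps)
  let ?R = "\<Sum>t\<leftarrow>ts. mono t"
  have "tsq frob X0 = X0 + ?R"
    by (simp only: X0_def tsq_mono ts(1) list.map sum_list.Cons)
  then have "tsq frob (X0 * u\<^sup>2) = (X0 + ?R) * ?s\<^sup>2"
    by (simp add: tsq_def subst_mult subst_power)
  then have "hom 42 (tsq frob (X0 * u\<^sup>2)) = hom 42 (X0 * ?s\<^sup>2) + hom 42 (?R * ?s\<^sup>2)"
    by (simp add: distrib_right hom_add)
  moreover have "hom (4 + 2 * 19) (X0 * ?s\<^sup>2) = X0 * hom (2 * 19) (?s\<^sup>2)"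
    by (rule hom_mult_left) (simp add: X0_def)
  ultimately have eq: "hom 42 (tsq frob (X0 * u\<^sup>2)) = X0 * v\<^sup>2 + hom 42 (?R * ?s\<^sup>2)"
    unfolding hom_square v by simp
  have "hom 42 (tsq frob (X0 * u\<^sup>2)) \<in> hit frob 42"
  proof (rule hit_tsq)
    fix m assume "m \<in> keys (X0 * u\<^sup>2)"
    then obtain a where "m = mx (0, 1, 1, 1, 1) + (a + a)" "a \<in> keys u"
      unfolding X0_def by (auto elim!: keys_mult_cases dest!: keys_square)
    then show "deg m \<noteq> 42" using u by (auto simp: deg_add)
  qed
  moreover have "hom 42 (?R * ?s\<^sup>2) \<in> hit frob 42"
  proof (rule hit_few_odds)
    fix m assume "m \<in> keys (hom 42 (?R * ?s\<^sup>2))"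
    then have d: "deg m = 42" and "m \<in> keys (?R * ?s\<^sup>2)" by (auto simp: keys_hom)
    then obtain a b where a: "a \<in> keys ?R" and m: "m = a + (b + b)"
      by (auto elim!: keys_mult_cases dest!: keys_square)
    from a have "\<exists>t\<in>set ts. a = mx t"
      by (induction ts) (auto dest!: keys_add_cases)
    then show "deg m = 42 \<and> card (odds m) \<le> 3" using d ts(2) by (auto simp: m)
  qed
  ultimately show ?thesis unfolding eq by (rule hit_cancel)
qed

section \<open>Cyclic shifts and orbit sums\<close>

lemma keys_V: "keys (V i) = {single i 1}"
  by (simp add: V_def)

definition shift :: "pol \<Rightarrow> pol" where "shift = subst (\<lambda>i. V (rot i))"

lemma shift_mono: "shift (mono (a0, a1, a2, a3, a4)) = mono (a4, a0, a1, a2, a3)"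
  unfolding mono_eq shift_def by (simp add: subst_simps mult_ac)

lemma shift_add: "shift (p + q) = shift p + shift q" and shift_C_mult: "shift (C c * p) = C c * shift p"
  by (simp_all add: shift_def subst_add subst_C_mult)

lemma hit_shift: "p \<in> hit frob n \<Longrightarrow> shift p \<in> hit frob n"
  unfolding shift_def by (rule hit_subst) (simp_all add: keys_V tsq_def)

text \<open>The sum over the cyclic group of order five acting on the variables. It is linear over
  the scalars, in contrast to a field trace.\<close>

definition trace :: "pol \<Rightarrow> pol" where "trace p = (\<Sum>k<5. (shift ^^ k) p)"

lemma shift_pow5: "shift (shift (shift (shift (shift p)))) = p"
proof -
  have "rot (rot (rot (rot (rot i)))) = i" for i
    by (cases "i < 5") (auto simp: less5, simp_all add: rot_def)
  then show ?thesis by (simp add: shift_def subst_subst)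
qed

lemma trace_unfold: "trace p = p + shift p + shift (shift p) + shift (shift (shift p)) + shift (shift (shift (shift p)))"
  by (simp add: trace_def lessThan5 eval_nat_numeral add.assoc)

lemma trace_shift: "trace (shift p) = trace p"
  by (simp add: trace_unfold shift_pow5 add_ac)

lemma trace_add: "trace (p + q) = trace p + trace q" and trace_C_mult: "trace (C c * p) = C c * trace p"
  by (simp_all add: trace_unfold shift_add shift_C_mult distrib_left add_ac)

lemma trace_0 [simp]: "trace 0 = 0"
  using trace_C_mult[of 0 0] by simp

lemma trace_sum_list: "trace (sum_list ps) = (\<Sum>p\<leftarrow>ps. trace p)"
  by (induction ps) (simp_all add: trace_add)

lemma hit_trace: "p \<in> hit frob n \<Longrightarrow> trace p \<in> hit frob n"
  unfolding trace_unfold by (intro hit_add hit_shift)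

text \<open>Summing over shifts makes the position of the even exponent irrelevant, so it is placed
  at index 0.\<close>

definition cls :: "e5 \<Rightarrow> pol" where "cls f = trace (mono (add_double (0, 1, 1, 1, 1) f))"

lemma cls_eq: "cls f = trace (X0 * mono f ^ 2)"
  by (simp add: cls_def X0_def mono_add_double)

lemma hit_cls_sq:
  assumes "deg5 u < 19"
  shows "(\<Sum>f\<leftarrow>filter (\<lambda>f. deg5 f = 19) (sq_terms u). cls f) \<in> hit frob 42"
proof -
  let ?fs = "filter (\<lambda>f. deg5 f = 19) (sq_terms u)"
  have "(\<Sum>f\<leftarrow>?fs. mono f) \<in> hit frob 19"
    using assms by (intro hitI[of "mono u"]) (simp_all add: tsq_mono hom_mono_list)
  then have "trace (X0 * (\<Sum>f\<leftarrow>?fs. mono f)\<^sup>2) \<in> hit frob 42"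
    by (intro hit_trace hit_X0_square)
  then show ?thesis
    by (simp add: square_sum_list o_def trace_sum_list cls_eq flip: sum_list_const_mult)
qed

text \<open>The total square of the product of all variables has terms of degree 5 to 10, while that
  of \<open>g\<close> squared lives in even degrees from 36 on. The only way to reach 42 is 6 + 36,
  which leaves the five terms of degree 6 times \<open>g\<close> squared; each is then rotated until
  its even exponent comes first.\<close>

lemma hit_cls_sq1:
  assumes "deg5 (g0, g1, g2, g3, g4) = 18"
  shows "(\<Sum>f\<leftarrow>[(g0, g1, g2, g3, Suc g4), (g4, g0, g1, g2, Suc g3), (g3, g4, g0, g1, Suc g2),
      (g2, g3, g4, g0, Suc g1), (g1, g2, g3, g4, Suc g0)]. cls f) \<in> hit frob 42"
proof -
  let ?g = "(g0, g1, g2, g3, g4)" and ?s = "tsq frob (mono (g0, g1, g2, g3, g4))"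
  have hs: "highdeg 18 ?s" using highdeg_tsq_mon[of "mx ?g" frob] assms by simp
  have low: "hom k (?s\<^sup>2) = 0" if "k < 36 \<or> k = 37" for k
  proof (rule hom_eq_0)
    fix m assume "m \<in> keys (?s\<^sup>2)"
    then obtain a where "a \<in> keys ?s" "m = a + a" by (auto dest: keys_square)
    moreover from this have "18 \<le> deg a" using hs unfolding highdeg_def by blast
    ultimately have "deg m = 2 * deg a" "18 \<le> deg a" by (simp_all add: deg_add)
    then show "deg m \<noteq> k" using that by presburger
  qed
  have "hom 18 ?s = mono ?g"
    using hom_tsq_bottom[of "mx ?g" frob] assms by simp
  then have h36: "hom 36 (?s\<^sup>2) = (mono ?g)\<^sup>2"
    using hom_square[of 18 ?s] by simp
  let ?ts = "sq_terms (1, 1, 1, 1, 1)"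
  have contrib: "hom 42 (mono t * ?s\<^sup>2) = (if deg5 t = 6 then mono (add_double t ?g) else 0)"
    if "t \<in> set ?ts" for t
  proof -
    have d: "5 \<le> deg5 t" "deg5 t \<le> 10"
      using that by (auto simp: sq_terms.simps odd_binomials.simps)
    then have "hom 42 (mono t * ?s\<^sup>2) = mono t * hom (42 - deg5 t) (?s\<^sup>2)"
      using hom_mult_left[of "mono t" "deg5 t" "42 - deg5 t" "?s\<^sup>2"] by simp
    moreover have "42 - deg5 t < 36 \<or> 42 - deg5 t = 37" if "deg5 t \<noteq> 6"
      using d that by linarith
    ultimately show ?thesis
      using low[of "42 - deg5 t"] h36 by (auto simp: mono_add_double)
  qed
  have six: "filter (\<lambda>t. deg5 t = 6) ?ts =
      [(1, 1, 1, 3, 0), (1, 1, 3, 0, 1), (1, 3, 0, 1, 1), (3, 0, 1, 1, 1), (0, 1, 1, 1, 3)]"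
    by (simp add: sq_terms.simps odd_binomials.simps)
  have "hom 42 (tsq frob (mono (1, 1, 1, 1, 1) * (mono ?g)\<^sup>2)) = hom 42 ((\<Sum>t\<leftarrow>?ts. mono t) * ?s\<^sup>2)"
    by (simp only: tsq_def subst_mult subst_power) (simp only: tsq_mono flip: tsq_def)
  also have "\<dots> = (\<Sum>t\<leftarrow>?ts. hom 42 (mono t * ?s\<^sup>2))"
    by (simp only: hom_sum_list list.map_comp o_def flip: sum_list_mult_const)
  also have "\<dots> = (\<Sum>t\<leftarrow>?ts. if deg5 t = 6 then mono (add_double t ?g) else 0)"
    by (rule arg_cong[of _ _ sum_list], rule map_cong) (simp_all only: contrib)
  also have "\<dots> = (\<Sum>t\<leftarrow>filter (\<lambda>t. deg5 t = 6) ?ts. mono (add_double t ?g))"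
    by (simp only: sum_list_map_filter')
  also have "mono (1, 1, 1, 1, 1) * (mono ?g)\<^sup>2 = mono (add_double (1, 1, 1, 1, 1) ?g)"
    by (simp only: mono_add_double)
  finally have "(\<Sum>t\<leftarrow>filter (\<lambda>t. deg5 t = 6) ?ts. mono (add_double t ?g)) \<in> hit frob 42"
    by (intro hitI[of "mono (add_double (1, 1, 1, 1, 1) ?g)"])
       (use assms in \<open>auto simp: add_double.simps\<close>)
  then have "trace (\<Sum>t\<leftarrow>filter (\<lambda>t. deg5 t = 6) ?ts. mono (add_double t ?g)) \<in> hit frob 42"
    by (rule hit_trace)
  moreover have r1: "trace (mono (a0, a1, a2, a3, a4)) = trace (mono (a1, a2, a3, a4, a0))" for a0 a1 a2 a3 a4
    by (metis shift_mono trace_shift)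
  have r2: "trace (mono (a0, a1, a2, a3, a4)) = trace (mono (a2, a3, a4, a0, a1))"
    and r3: "trace (mono (a0, a1, a2, a3, a4)) = trace (mono (a3, a4, a0, a1, a2))"
    and r4: "trace (mono (a0, a1, a2, a3, a4)) = trace (mono (a4, a0, a1, a2, a3))" for a0 a1 a2 a3 a4
    using r1 by metis+
  \<comment> \<open>The variable with exponent 3 contributes an extra square, which is the source of
    each \<open>Suc\<close>.\<close>
  have s: "3 + 2 * x = 1 + 2 * Suc x" for x :: nat by simp
  have "cls (g4, g0, g1, g2, Suc g3) = trace (mono (add_double (1, 1, 1, 3, 0) ?g))"
    "cls (g3, g4, g0, g1, Suc g2) = trace (mono (add_double (1, 1, 3, 0, 1) ?g))"
    "cls (g2, g3, g4, g0, Suc g1) = trace (mono (add_double (1, 3, 0, 1, 1) ?g))"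
    "cls (g1, g2, g3, g4, Suc g0) = trace (mono (add_double (3, 0, 1, 1, 1) ?g))"
    "cls (g0, g1, g2, g3, Suc g4) = trace (mono (add_double (0, 1, 1, 1, 3) ?g))"
    unfolding cls_def add_double.simps s by (rule r1 r2 r3 r4 refl)+
  ultimately show ?thesis
    unfolding six by (simp add: trace_add add_ac)
qed

section \<open>Reduction to seventeen classes\<close>

text \<open>The starting set of the elimination: from these tuples of degree 19 the certificate
  reaches all others of weight 16 modulo 31 that have more than one odd entry.\<close>

definition basis :: "e5 list" where
  "basis = [(0,3,5,0,11), (10,0,3,5,1), (3,1,6,8,1), (8,0,3,1,7), (9,2,2,1,5), (2,9,0,1,7), (0,5,2,1,11), (1,10,0,5,3), (15,0,2,1,1), (1,0,15,0,3), (11,4,3,0,1), (3,2,5,0,9), (0,7,10,1,1), (8,5,3,0,3), (7,1,1,8,2), (3,3,9,0,4), (3,1,8,5,2)]"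

definition reducible :: "pol \<Rightarrow> bool" where
  "reducible p \<longleftrightarrow> (\<exists>c. p + (\<Sum>k<17. C (c k) * cls (basis ! k)) \<in> hit frob 42)"

lemma reducible_hit: "p \<in> hit frob 42 \<Longrightarrow> reducible p"
  unfolding reducible_def by (intro exI[of _ "\<lambda>_. 0"]) simp

lemma reducible_add: "reducible p \<Longrightarrow> reducible q \<Longrightarrow> reducible (p + q)"
proof -
  assume "reducible p" "reducible q"
  then obtain c d where "p + (\<Sum>k<17. C (c k) * cls (basis ! k)) \<in> hit frob 42"
    "q + (\<Sum>k<17. C (d k) * cls (basis ! k)) \<in> hit frob 42" by (auto simp: reducible_def)
  then have "(p + q) + (\<Sum>k<17. C (c k + d k) * cls (basis ! k)) \<in> hit frob 42"
    using hit_add by (fastforce simp: C_add distrib_right sum.distrib add_ac)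
  then show ?thesis unfolding reducible_def by (intro exI[of _ "\<lambda>k. c k + d k"])
qed

lemma reducible_C_mult: "reducible p \<Longrightarrow> reducible (C a * p)"
proof -
  assume "reducible p"
  then obtain c where "p + (\<Sum>k<17. C (c k) * cls (basis ! k)) \<in> hit frob 42" by (auto simp: reducible_def)
  from hit_C_mult[OF this, of a] show ?thesis
    unfolding reducible_def
    by (intro exI[of _ "\<lambda>k. a * c k"]) (simp add: distrib_left C_mult sum_distrib_left mult.assoc)
qed

lemma reducible_sum: "(\<And>a. a \<in> A \<Longrightarrow> reducible (f a)) \<Longrightarrow> reducible (sum f A)"
  by (induction A rule: infinite_finite_induct) (auto intro: reducible_add reducible_hit)

lemma reducible_sum_list: "(\<And>p. p \<in> set ps \<Longrightarrow> reducible p) \<Longrightarrow> reducible (sum_list ps)"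
  by (induction ps) (auto intro: reducible_add reducible_hit)

lemma reducible_basis: "f \<in> set basis \<Longrightarrow> reducible (cls f)"
proof -
  assume "f \<in> set basis"
  moreover have "length basis = 17" by (simp add: basis_def)
  ultimately obtain l where l: "l < 17" "f = basis ! l" by (metis in_set_conv_nth)
  have "(\<Sum>k<17. C (if k = l then 1 else 0) * cls (basis ! k)) = (\<Sum>k<17. if k = l then cls (basis ! k) else 0)"
    by (rule sum.cong) auto
  then have eq: "cls f + (\<Sum>k<17. C (if k = l then 1 else 0) * cls (basis ! k)) = 0"
    using l by simp
  show ?thesis unfolding reducible_def
    by (rule exI[of _ "\<lambda>k. if k = l then 1 else 0"]) (simp only: eq hit_0)
qed

text \<open>Half of 19 + 1 is 10 = 8 + 2, with two binary ones, so by Wood's criterion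
  \<open>f\<close> is already hit in degree 19.\<close>

lemma reducible_cls_odd1:
  assumes "deg5 f = 19" "odds5 f = 1"
  shows "reducible (cls f)"
proof -
  have "popcount 10 = 2" by code_simp
  then have "mono f \<in> hit frob 19"
    using hit_mon[OF bij_frob, of "mx f"] assms by simp
  then show ?thesis unfolding cls_eq by (intro reducible_hit hit_trace hit_X0_square)
qed

text \<open>
  \<open>TotalSq u\<close> is the relation \<open>X\<^sub>0 (Sq\<^sup>k u)\<^sup>2 \<equiv> 0\<close>, and \<open>FirstSq g\<close> the relation \<open>Sq\<^sup>1(y\<^sub>0 y\<^sub>1 y\<^sub>2 y\<^sub>3 y\<^sub>4 g\<^sup>2) \<equiv> 0\<close>.
  Each relation in the list \<open>certificate\<close> expresses one new class by known ones.
\<close>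

datatype relation = TotalSq e5 | FirstSq e5

text \<open>A relation of the wrong degree yields the empty list; thus \<open>hit_terms\<close>
  holds without side conditions on the certificate.\<close>

fun terms :: "relation \<Rightarrow> e5 list" where
  "terms (TotalSq u) = (if deg5 u < 19 then filter (\<lambda>f. deg5 f = 19) (sq_terms u) else [])"
| "terms (FirstSq (g0, g1, g2, g3, g4)) = (if g0 + g1 + g2 + g3 + g4 = 18 then
    [(g0, g1, g2, g3, Suc g4), (g4, g0, g1, g2, Suc g3), (g3, g4, g0, g1, Suc g2),
     (g2, g3, g4, g0, Suc g1), (g1, g2, g3, g4, Suc g0)] else [])"

lemma hit_terms: "(\<Sum>f\<leftarrow>terms r. cls f) \<in> hit frob 42"
proof (cases r)
  case (TotalSq u)
  then show ?thesis using hit_cls_sq[of u] by simp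
next
  case (FirstSq g)
  then show ?thesis using hit_cls_sq1 by (cases g) auto
qed

lemma deg_terms: "f \<in> set (terms r) \<Longrightarrow> deg5 f = 19"
  by (induction r rule: terms.induct) (auto split: if_splits)

text \<open>Triangular elimination: each relation must contain exactly one occurrence of a class
  that is neither hit nor known. A single occurrence has coefficient 1, so the relation can be
  solved for it.\<close>

fun check :: "e5 list \<Rightarrow> relation list \<Rightarrow> e5 list option" where
  "check known [] = Some known"
| "check known (r # rs) = (case filter (\<lambda>f. odds5 f \<noteq> 1 \<and> f \<notin> set known) (terms r) of
     [f] \<Rightarrow> check (f # known) rs | _ \<Rightarrow> None)"

lemma sum_list_filter_split:
  "(\<Sum>x\<leftarrow>xs. f x) = (\<Sum>x\<leftarrow>filter P xs. f x) + (\<Sum>x\<leftarrow>filter (\<lambda>x. \<not> P x) xs. f x :: pol)"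
  by (induction xs) (simp_all add: add_ac)

lemma reducible_check:
  "check known rs = Some fs \<Longrightarrow> \<forall>f\<in>set known. reducible (cls f) \<Longrightarrow> \<forall>f\<in>set fs. reducible (cls f)"
proof (induction rs arbitrary: known)
  case (Cons r rs)
  let ?new = "\<lambda>f. odds5 f \<noteq> 1 \<and> f \<notin> set known"
  from Cons.prems(1) obtain f where f: "filter ?new (terms r) = [f]" and c: "check (f # known) rs = Some fs"
    by (auto split: list.splits)
  let ?R = "\<Sum>g\<leftarrow>filter (\<lambda>g. \<not> ?new g) (terms r). cls g"
  have "cls f + ?R \<in> hit frob 42"
    using hit_terms[of r] sum_list_filter_split[of cls "terms r" ?new] f by simp
  moreover have "reducible ?R"
  proof (rule reducible_sum_list)
    fix p assume "p \<in> set (map cls (filter (\<lambda>g. \<not> ?new g) (terms r)))"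
    then obtain g where "p = cls g" "g \<in> set (terms r)" "odds5 g = 1 \<or> g \<in> set known" by auto
    then show "reducible p" using deg_terms reducible_cls_odd1 Cons.prems(2) by metis
  qed
  ultimately have "reducible ((cls f + ?R) + ?R)"
    by (rule reducible_add[OF reducible_hit])
  then have "reducible (cls f)" by (simp only: add.assoc add_self add_0_right)
  then have "\<forall>g\<in>set (f # known). reducible (cls g)" using Cons.prems(2) by simp
  then show ?case by (rule Cons.IH[OF c])
qed simp

definition certificate :: "relation list" where
  "certificate = [TotalSq (0,1,1,9,0),
   FirstSq (0,2,1,0,15),
   FirstSq (0,3,1,6,8),
   FirstSq (0,3,5,0,10),
   FirstSq (0,5,2,1,10),
   TotalSq (1,0,1,13,0),
   TotalSq (1,1,0,5,8),
   TotalSq (1,5,9,0,0),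
   TotalSq (0,0,1,15,1),
   TotalSq (0,0,9,3,5),
   TotalSq (0,1,0,7,9),
   TotalSq (0,1,15,0,1),
   FirstSq (0,0,0,5,13),
   TotalSq (0,3,12,1,1),
   TotalSq (0,8,1,1,7),
   TotalSq (0,9,1,7,0),
   TotalSq (0,9,3,4,1),
   FirstSq (0,0,13,1,4),
   TotalSq (0,11,0,5,1),
   TotalSq (1,0,0,3,13),
   FirstSq (0,4,1,12,1),
   TotalSq (1,0,7,8,1),
   FirstSq (0,1,4,5,8),
   TotalSq (1,1,0,9,6),
   TotalSq (1,1,6,0,9),
   FirstSq (0,8,1,5,4),
   TotalSq (1,2,4,9,1),
   FirstSq (0,4,9,0,5),
   TotalSq (1,3,1,4,8),
   TotalSq (1,8,1,3,4),
   TotalSq (1,9,7,0,0),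
   TotalSq (1,11,4,1,0),
   TotalSq (0,3,1,2,11),
   TotalSq (3,1,2,10,1),
   FirstSq (1,1,2,10,4),
   TotalSq (11,2,2,1,1),
   TotalSq (0,4,3,1,7),
   TotalSq (0,7,2,5,1),
   FirstSq (0,8,3,2,5),
   TotalSq (1,0,7,4,3),
   TotalSq (1,2,4,5,3),
   TotalSq (1,2,8,3,3),
   TotalSq (1,6,2,1,5),
   FirstSq (0,1,6,2,9),
   TotalSq (1,4,1,6,3),
   FirstSq (1,4,9,2,2),
   TotalSq (1,0,11,2,3),
   FirstSq (0,1,0,11,6),
   TotalSq (2,1,0,7,5),
   FirstSq (1,8,3,4,2),
   TotalSq (2,4,3,5,1),
   TotalSq (3,1,6,0,5),
   FirstSq (0,4,3,9,2),
   TotalSq (3,3,1,4,4),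
   TotalSq (3,3,1,8,2),
   TotalSq (3,5,0,2,5),
   FirstSq (0,2,4,11,1),
   TotalSq (4,5,2,1,3),
   FirstSq (1,2,1,2,12),
   TotalSq (3,2,1,2,9),
   FirstSq (0,1,2,8,7),
   TotalSq (5,0,0,7,3),
   FirstSq (0,0,7,10,1),
   TotalSq (7,1,1,0,6),
   TotalSq (0,5,11,1,1),
   TotalSq (0,5,3,7,0),
   TotalSq (1,0,9,7,1),
   TotalSq (1,0,13,1,3),
   TotalSq (1,0,5,7,2),
   TotalSq (1,1,0,11,5),
   FirstSq (0,0,11,4,3),
   TotalSq (1,3,5,0,9),
   TotalSq (5,3,5,2,0),
   TotalSq (1,4,3,9,1),
   TotalSq (1,4,3,3,4),
   TotalSq (1,5,2,1,9),
   TotalSq (5,5,2,3,0),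
   TotalSq (3,1,4,9,1),
   TotalSq (3,1,4,3,4),
   TotalSq (5,1,1,2,9),
   FirstSq (0,2,8,5,3),
   TotalSq (0,9,5,3,1),
   FirstSq (0,0,9,7,2),
   TotalSq (8,5,1,1,3),
   FirstSq (1,3,1,8,5),
   TotalSq (8,1,3,3,2),
   FirstSq (1,1,8,1,7),
   TotalSq (0,5,7,1,2),
   FirstSq (0,13,3,1,1),
   TotalSq (9,5,3,0,1),
   TotalSq (9,7,0,1,1),
   TotalSq (9,3,2,3,0),
   TotalSq (1,7,6,1,0),
   TotalSq (1,13,3,1,0),
   TotalSq (3,4,7,1,0),
   TotalSq (11,0,3,3,0),
   TotalSq (0,7,6,3,1),
   TotalSq (1,4,3,7,2),
   TotalSq (1,6,2,5,3),
   TotalSq (2,4,7,3,1),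
   TotalSq (2,5,2,1,7),
   FirstSq (2,5,2,5,4),
   TotalSq (3,0,0,7,7),
   FirstSq (0,4,5,6,3),
   TotalSq (3,1,4,7,2),
   TotalSq (3,3,5,2,4),
   TotalSq (3,5,2,3,4),
   TotalSq (4,7,3,0,3),
   FirstSq (0,4,7,3,4),
   TotalSq (5,7,3,2,0),
   TotalSq (1,1,4,5,7),
   TotalSq (1,1,2,6,7),
   TotalSq (3,1,6,4,3),
   TotalSq (3,1,8,3,3),
   TotalSq (3,3,1,10,1),
   FirstSq (1,10,2,2,3),
   TotalSq (0,3,3,1,11),
   FirstSq (0,3,3,3,9),
   TotalSq (1,3,3,3,8),
   TotalSq (7,1,5,0,5),
   FirstSq (0,6,6,1,5),
   TotalSq (2,3,5,0,7),
   FirstSq (2,3,5,4,4),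
   TotalSq (2,3,1,6,5),
   FirstSq (1,1,6,4,6),
   TotalSq (4,7,1,5,1),
   TotalSq (4,3,3,7,0),
   TotalSq (4,3,7,1,2),
   FirstSq (1,1,4,7,5),
   TotalSq (5,6,1,1,5),
   TotalSq (5,2,3,3,4),
   TotalSq (7,2,7,1,0),
   TotalSq (1,3,1,6,7),
   TotalSq (1,4,7,3,3),
   FirstSq (1,6,6,3,2),
   TotalSq (2,3,3,5,5),
   TotalSq (3,3,5,4,3),
   TotalSq (3,3,7,1,4),
   TotalSq (3,5,2,5,3),
   TotalSq (4,3,7,3,1),
   TotalSq (5,2,3,5,3),
   FirstSq (1,5,2,3,7),
   TotalSq (6,1,3,1,7),
   FirstSq (1,3,3,5,6),
   TotalSq (7,1,1,6,3),
   FirstSq (0,6,2,7,3),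
   TotalSq (2,7,1,1,7),
   FirstSq (1,3,5,2,7),
   TotalSq (3,7,1,3,4),
   TotalSq (7,1,3,3,4),
   FirstSq (2,3,3,7,3)]"

text \<open>All exponents \<open>f\<close> of degree 19 for which \<open>X\<^sub>0 f\<^sup>2\<close> has weight 0 for the torus.\<close>

definition exponents :: "e5 list" where
  "exponents = [(19 - (a1 + a2 + a3 + a4), a1, a2, a3, a4).
     a1 \<leftarrow> [0..<20], a2 \<leftarrow> [0..<20 - a1], a3 \<leftarrow> [0..<20 - a1 - a2], a4 \<leftarrow> [0..<20 - a1 - a2 - a3],
     (19 - (a1 + a2 + a3 + a4) + 2 * a1 + 4 * a2 + 8 * a3 + 16 * a4) mod 31 = 16]"

lemma certificate_complete:
  "case check basis certificate of None \<Rightarrow> False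
   | Some known \<Rightarrow> list_all (\<lambda>f. odds5 f = 1 \<or> List.member known f) exponents"
  by code_simp

lemma reducible_cls:
  assumes "a0 + a1 + a2 + a3 + a4 = 19" "(a0 + 2 * a1 + 4 * a2 + 8 * a3 + 16 * a4) mod 31 = 16"
  shows "reducible (cls (a0, a1, a2, a3, a4))"
proof -
  obtain known where c: "check basis certificate = Some known"
    and all: "list_all (\<lambda>f. odds5 f = 1 \<or> List.member known f) exponents"
    using certificate_complete by (auto split: option.splits)
  have k: "\<forall>f\<in>set known. reducible (cls f)"
    by (rule reducible_check[OF c]) (simp add: reducible_basis)
  have a0: "a0 = 19 - (a1 + a2 + a3 + a4)" using assms(1) by simp
  have "(a0, a1, a2, a3, a4) \<in> set exponents"
    using assms unfolding exponents_def by (auto simp: a0 intro!: bexI[of _ a1] bexI[of _ a2] bexI[of _ a3] bexI[of _ a4])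
  then have "odds5 (a0, a1, a2, a3, a4) = 1 \<or> (a0, a1, a2, a3, a4) \<in> set known"
    using all by (auto simp: list_all_iff)
  then show ?thesis
  proof
    assume "odds5 (a0, a1, a2, a3, a4) = 1"
    then show ?thesis by (rule reducible_cls_odd1[rotated]) (simp only: deg5.simps assms(1))
  next
    assume "(a0, a1, a2, a3, a4) \<in> set known"
    with k show ?thesis by (rule bspec)
  qed
qed

lemma reducible_trace_even0:
  assumes "a0 + a1 + a2 + a3 + a4 = 42" "31 dvd a0 + 2 * a1 + 4 * a2 + 8 * a3 + 16 * a4"
    and "even a0" "odd a1" "odd a2" "odd a3" "odd a4"
  shows "reducible (trace (mono (a0, a1, a2, a3, a4)))"
proof -
  obtain f0 f1 f2 f3 f4 where f: "a0 = 2 * f0" "a1 = 2 * f1 + 1" "a2 = 2 * f2 + 1" "a3 = 2 * f3 + 1" "a4 = 2 * f4 + 1"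
    using assms(3-7) by (metis evenE oddE)
  define w where "w = f0 + 2 * f1 + 4 * f2 + 8 * f3 + 16 * f4"
  have "a0 + 2 * a1 + 4 * a2 + 8 * a3 + 16 * a4 = 2 * w + 30"
    by (simp add: f w_def)
  with assms(2) have "31 dvd 2 * w + 30" by simp
  \<comment> \<open>The odd parts of \<open>X0\<close> have weight 2 + 4 + 8 + 16 = 30, so
    \<open>2 * w\<close> is 1 modulo 31, and 16 is the inverse of 2.\<close>
  then have "w mod 31 = 16" by presburger
  then have "(f0 + 2 * f1 + 4 * f2 + 8 * f3 + 16 * f4) mod 31 = 16" by (simp add: w_def)
  moreover have "f0 + f1 + f2 + f3 + f4 = 19" using assms(1) unfolding f by simp
  ultimately have "reducible (cls (f0, f1, f2, f3, f4))" by (rule reducible_cls[rotated])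
  then show ?thesis by (simp add: cls_def add_double.simps f)
qed

text \<open>Multiplication by 16, the inverse of 2 modulo 31, rotates the weights 1, 2, 4, 8,
  16.\<close>

lemma weight_shift:
  assumes "31 dvd a0 + 2 * a1 + 4 * a2 + 8 * a3 + 16 * (a4 :: nat)"
  shows "31 dvd a1 + 2 * a2 + 4 * a3 + 8 * a4 + 16 * a0"
proof -
  have "31 dvd 16 * (a0 + 2 * a1 + 4 * a2 + 8 * a3 + 16 * a4)" using assms by (rule dvd_mult)
  also have "16 * (a0 + 2 * a1 + 4 * a2 + 8 * a3 + 16 * a4) =
      (a1 + 2 * a2 + 4 * a3 + 8 * a4 + 16 * a0) + 31 * (a1 + 2 * a2 + 4 * a3 + 8 * a4)" by simp
  finally show ?thesis by (metis dvd_add_left_iff dvd_triv_left)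
qed

lemma trace_rotate: "trace (mono (a0, a1, a2, a3, a4)) = trace (mono (a1, a2, a3, a4, a0))"
  by (metis shift_mono trace_shift)

lemma reducible_trace:
  assumes d: "a0 + a1 + a2 + a3 + a4 = 42" and w: "31 dvd a0 + 2 * a1 + 4 * a2 + 8 * a3 + 16 * a4"
  shows "reducible (trace (mono (a0, a1, a2, a3, a4)))"
proof (cases "odds5 (a0, a1, a2, a3, a4) \<le> 3")
  case True
  then show ?thesis using d by (intro reducible_hit hit_trace hit_few_odds) auto
next
  case False
  note w1 = weight_shift[OF w]
  note w2 = weight_shift[OF w1]
  note w3 = weight_shift[OF w2]
  note w4 = weight_shift[OF w3]
  have *: "even (a0 + a1 + a2 + a3 + a4)" using d by simp
  \<comment> \<open>More than three odd exponents with an even sum are exactly four.\<close>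
  consider "even a0" "odd a1" "odd a2" "odd a3" "odd a4" | "even a1" "odd a0" "odd a2" "odd a3" "odd a4"
    | "even a2" "odd a0" "odd a1" "odd a3" "odd a4" | "even a3" "odd a0" "odd a1" "odd a2" "odd a4"
    | "even a4" "odd a0" "odd a1" "odd a2" "odd a3"
    using False * unfolding odds5.simps mod2_eq_if
    by (cases "even a0"; cases "even a1"; cases "even a2"; cases "even a3"; cases "even a4") simp_all
  then show ?thesis
  proof cases
    case 1 then show ?thesis using reducible_trace_even0[OF _ w] d by simp
  next
    case 2 then show ?thesis
      using reducible_trace_even0[OF _ w1] d trace_rotate[of a0 a1 a2 a3 a4] by simp
  next
    case 3 then show ?thesis
      using reducible_trace_even0[OF _ w2] d trace_rotate[of a0 a1 a2 a3 a4] trace_rotate[of a1 a2 a3 a4 a0] by simp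
  next
    case 4 then show ?thesis
      using reducible_trace_even0[OF _ w3] d trace_rotate[of a0 a1 a2 a3 a4] trace_rotate[of a1 a2 a3 a4 a0]
        trace_rotate[of a2 a3 a4 a0 a1] by simp
  next
    case 5 then show ?thesis
      using reducible_trace_even0[OF _ w4] d trace_rotate[of a0 a1 a2 a3 a4] trace_rotate[of a1 a2 a3 a4 a0]
        trace_rotate[of a2 a3 a4 a0 a1] trace_rotate[of a3 a4 a0 a1 a2] by simp
  qed
qed

section \<open>The field with 32 elements\<close>

text \<open>The polynomial is chosen so that its roots are primitive 31st roots of unity and form a
  self-dual normal basis of the field with 32 elements.\<close>

definition beta :: F where
  "beta = (SOME b. b ^ 5 = b ^ 4 + b ^ 2 + b + 1)"

lemma beta_power5: "beta ^ 5 = beta ^ 4 + beta ^ 2 + beta + 1"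
proof -
  define f :: "nat \<Rightarrow> F" where "f k = (if k = 3 then 0 else 1)" for k
  obtain b where "(\<Sum>k\<le>5. f k * b ^ k) = 0"
    using alg_closed[of 5 f] by (auto simp: f_def)
  then have "(b ^ 4 + b ^ 2 + b + 1) + b ^ 5 = 0"
    by (simp add: f_def eval_nat_numeral add_ac)
  then have "\<exists>b::F. b ^ 5 = b ^ 4 + b ^ 2 + b + 1"
    by (metis add_eq_0_char2)
  then show ?thesis unfolding beta_def by (rule someI_ex)
qed

text \<open>An executable model of the field with 32 elements, by coordinates in 1,
  \<open>beta\<close>, ..., \<open>beta ^ 4\<close>. The map \<open>val\<close> respects sums and
  products, so identities may be evaluated in the model.\<close>

type_synonym gf = "bool \<times> bool \<times> bool \<times> bool \<times> bool"

definition val :: "gf \<Rightarrow> F" where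
  "val = (\<lambda>(a0, a1, a2, a3, a4). of_bool a0 + of_bool a1 * beta + of_bool a2 * beta ^ 2
     + of_bool a3 * beta ^ 3 + of_bool a4 * beta ^ 4)"

fun gadd :: "gf \<Rightarrow> gf \<Rightarrow> gf" where
  "gadd (a0, a1, a2, a3, a4) (b0, b1, b2, b3, b4) =
    (a0 \<noteq> b0, a1 \<noteq> b1, a2 \<noteq> b2, a3 \<noteq> b3, a4 \<noteq> b4)"

text \<open>Multiplication by \<open>beta\<close>, with \<open>beta ^ 5\<close> rewritten as in
  \<open>beta_power5\<close>.\<close>

fun gshift :: "gf \<Rightarrow> gf" where
  "gshift (a0, a1, a2, a3, a4) = (a4, a0 \<noteq> a4, a1 \<noteq> a4, a2, a3 \<noteq> a4)"

definition gzero :: gf where "gzero = (False, False, False, False, False)"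
definition gone :: gf where "gone = (True, False, False, False, False)"

text \<open>Horner's scheme in the first factor.\<close>

fun gmul :: "gf \<Rightarrow> gf \<Rightarrow> gf" where
  "gmul (a0, a1, a2, a3, a4) c = (let s = (\<lambda>a. if a then c else gzero) in
     gadd (s a0) (gshift (gadd (s a1) (gshift (gadd (s a2) (gshift (gadd (s a3) (gshift (s a4)))))))))"

lemma of_bool_xor: "of_bool (a \<noteq> b) = (of_bool a + of_bool b :: 'a::char2)"
  by (cases a; cases b) simp_all

lemma val_gzero [simp]: "val gzero = 0" and val_gone [simp]: "val gone = 1"
  by (simp_all add: val_def gzero_def gone_def)

lemma val_gadd: "val (gadd a b) = val a + val b"
  by (cases a; cases b) (simp add: val_def of_bool_xor distrib_right add_ac del: of_bool_eq_iff)

lemma val_gshift: "val (gshift a) = beta * val a"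
proof -
  obtain a0 a1 a2 a3 a4 where a: "a = (a0, a1, a2, a3, a4)" by (metis prod_cases5)
  have "beta * val a = of_bool a0 * beta + of_bool a1 * beta ^ 2 + of_bool a2 * beta ^ 3 + of_bool a3 * beta ^ 4
      + of_bool a4 * beta ^ 5"
    by (simp add: a val_def distrib_left mult.left_commute eval_nat_numeral)
  also have "\<dots> = val (gshift a)"
    unfolding beta_power5 by (cases a4) (simp_all add: a val_def of_bool_xor distrib_right add_ac)
  finally show ?thesis by simp
qed

lemma horner5:
  "c0 * v + x * (c1 * v + x * (c2 * v + x * (c3 * v + x * (c4 * v)))) =
    (c0 + c1 * x + c2 * x ^ 2 + c3 * x ^ 3 + c4 * x ^ 4) * v" for x :: "'a::comm_ring_1"
  by (simp add: power2_eq_square power3_eq_cube power4_eq_xxxx distrib_left distrib_right mult_ac)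

lemma val_gmul: "val (gmul a b) = val a * val b"
proof -
  obtain a0 a1 a2 a3 a4 where a: "a = (a0, a1, a2, a3, a4)" by (metis prod_cases5)
  have "val (if c then b else gzero) = of_bool c * val b" for c by simp
  then show ?thesis
    unfolding a gmul.simps Let_def val_gadd val_gshift horner5[symmetric]
    by (simp only: horner5) (simp only: val_def prod.case)
qed

text \<open>The conjugates \<open>\<beta>, \<beta>\<^sup>2, \<beta>\<^sup>4, \<beta>\<^sup>8, \<beta>\<^bsup>16\<^esup>\<close> form a self-dual normal basis.\<close>

definition conjugates :: "gf list" where
  "conjugates = [(False, True, False, False, False), (False, False, True, False, False),
     (False, False, False, False, True), (False, True, False, True, False), (True, False, True, True, True)]"

definition bt :: "nat \<Rightarrow> F" where "bt i = val (conjugates ! (i mod 5))"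

lemma conjugates_square: "i < 5 \<Longrightarrow> gmul (conjugates ! i) (conjugates ! i) = conjugates ! (Suc i mod 5)"
proof -
  have "\<forall>i\<in>set [0..<5]. gmul (conjugates ! i) (conjugates ! i) = conjugates ! (Suc i mod 5)" by code_simp
  then show "i < 5 \<Longrightarrow> ?thesis" by simp
qed

lemma bt_square: "bt i ^ 2 = bt (Suc i)"
proof -
  have "bt i ^ 2 = val (gmul (conjugates ! (i mod 5)) (conjugates ! (i mod 5)))"
    by (simp add: bt_def val_gmul power2_eq_square)
  also have "\<dots> = bt (Suc i)"
    by (simp add: conjugates_square bt_def mod_Suc_eq)
  finally show ?thesis .
qed

lemma bt_add5 [simp]: "bt (i + 5) = bt i" "bt (5 + i) = bt i"
  by (simp_all add: bt_def)

text \<open>A finite check. It says that the symmetric matrix with entries \<open>bt (i + k)\<close>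
  is orthogonal and hence its own inverse.\<close>

lemma bt_dual:
  assumes "j < 5" "k < 5"
  shows "(\<Sum>i<5. bt (i + j) * bt (i + k)) = (if j = k then 1 else 0)"
proof -
  let ?g = "\<lambda>j k. fold gadd [gmul (conjugates ! ((i + j) mod 5)) (conjugates ! ((i + k) mod 5)). i \<leftarrow> [0..<5]] gzero"
  have upt: "[0..<5] = [0, 1, 2, 3, 4]" by code_simp
  have "(\<Sum>i<5. bt (i + j) * bt (i + k)) = val (?g j k)"
    by (simp add: lessThan5 upt val_gadd val_gmul bt_def add_ac)
  also have "\<forall>j\<in>set [0..<5]. \<forall>k\<in>set [0..<5]. ?g j k = (if j = k then gone else gzero)"
    by code_simp
  then have "?g j k = (if j = k then gone else gzero)" using assms by simp
  finally show ?thesis by simp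
qed

lemma bt_0: "bt 0 = beta"
  by (simp add: bt_def conjugates_def val_def)

lemma bt_power: "bt i = beta ^ (2 ^ i)"
proof (induction i)
  case (Suc i)
  have "bt (Suc i) = (beta ^ 2 ^ i)\<^sup>2" by (simp add: Suc flip: bt_square)
  also have "\<dots> = beta ^ 2 ^ Suc i" by (simp only: mult.commute power_Suc flip: power_mult)
  finally show ?case .
qed (simp add: bt_0)

lemma beta_nonzero: "beta \<noteq> 0"
  using beta_power5 by auto

lemma beta_power31: "beta ^ 31 = 1"
proof -
  have "beta ^ 32 = beta" using bt_power[of 5] bt_add5(1)[of 0] by (simp add: bt_0)
  then have "beta * beta ^ 31 = beta * 1" by (simp flip: power_Suc)
  then show ?thesis using beta_nonzero by (metis mult_cancel_left)
qed

lemma beta_not_1: "beta \<noteq> 1"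
  using beta_power5 by auto

text \<open>Since 31 is prime, an exponent not divisible by 31 is invertible modulo 31; raising
  \<open>beta ^ n = 1\<close> to the inverse would give \<open>beta = 1\<close>.\<close>

lemma beta_power_eq_1_iff: "beta ^ n = 1 \<longleftrightarrow> 31 dvd n"
proof
  assume "31 dvd n"
  then show "beta ^ n = 1" by (auto simp: dvd_def power_mult beta_power31)
next
  assume n: "beta ^ n = 1"
  show "31 dvd n"
  proof (rule ccontr)
    assume "\<not> 31 dvd n"
    moreover have "\<forall>r\<in>set [1..<31]. \<exists>x\<in>set [1..<31]. r * x mod 31 = (1::nat)" by code_simp
    ultimately obtain x where "(n mod 31) * x mod 31 = 1"
      by (metis atLeastLessThan_iff atLeastLessThan_upt dvd_eq_mod_eq_0 less_one linorder_not_less mod_less_divisor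
          zero_less_numeral)
    then have x: "n * x mod 31 = 1" by (simp add: mod_mult_left_eq)
    have "beta ^ (n * x) = 1" using n by (simp add: power_mult)
    moreover have "n * x = 31 * (n * x div 31) + 1" using x by (metis div_mult_mod_eq mult.commute)
    then have "beta ^ (n * x) = beta ^ (31 * (n * x div 31) + 1)" by simp
    ultimately have "beta = 1" by (simp add: power_add power_mult beta_power31)
    then show False using beta_not_1 by simp
  qed
qed

section \<open>Conjugate coordinates\<close>

lemma square_lform: "(lform t c)\<^sup>2 = (\<Sum>k<t. C ((c k)\<^sup>2) * V k ^ 2)"
  by (simp add: lform_def square_sum power_mult_distrib C_power)

lemma tsq_lform: "tsq \<pi> (lform t c) = lform t c + (\<Sum>k<t. C (c k) * V (\<pi> k) ^ 2)"
  by (simp add: lform_def tsq_def subst_sum subst_C_mult distrib_left sum.distrib)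

lemma subst_lform: "subst \<sigma> (lform t c) = (\<Sum>k<t. C (c k) * \<sigma> k)"
  by (simp add: lform_def subst_sum subst_C_mult)

lemma bt_cong: "i mod 5 = j mod 5 \<Longrightarrow> bt i = bt j"
  by (simp add: bt_def)

lemma bt_rot: "k < 5 \<Longrightarrow> bt (i + k) ^ 2 = bt (i + rot k)"
  unfolding bt_square by (rule bt_cong) (simp add: rot_def mod_simps)

lemma bt_frob_rot: "i < 5 \<Longrightarrow> k < 5 \<Longrightarrow> bt (frob i + rot k) = bt (i + k)"
proof (rule bt_cong)
  assume "i < 5" "k < 5"
  then have "(frob i + rot k) mod 5 = ((i + 4) mod 5 + (k + 1) mod 5) mod 5"
    by (simp only: frob_def rot_def if_True)
  also have "\<dots> = (i + 4 + (k + 1)) mod 5" by (rule mod_add_eq)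
  also have "i + 4 + (k + 1) = i + k + 5" by simp
  finally show "(frob i + rot k) mod 5 = (i + k) mod 5" by (simp only: mod_add_self2)
qed

lemma bt_frob: "i < 5 \<Longrightarrow> bt (frob i + k) ^ 2 = bt (i + k)"
  unfolding bt_square
proof (rule bt_cong)
  assume "i < 5"
  then have "Suc (frob i + k) mod 5 = ((i + 4) mod 5 + (k + 1)) mod 5"
    by (simp add: frob_def)
  also have "\<dots> = (i + 4 + (k + 1)) mod 5" by (rule mod_add_left_eq)
  also have "i + 4 + (k + 1) = i + k + 5" by simp
  finally show "Suc (frob i + k) mod 5 = (i + k) mod 5" by (simp only: mod_add_self2)
qed

definition lsub :: "(nat \<Rightarrow> nat \<Rightarrow> F) \<Rightarrow> nat \<Rightarrow> pol" where
  "lsub g i = (if i < 5 then lform 5 (g i) else V i)"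

lemma deg_lsub: "m \<in> keys (lsub g i) \<Longrightarrow> deg m = 1"
  by (auto simp: lsub_def keys_V dest: keys_lform split: if_splits)

lemma subst_lsub_lsub:
  "subst (lsub g) (subst (lsub h) p) = subst (lsub (\<lambda>i j. \<Sum>k<5. h i k * g k j)) p"
proof -
  have "subst (lsub g) (lsub h i) = lsub (\<lambda>i j. \<Sum>k<5. h i k * g k j) i" for i
  proof (cases "i < 5")
    case True
    then have "subst (lsub g) (lsub h i) = (\<Sum>k<5. C (h i k) * (\<Sum>j<5. C (g k j) * V j))"
      by (simp add: lsub_def subst_lform) (simp add: lform_def)
    also have "\<dots> = (\<Sum>j<5. \<Sum>k<5. C (h i k * g k j) * V j)"
      by (simp add: sum_distrib_left C_mult mult.assoc) (rule sum.swap)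
    also have "\<dots> = lsub (\<lambda>i j. \<Sum>k<5. h i k * g k j) i"
      using True by (simp add: lsub_def lform_def C_sum sum_distrib_right)
    finally show ?thesis .
  qed (simp add: lsub_def)
  then show ?thesis by (simp add: subst_subst)
qed

lemma lsub_cong: "(\<And>i j. i < 5 \<Longrightarrow> j < 5 \<Longrightarrow> g i j = h i j) \<Longrightarrow> lsub g = lsub h"
  by (auto simp: fun_eq_iff lsub_def lform_def intro!: sum.cong)

lemma lsub_id: "lsub (\<lambda>i j. if i = j then 1 else 0) = V"
proof -
  have "lform 5 (\<lambda>j. if i = j then 1 else 0) = V i" if "i < 5" for i
    using that by (simp add: lform_def if_distrib[of C] if_distrib[of "\<lambda>x. x * _"] cong: if_cong)
  then show ?thesis by (auto simp: fun_eq_iff lsub_def)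
qed

text \<open>The change between ordinary and conjugate coordinates, in the manner of a Fourier
  transform. By \<open>bt_dual\<close> the same substitution serves in both directions.\<close>

definition four :: "pol \<Rightarrow> pol" where "four = subst (lsub (\<lambda>i k. bt (i + k)))"

lemma four_four [simp]: "four (four p) = p"
proof -
  have "lsub (\<lambda>i j. \<Sum>k<5. bt (i + k) * bt (k + j)) = V"
    unfolding lsub_id[symmetric] using bt_dual by (intro lsub_cong) (simp add: add.commute)
  then show ?thesis by (simp add: four_def subst_lsub_lsub)
qed

lemma four_add: "four (p + q) = four p + four q" and four_C_mult: "four (C c * p) = C c * four p"
  and four_sum: "four (sum f A) = (\<Sum>a\<in>A. four (f a))"
  by (simp_all add: four_def subst_add subst_C_mult subst_sum)

text \<open>Squaring turns the coefficient \<open>bt (i + k)\<close> into the next conjugate;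
  reindexing the sum moves this from the coefficients to the variables, where it becomes the twist
  by \<open>frob\<close>.\<close>

lemma hit_four_frob: "p \<in> hit id n \<Longrightarrow> four p \<in> hit frob n"
  unfolding four_def
proof (rule hit_subst)
  fix i
  show "lsub (\<lambda>i k. bt (i + k)) i + lsub (\<lambda>i k. bt (i + k)) (id i) ^ 2 = tsq frob (lsub (\<lambda>i k. bt (i + k)) i)"
  proof (cases "i < 5")
    case True
    have "(\<Sum>k<5. C (bt (i + k) ^ 2) * V k ^ 2) = (\<Sum>k<5. C (bt (i + rot k)) * V k ^ 2)"
      by (rule sum.cong) (simp_all add: bt_rot)
    also have "\<dots> = (\<Sum>k<5. C (bt (i + k)) * V (frob k) ^ 2)"
      by (simp add: lessThan5 add_ac)
    finally have "(\<Sum>k<5. C (bt (i + k) ^ 2) * V k ^ 2) = (\<Sum>k<5. C (bt (i + k)) * V (frob k) ^ 2)" .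
    then show ?thesis using True by (simp add: lsub_def square_lform tsq_lform)
  qed (simp add: lsub_def tsq_def frob_def)
qed (rule deg_lsub)

text \<open>Here the twist acts on the row: squaring the coefficients of row \<open>frob i\<close>
  gives those of row \<open>i\<close>.\<close>

lemma hit_four_id: "p \<in> hit frob n \<Longrightarrow> four p \<in> hit id n"
  unfolding four_def
proof (rule hit_subst)
  fix i
  show "lsub (\<lambda>i k. bt (i + k)) i + lsub (\<lambda>i k. bt (i + k)) (frob i) ^ 2 = tsq id (lsub (\<lambda>i k. bt (i + k)) i)"
  proof (cases "i < 5")
    case True
    then have "bt (frob i + k) ^ 2 = bt (i + k)" for k
      by (rule bt_frob)
    moreover have "frob i < 5" using True by (simp add: frob_def)
    ultimately show ?thesis using True by (simp add: lsub_def square_lform tsq_lform)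
  qed (simp add: lsub_def tsq_def frob_def)
qed (rule deg_lsub)

text \<open>The entries depend on \<open>i + k\<close> only, so a step in the row index can be
  exchanged for a step in the column index. Hence a five-cycle of the original variables is again a
  five-cycle in the new ones.\<close>

lemma four_shift: "four (subst (\<lambda>i. V (frob i)) q) = shift (four q)"
proof -
  have "lsub (\<lambda>i k. bt (i + k)) (frob i) = shift (lsub (\<lambda>i k. bt (i + k)) i)" for i
  proof (cases "i < 5")
    case True
    have r: "shift (lform 5 (\<lambda>k. bt (i + k))) = (\<Sum>k<5. C (bt (i + k)) * V (rot k))"
      by (simp add: shift_def subst_lform)
    have "frob i < 5" using True by (simp add: frob_def)
    moreover have "lform 5 (\<lambda>k. bt (frob i + k)) = (\<Sum>k<5. C (bt (frob i + rot k)) * V (rot k))"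
      by (simp add: lform_def lessThan5 add_ac)
    then have "lform 5 (\<lambda>k. bt (frob i + k)) = (\<Sum>k<5. C (bt (i + k)) * V (rot k))"
      using True by (simp add: bt_frob_rot)
    ultimately show ?thesis using True by (simp add: lsub_def r)
  qed (simp add: lsub_def shift_def frob_def rot_def)
  then show ?thesis by (simp add: four_def shift_def subst_subst)
qed

subsection \<open>Averaging over the normaliser of a Singer cycle\<close>

text \<open>In the new coordinates the Singer cycle is diagonal.\<close>

definition torus :: "pol \<Rightarrow> pol" where "torus = subst (\<lambda>i. if i < 5 then C (bt i) * V i else V i)"

lemma torus_add: "torus (p + q) = torus p + torus q" and torus_C_mult: "torus (C c * p) = C c * torus p"
  by (simp_all add: torus_def subst_add subst_C_mult)

lemma hit_torus: "p \<in> hit frob n \<Longrightarrow> torus p \<in> hit frob n"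
  unfolding torus_def
proof (rule hit_subst)
  fix i
  show "(if i < 5 then C (bt i) * V i else V i) + (if frob i < 5 then C (bt (frob i)) * V (frob i) else V (frob i)) ^ 2
      = tsq frob (if i < 5 then C (bt i) * V i else V i)"
  proof (cases "i < 5")
    case True
    then have "bt (frob i) ^ 2 = bt i"
      using bt_frob[of i 0] by simp
    moreover have "frob i < 5" using True by (simp add: frob_def)
    ultimately show ?thesis
      using True by (simp add: tsq_def subst_C_mult distrib_left power_mult_distrib flip: C_power)
  qed (simp add: tsq_def frob_def)
qed (auto simp: keys_V V_def C_mult_single split: if_splits)

lemma torus_mono: "torus (mono (a0, a1, a2, a3, a4)) =
    C (beta ^ (a0 + 2 * a1 + 4 * a2 + 8 * a3 + 16 * a4)) * mono (a0, a1, a2, a3, a4)"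
  unfolding mono_eq torus_def
  by (simp add: subst_simps bt_power power_mult_distrib power_add C_mult C_power mult_ac flip: power_mult)

lemma torus_pow_mono: "(torus ^^ j) (mono (a0, a1, a2, a3, a4)) =
    C ((beta ^ (a0 + 2 * a1 + 4 * a2 + 8 * a3 + 16 * a4)) ^ j) * mono (a0, a1, a2, a3, a4)"
proof (induction j)
  case (Suc j)
  show ?case
    by (simp only: funpow.simps o_apply Suc torus_C_mult torus_mono power_Suc C_mult) (simp only: mult_ac)
qed simp

text \<open>Orthogonality of characters. The trivial character gives 31, which is 1 in
  characteristic two, so no division is involved.\<close>

lemma sum_beta_powers: "(\<Sum>j<31. (beta ^ w) ^ j) = (if 31 dvd w then 1 else 0)"
proof (cases "beta ^ w = 1")
  case True
  then have "31 dvd w" by (simp add: beta_power_eq_1_iff)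
  moreover have "(\<Sum>j<31. (beta ^ w) ^ j) = (of_nat 31 :: F)" by (simp add: True)
  moreover have "(of_nat 31 :: F) = 1" by (subst of_nat_char2) simp
  ultimately show ?thesis by metis
next
  case False
  have "(beta ^ w + 1) * (\<Sum>j<31. (beta ^ w) ^ j) = (beta ^ w) ^ 31 + 1"
    using power_diff_1_eq[of "beta ^ w" 31] by simp
  also have "(beta ^ w) ^ 31 = 1"
    by (metis beta_power31 mult.commute power_mult power_one)
  finally have "(\<Sum>j<31. (beta ^ w) ^ j) = 0"
    using False by (auto simp: add_eq_0_char2)
  then show ?thesis using False by (simp add: beta_power_eq_1_iff)
qed

lemma trace_sum: "trace (sum f A) = (\<Sum>a\<in>A. trace (f a))"
  by (induction A rule: infinite_finite_induct) (simp_all add: trace_add)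

text \<open>Monomials are eigenvectors of the torus: the average kills those of nonzero weight and
  fixes the others, and \<open>reducible_trace\<close> handles the latter.\<close>

lemma reducible_average:
  assumes "\<And>m. m \<in> keys p \<Longrightarrow> keys m \<subseteq> {..<5} \<and> deg m = 42"
  shows "reducible (trace (\<Sum>j<31. (torus ^^ j) p))"
proof -
  have lin: "(torus ^^ j) (\<Sum>m\<in>A. C (f m) * g m) = (\<Sum>m\<in>A. C (f m) * (torus ^^ j) (g m))" for j A f g
  proof (induction j)
    case (Suc j)
    have "torus (sum h A) = (\<Sum>a\<in>A. torus (h a))" for h :: "_ \<Rightarrow> pol"
      by (simp add: torus_def subst_sum)
    then show ?case using Suc by (simp add: torus_C_mult)
  qed simp
  have "trace (\<Sum>j<31. (torus ^^ j) p) = trace (\<Sum>j<31. \<Sum>m\<in>keys p. C (lookup p m) * (torus ^^ j) (mon m))"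
    by (subst (1) pol_as_sum[of p]) (simp only: lin)
  also have "\<dots> = (\<Sum>m\<in>keys p. C (lookup p m) * trace (\<Sum>j<31. (torus ^^ j) (mon m)))"
    by (subst sum.swap) (simp add: trace_sum trace_C_mult flip: sum_distrib_left)
  also have "reducible \<dots>"
  proof (intro reducible_sum reducible_C_mult)
    fix m assume "m \<in> keys p"
    with assms have m: "keys m \<subseteq> {..<5}" "deg m = 42" by auto
    obtain a0 a1 a2 a3 a4 where a: "m = mx (a0, a1, a2, a3, a4)" using mx_lookup[OF m(1)] by blast
    let ?w = "a0 + 2 * a1 + 4 * a2 + 8 * a3 + 16 * a4"
    have "(\<Sum>j<31. (torus ^^ j) (mon m)) = C (\<Sum>j<31. (beta ^ ?w) ^ j) * mon m"
      by (simp only: a torus_pow_mono C_sum sum_distrib_right)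
    then have "trace (\<Sum>j<31. (torus ^^ j) (mon m)) = C (if 31 dvd ?w then 1 else 0) * trace (mon m)"
      by (simp only: sum_beta_powers trace_C_mult)
    moreover have "reducible (trace (mon m))" if "31 dvd ?w"
      using reducible_trace[OF _ that] m(2) by (simp add: a)
    ultimately show "reducible (trace (\<Sum>j<31. (torus ^^ j) (mon m)))"
      by (cases "31 dvd ?w") (simp_all add: reducible_hit)
  qed
  finally show ?thesis .
qed

lemma reducible_invariant:
  assumes p: "\<And>m. m \<in> keys p \<Longrightarrow> keys m \<subseteq> {..<5} \<and> deg m = 42"
    and torus: "torus p + p \<in> hit frob 42" and shift: "shift p + p \<in> hit frob 42"
  shows "reducible p"
proof -
  have t: "(torus ^^ j) p + p \<in> hit frob 42" for j
  proof (induction j)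
    case (Suc j)
    have "torus ((torus ^^ j) p + p) + (torus p + p) \<in> hit frob 42"
      by (intro hit_add hit_torus Suc torus)
    then show ?case by (simp add: torus_add add.assoc)
  qed simp
  have s: "(shift ^^ k) q + p \<in> hit frob 42" if "q + p \<in> hit frob 42" for k q
  proof (induction k)
    case 0
    then show ?case using that by simp
  next
    case (Suc k)
    have "shift ((shift ^^ k) q + p) + (shift p + p) \<in> hit frob 42"
      by (intro hit_add hit_shift Suc shift)
    then show ?case by (simp add: shift_add add.assoc)
  qed
  define S where "S = trace (\<Sum>j<31. (torus ^^ j) p)"
  have "S = (\<Sum>j<31. \<Sum>k<5. (shift ^^ k) ((torus ^^ j) p))"
    unfolding S_def trace_sum by (simp only: trace_def)
  \<comment> \<open>The group of substitutions has odd order 31 * 5, so adding up 155 copies of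
    \<open>p\<close> returns \<open>p\<close>.\<close>
  moreover have "(of_nat 155 :: pol) = 1"
    by (subst of_nat_char2) simp
  then have "p = (\<Sum>j<31::nat. \<Sum>k<5::nat. p)"
    by (simp flip: mult.assoc)
  ultimately have "S + p = (\<Sum>j<31. \<Sum>k<5. (shift ^^ k) ((torus ^^ j) p) + p)"
    by (simp only: sum.distrib)
  also have "\<dots> \<in> hit frob 42"
    by (intro hit_sum s t)
  finally have Sp: "reducible (S + p)" by (rule reducible_hit)
  have S: "reducible S"
    unfolding S_def by (rule reducible_average) (rule p)
  have "reducible (S + (S + p))" by (rule reducible_add[OF S Sp])
  then show ?thesis by (simp only: add_cancel_char2)
qed

section \<open>Functionals that vanish on hit polynomials\<close>

lemma odd_binomials_le: "j \<in> set (odd_binomials a) \<Longrightarrow> j \<le> a"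
  using power_add_char2[where 'a = F, of a] by auto

lemma odd_binomials_step:
  "j \<in> set (odd_binomials a) \<Longrightarrow> j div 2 \<in> set (odd_binomials (a div 2)) \<and> (odd j \<longrightarrow> odd a)"
proof (cases "a = 0")
  case True
  then show "j \<in> set (odd_binomials a) \<Longrightarrow> ?thesis" by (simp add: odd_binomials.simps[of 0])
next
  case False
  then show "j \<in> set (odd_binomials a) \<Longrightarrow> ?thesis"
    by (subst (asm) odd_binomials.simps) (auto simp: Let_def split: if_splits)
qed

text \<open>Kummer's criterion: the binomial coefficient is odd when adding \<open>j\<close> to
  \<open>a - j\<close> produces no carry. The summand \<open>2 ^ k - 1\<close> has all its low
  digits set, so those of \<open>j\<close> vanish.\<close>

lemma power2_dvd_odd_binomial:
  "j \<in> set (odd_binomials a) \<Longrightarrow> a = 2 ^ k - 1 + j \<Longrightarrow> 2 ^ k dvd j"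
proof (induction k arbitrary: a j)
  case (Suc k)
  have p: "(2::nat) ^ k \<ge> 1" by simp
  note step = odd_binomials_step[OF Suc.prems(1)]
  have "even j"
  proof (rule ccontr)
    assume "odd j"
    with step have "odd a" by blast
    moreover have "a + 1 = 2 * 2 ^ k + j" using Suc.prems(2) p by simp
    ultimately show False using \<open>odd j\<close> by presburger
  qed
  then obtain i where i: "j = 2 * i" by blast
  have "a = 2 * (2 ^ k - 1 + i) + 1" using Suc.prems(2) p unfolding i power_Suc by arith
  then have "a div 2 = 2 ^ k - 1 + i" by simp
  then have "2 ^ k dvd i" using Suc.IH[of "j div 2" "a div 2"] step by (simp add: i)
  then show ?case by (simp add: i)
qed simp

text \<open>The binary digits of \<open>j\<close> are among those of \<open>a\<close>. A common
  lowest digit would make the sum even, while all digits of \<open>2 ^ k - 1\<close> are ones; the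
  same argument repeats on the halves.\<close>

lemma odd_binomial_spike:
  "j \<in> set (odd_binomials a) \<Longrightarrow> a + j = 2 ^ k - 1 \<Longrightarrow> j = 0"
proof (induction k arbitrary: a j)
  case (Suc k)
  have p: "(2::nat) ^ k \<ge> 1" by simp
  note step = odd_binomials_step[OF Suc.prems(1)]
  have sum: "a + j + 1 = 2 * 2 ^ k" using Suc.prems(2) p by simp
  have "even j"
  proof (rule ccontr)
    assume "odd j"
    with step have "odd a" by blast
    with \<open>odd j\<close> sum show False by presburger
  qed
  then obtain i where i: "j = 2 * i" by blast
  have "odd (a + j)" using sum by (metis Suc_eq_plus1 dvd_triv_left even_Suc)
  then have "odd a" using i by simp
  then obtain c where c: "a = 2 * c + 1" by (rule oddE)
  have "c + i = 2 ^ k - 1" using sum unfolding i c by simp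
  then have "j div 2 = 0" using Suc.IH[of "j div 2" "a div 2"] step by (simp add: i c)
  then show ?case by (simp add: i)
qed simp

text \<open>A hit polynomial in five variables may have a witness in more variables. Setting the
  extra ones to zero commutes with the total square and removes them from the witness.\<close>

definition proj :: "pol \<Rightarrow> pol" where "proj = subst (\<lambda>i. if i < 5 then V i else 0)"

lemma proj_mon: "proj (mon m) = (if keys m \<subseteq> {..<5} then mon m else 0)"
proof (cases "keys m \<subseteq> {..<5}")
  case True
  have "proj (mon m) = subst V (mon m)"
    unfolding proj_def by (rule subst_cong_vars[where A = "{..<5}"]) (use True in auto)
  then show ?thesis using True by simp
next
  case False
  then obtain i where i: "i \<in> keys m" "\<not> i < 5" by auto
  then have "(\<Prod>i\<in>keys m. (if i < 5 then V i else 0) ^ lookup m i) = 0"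
    by (intro prod_zero bexI[of _ i]) (auto simp: in_keys_iff)
  then show ?thesis using False by (simp add: proj_def subst_mon[of "keys m"])
qed

lemma lookup_proj: "lookup (proj p) m = (if keys m \<subseteq> {..<5} then lookup p m else 0)"
proof (induction p rule: pol_induct)
  case (mon c n)
  have "proj (C c * mon n) = C c * proj (mon n)" by (simp add: proj_def subst_C_mult)
  then show ?case by (auto simp: proj_mon lookup_C_mult lookup_mon)
qed (simp_all add: proj_def subst_add lookup_add)

lemma proj_tsq:
  assumes "\<And>i. \<pi> i < 5 \<longleftrightarrow> i < 5"
  shows "proj (tsq \<pi> p) = tsq \<pi> (proj p)"
proof -
  have "subst (\<lambda>i. if i < 5 then V i else 0) (V i + V (\<pi> i) ^ 2)
      = subst (\<lambda>i. V i + V (\<pi> i) ^ 2) (if i < 5 then V i else 0)" for i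
    using assms[of i] by (simp add: subst_simps)
  then show ?thesis by (simp only: proj_def tsq_def subst_subst)
qed

lemma frob_less [simp]: "frob i < 5 \<longleftrightarrow> i < 5" and rot_less [simp]: "rot i < 5 \<longleftrightarrow> i < 5"
  by (simp_all add: frob_def rot_def)

lemma lookup_hit_eq_0:
  assumes \<pi>: "\<And>i. \<pi> i < 5 \<longleftrightarrow> i < 5"
    and t: "\<And>e. deg5 e \<noteq> n \<Longrightarrow> lookup (tsq \<pi> (mono e)) (mx t) = 0"
    and h: "h \<in> hit \<pi> n"
  shows "lookup h (mx t) = 0"
proof -
  obtain u where u: "\<forall>m\<in>keys u. deg m < n" and h: "h = hom n (tsq \<pi> u)"
    using h by (auto simp: hit_def)
  have "lookup (tsq \<pi> u) (mx t) = lookup (proj (tsq \<pi> u)) (mx t)"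
    using keys_mx[of t] by (simp add: lookup_proj)
  also have "\<dots> = (\<Sum>m\<in>keys (proj u). lookup (proj u) m * lookup (tsq \<pi> (mon m)) (mx t))"
    unfolding proj_tsq[OF \<pi>] by (subst tsq_as_sum) (simp add: lookup_sum lookup_C_mult)
  also have "\<dots> = 0"
  proof (rule sum.neutral, rule ballI)
    fix m assume m: "m \<in> keys (proj u)"
    then have "keys m \<subseteq> {..<5}" "m \<in> keys u"
      by (auto simp: in_keys_iff lookup_proj split: if_splits)
    then obtain e where e: "m = mx e" using mx_lookup by blast
    then have "deg5 e \<noteq> n" using u \<open>m \<in> keys u\<close> by fastforce
    then show "lookup (proj u) m * lookup (tsq \<pi> (mon m)) (mx t) = 0"
      by (simp add: e t)
  qed
  finally show ?thesis by (simp add: h lookup_hom)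
qed

lemma lookup_mono_list: "s \<notin> set ts \<Longrightarrow> lookup (\<Sum>t\<leftarrow>ts. mono t) (mx s) = 0"
  by (induction ts) (auto simp: lookup_add lookup_mon)

text \<open>The monomial of the fully twisted flag is a spike: it occurs in no \<open>Sq\<^sup>k(u)\<close> with \<open>k > 0\<close>.\<close>

lemma twisted_spike:
  assumes "(1, 16, 15, 7, 3) \<in> set (sq_terms e)"
  shows "e = (1, 16, 15, 7, 3)"
proof -
  obtain a0 a1 a2 a3 a4 where e: "e = (a0, a1, a2, a3, a4)" by (metis prod_cases5)
  obtain j0 j1 j2 j3 j4 where j: "j0 \<in> set (odd_binomials a0)" "j1 \<in> set (odd_binomials a1)"
      "j2 \<in> set (odd_binomials a2)" "j3 \<in> set (odd_binomials a3)" "j4 \<in> set (odd_binomials a4)"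
    and eq: "a0 - j0 + 2 * j1 = 1" "a1 - j1 + 2 * j2 = 16" "a2 - j2 + 2 * j3 = 15" "a3 - j3 + 2 * j4 = 7"
      "a4 - j4 + 2 * j0 = 3"
    using assms unfolding e sq_terms.simps by auto
  note le = j[THEN odd_binomials_le]
  have j1: "j1 = 0" using eq(1) by linarith
  \<comment> \<open>The exponents 1, 3, 7, 15 are treated in this order. Once nothing enters a slot
    by the twist, its exponent \<open>2 ^ k - 1\<close> equals \<open>a - j\<close>, so
    \<open>2 ^ k\<close> divides \<open>j\<close>; the neighbouring exponent bounds \<open>j\<close>
    below \<open>2 ^ k\<close>, so nothing enters that slot either.\<close>
  have "2 ^ 1 dvd j0" by (rule power2_dvd_odd_binomial[OF j(1)]) (use eq(1) j1 le(1) in simp)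
  moreover have "j0 \<le> 1" using eq(5) by linarith
  ultimately have j0: "j0 = 0" by (auto dest: dvd_imp_le)
  have "2 ^ 2 dvd j4" by (rule power2_dvd_odd_binomial[OF j(5)]) (use eq(5) j0 le(5) in simp)
  moreover have "j4 \<le> 3" using eq(4) by linarith
  ultimately have j4: "j4 = 0" by (auto dest: dvd_imp_le)
  have "2 ^ 3 dvd j3" by (rule power2_dvd_odd_binomial[OF j(4)]) (use eq(4) j4 le(4) in simp)
  moreover have "j3 \<le> 7" using eq(3) by linarith
  ultimately have j3: "j3 = 0" by (auto dest: dvd_imp_le)
  have "2 ^ 4 dvd j2" by (rule power2_dvd_odd_binomial[OF j(3)]) (use eq(3) j3 le(3) in simp)
  moreover have "j2 \<le> 8" using eq(2) by linarith
  ultimately have "j2 = 0" by (auto dest: dvd_imp_le)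
  then show ?thesis using eq j0 j1 j3 j4 by (simp add: e)
qed

lemma lookup_hit_twisted: "h \<in> hit frob 42 \<Longrightarrow> lookup h (mx (1, 16, 15, 7, 3)) = 0"
proof (rule lookup_hit_eq_0[where \<pi> = frob and n = 42])
  fix e assume "deg5 e \<noteq> 42"
  then have "(1, 16, 15, 7, 3) \<notin> set (sq_terms e)"
    using twisted_spike[of e] by auto
  then show "lookup (tsq frob (mono e)) (mx (1, 16, 15, 7, 3)) = 0"
    unfolding tsq_mono by (rule lookup_mono_list)
qed simp_all

lemma tsq_id_mono: "tsq id (mono (a0, a1, a2, a3, a4)) =
   (\<Sum>s\<leftarrow>[(a0 + j0, a1 + j1, a2 + j2, a3 + j3, a4 + j4).
      j0 \<leftarrow> odd_binomials a0, j1 \<leftarrow> odd_binomials a1, j2 \<leftarrow> odd_binomials a2,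
      j3 \<leftarrow> odd_binomials a3, j4 \<leftarrow> odd_binomials a4]. mono s)"
proof -
  have *: "tsq id (V i ^ a) = (\<Sum>j\<leftarrow>odd_binomials a. V i ^ (a + j))" for i a
  proof -
    have "tsq id (V i ^ a) = (\<Sum>j\<leftarrow>odd_binomials a. V i ^ (a - j) * (V i ^ 2) ^ j)"
      using power_add_char2[of a "V i" "V i ^ 2"] by (simp add: tsq_def subst_power)
    also have "\<dots> = (\<Sum>j\<leftarrow>odd_binomials a. V i ^ (a + j))"
    proof (intro arg_cong[of _ _ sum_list] map_cong refl)
      fix j assume "j \<in> set (odd_binomials a)"
      then have "a + j = (a - j) + 2 * j" using odd_binomials_le by fastforce
      then show "V i ^ (a - j) * (V i ^ 2) ^ j = V i ^ (a + j)" by (simp only: power_add power_mult)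
    qed
    finally show ?thesis .
  qed
  have f: "mono (a0 + j0, a1 + j1, a2 + j2, a3 + j3, a4 + j4) = V 0 ^ (a0 + j0) * (V 1 ^ (a1 + j1) *
      (V 2 ^ (a2 + j2) * (V 3 ^ (a3 + j3) * V 4 ^ (a4 + j4))))" for j0 j1 j2 j3 j4
    by (simp only: mono_eq mult.assoc)
  have "tsq id (mono (a0, a1, a2, a3, a4)) = tsq id (V 0 ^ a0) * (tsq id (V 1 ^ a1) * (tsq id (V 2 ^ a2) *
      (tsq id (V 3 ^ a3) * tsq id (V 4 ^ a4))))"
    unfolding mono_eq by (simp add: tsq_def subst_mult mult.assoc)
  also have "\<dots> = (\<Sum>j0\<leftarrow>odd_binomials a0. \<Sum>j1\<leftarrow>odd_binomials a1. \<Sum>j2\<leftarrow>odd_binomials a2.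
      \<Sum>j3\<leftarrow>odd_binomials a3. \<Sum>j4\<leftarrow>odd_binomials a4. mono (a0 + j0, a1 + j1, a2 + j2, a3 + j3, a4 + j4))"
    unfolding * f by (simp only: sum_list_const_mult sum_list_mult_const)
  finally show ?thesis by (simp add: sum_list_concat_map o_def)
qed

text \<open>In every variable the exponent is one less than a power of two, so
  \<open>odd_binomial_spike\<close> leaves only the trivial choice, which is the identity part of
  the total square.\<close>

lemma lookup_hit_spike:
  assumes h: "h \<in> hit id n" and n: "n = deg5 (t0, t1, t2, t3, t4)"
    and t: "t0 = 2 ^ k0 - 1" "t1 = 2 ^ k1 - 1" "t2 = 2 ^ k2 - 1" "t3 = 2 ^ k3 - 1" "t4 = 2 ^ k4 - 1"
  shows "lookup h (mx (t0, t1, t2, t3, t4)) = 0"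
proof (rule lookup_hit_eq_0[OF _ _ h])
  fix e assume d: "deg5 e \<noteq> n"
  obtain a0 a1 a2 a3 a4 where e: "e = (a0, a1, a2, a3, a4)" by (metis prod_cases5)
  show "lookup (tsq id (mono e)) (mx (t0, t1, t2, t3, t4)) = 0"
    unfolding e tsq_id_mono
  proof (rule lookup_mono_list, rule notI)
    assume "(t0, t1, t2, t3, t4) \<in> set [(a0 + j0, a1 + j1, a2 + j2, a3 + j3, a4 + j4).
      j0 \<leftarrow> odd_binomials a0, j1 \<leftarrow> odd_binomials a1, j2 \<leftarrow> odd_binomials a2,
      j3 \<leftarrow> odd_binomials a3, j4 \<leftarrow> odd_binomials a4]"
    then obtain j0 j1 j2 j3 j4 where j: "j0 \<in> set (odd_binomials a0)" "j1 \<in> set (odd_binomials a1)"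
        "j2 \<in> set (odd_binomials a2)" "j3 \<in> set (odd_binomials a3)" "j4 \<in> set (odd_binomials a4)"
      and eq: "t0 = a0 + j0" "t1 = a1 + j1" "t2 = a2 + j2" "t3 = a3 + j3" "t4 = a4 + j4"
      by auto
    have "j0 = 0" "j1 = 0" "j2 = 0" "j3 = 0" "j4 = 0"
      using j[THEN odd_binomial_spike] t unfolding eq by blast+
    then show False using d by (simp add: eq e n)
  qed
qed simp

section \<open>Coefficients of linear substitutions\<close>

lemma lookup_V_mult: "lookup (V k * p) (single k 1 + m) = lookup p m"
proof (induction p rule: pol_induct)
  case (mon c n)
  have eq: "V k * (C c * mon n) = C c * mon (single k 1 + n)"
    by (simp add: mon_add mon_single mult_ac)
  show ?case unfolding eq by (simp add: lookup_C_mult lookup_mon)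
qed (simp_all add: distrib_left lookup_add)

lemma lookup_V_mult_0: "lookup m k = 0 \<Longrightarrow> lookup (V k * p) m = 0"
proof (induction p rule: pol_induct)
  case (mon c n)
  have eq: "V k * (C c * mon n) = C c * mon (single k 1 + n)"
    by (simp add: mon_add mon_single mult_ac)
  have "single k 1 + n \<noteq> m" using mon by (auto simp: lookup_add)
  then show ?case unfolding eq by (simp add: lookup_C_mult lookup_mon)
qed (simp_all add: distrib_left lookup_add)

lemma double_inject: "m + m = n + n \<longleftrightarrow> m = n" for m n :: "nat \<Rightarrow>\<^sub>0 nat"
proof
  assume eq: "m + m = n + n"
  show "m = n"
  proof (rule poly_mapping_eqI)
    fix i
    have "lookup (m + m) i = lookup (n + n) i" by (simp only: eq)
    then show "lookup m i = lookup n i" unfolding lookup_add by arith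
  qed
qed simp

lemma lookup_square: "lookup (p\<^sup>2) (m + m) = (lookup p m)\<^sup>2" for p :: pol
proof (induction p rule: pol_induct)
  case (mon c n)
  then show ?case by (simp add: square_term lookup_C_mult lookup_mon double_inject)
qed (simp_all add: square_add lookup_add)

lemma card_odds_le_deg: "card (odds m) \<le> deg m"
proof -
  obtain h where "m = ind (odds m) + (h + h)" by (rule monom_split)
  then have "deg m = card (odds m) + (deg h + deg h)" by (metis deg_add deg_ind)
  then show ?thesis by simp
qed

lemma keys_prod_list_deg:
  fixes ps :: "pol list"
  shows "(\<And>p m. p \<in> set ps \<Longrightarrow> m \<in> keys p \<Longrightarrow> deg m = 1) \<Longrightarrow> m \<in> keys (prod_list ps) \<Longrightarrow> deg m = length ps"
proof (induction ps arbitrary: m)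
  case (Cons p ps)
  from Cons.prems(2) obtain a b where ab: "a \<in> keys p" "b \<in> keys (prod_list ps)" "m = a + b"
    by (auto elim: keys_mult_cases)
  moreover have "deg b = length ps" using Cons.IH[OF Cons.prems(1)[OF list.set_intros(2)] ab(2)] by simp
  ultimately show ?case using Cons.prems(1)[of p a] by (simp add: deg_add)
qed simp

lemma odds_prod_list_square:
  assumes "m \<in> keys (prod_list (map (lsub g) rs) * q\<^sup>2)"
  shows "card (odds m) \<le> length rs"
proof -
  obtain a b where a: "a \<in> keys (prod_list (map (lsub g) rs))" and b: "b \<in> keys (q\<^sup>2)" and m: "m = a + b"
    using assms by (rule keys_mult_cases)
  obtain c where "b = c + c" using keys_square[OF b] by blast
  moreover have "deg a = length (map (lsub g) rs)"
    by (rule keys_prod_list_deg[OF _ a]) (auto dest: deg_lsub)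
  ultimately show ?thesis using card_odds_le_deg[of a] by (simp add: m)
qed

text \<open>Row expansion for the submatrix with rows \<open>rs\<close> and columns
  \<open>U\<close>. In characteristic two it is also the determinant.\<close>

fun permanent :: "(nat \<Rightarrow> nat \<Rightarrow> F) \<Rightarrow> nat list \<Rightarrow> nat list \<Rightarrow> F" where
  "permanent g [] U = 1"
| "permanent g (r # rs) U = (\<Sum>c\<leftarrow>U. g r c * permanent g rs (remove1 c U))"

text \<open>There are as many linear forms as odd exponents in the target, and the square supplies
  none. Each form must therefore provide a different variable from \<open>U\<close>, and summing
  over these assignments gives a permanent.\<close>

lemma lookup_prod_square:
  assumes "distinct U" "set U \<subseteq> {..<5}" "set rs \<subseteq> {..<5}" "length rs = length U"
  shows "lookup (prod_list (map (lsub g) rs) * q\<^sup>2) (ind (set U) + (m + m)) = permanent g rs U * (lookup q m)\<^sup>2"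
  using assms
proof (induction rs arbitrary: U)
  case Nil
  then show ?case by (simp add: lookup_square ind_def)
next
  case (Cons r rs)
  let ?X = "prod_list (map (lsub g) rs) * q\<^sup>2" and ?M = "ind (set U) + (m + m)"
  have r: "r < 5" using Cons.prems by simp
  have k: "lookup (V k * ?X) ?M = (if k \<in> set U then permanent g rs (remove1 k U) * (lookup q m)\<^sup>2 else 0)"
    for k
  proof (cases "k \<in> set U")
    case True
    have "?M = single k 1 + (ind (set (remove1 k U)) + (m + m))"
      using True Cons.prems(1) by (simp add: ind_def sum.remove[of "set U" k] set_remove1_eq add.assoc)
    moreover have "lookup ?X (ind (set (remove1 k U)) + (m + m)) = permanent g rs (remove1 k U) * (lookup q m)\<^sup>2"
      by (rule Cons.IH) (use True Cons.prems in \<open>auto simp: length_remove1 dest: subsetD[OF set_remove1_subset]\<close>)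
    ultimately show ?thesis using True by (simp only: lookup_V_mult if_True)
  next
    case False
    show ?thesis
    proof (cases "lookup m k = 0")
      case True
      then have "lookup ?M k = 0" using False by (simp add: lookup_add lookup_ind)
      then show ?thesis using False by (simp only: lookup_V_mult_0 if_False)
    next
      case nz: False
      \<comment> \<open>The variable \<open>k\<close> might divide the target only through its
        square part. Removing it once leaves one odd exponent more than \<open>U\<close> has, too
        many for the remaining forms.\<close>
      define N where "N = ?M - single k 1"
      have M: "?M = single k 1 + N"
        using nz by (intro poly_mapping_eqI) (auto simp: N_def lookup_add lookup_minus lookup_single when_def)
      have "odd (lookup N i) \<longleftrightarrow> i \<in> insert k (set U)" for i
        using nz False by (auto simp: N_def lookup_minus lookup_add lookup_ind lookup_single when_def)
      then have "odds N = insert k (set U)" by (auto simp: odds_def)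
      then have "card (odds N) = Suc (length U)"
        using False Cons.prems(1) by (simp add: distinct_card)
      then have "N \<notin> keys ?X"
        using odds_prod_list_square[of N g rs q] Cons.prems(4) by fastforce
      then show ?thesis using False by (simp only: M lookup_V_mult if_False) (simp add: in_keys_iff)
    qed
  qed
  have "prod_list (map (lsub g) (r # rs)) * q\<^sup>2 = (\<Sum>k<5. C (g r k) * (V k * ?X))"
    using r by (simp add: lsub_def lform_def sum_distrib_right mult.assoc)
  then have "lookup (prod_list (map (lsub g) (r # rs)) * q\<^sup>2) ?M = (\<Sum>k<5. g r k * lookup (V k * ?X) ?M)"
    by (simp only: lookup_sum lookup_C_mult)
  also have "\<dots> = (\<Sum>k\<in>set U. g r k * (permanent g rs (remove1 k U) * (lookup q m)\<^sup>2))"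
    unfolding k using Cons.prems(2)
    by (simp add: if_distrib[of "\<lambda>x. _ * x"] sum.If_cases Int_absorb1 Int_absorb2 Int_commute cong: if_cong)
  also have "\<dots> = permanent g (r # rs) U * (lookup q m)\<^sup>2"
    using Cons.prems(1) by (simp add: sum_list_distinct_conv_sum_set sum_distrib_right mult.assoc)
  finally show ?case .
qed

lemma prod_list_subst: "subst \<sigma> (prod_list (map V is)) = prod_list (map \<sigma> is)"
  by (induction "is") (simp_all add: subst_mult)

fun half5 :: "e5 \<Rightarrow> e5" where
  "half5 (a0, a1, a2, a3, a4) = (a0 div 2, a1 div 2, a2 div 2, a3 div 2, a4 div 2)"

fun oddlist :: "e5 \<Rightarrow> nat list" where
  "oddlist (a0, a1, a2, a3, a4) = (if odd a0 then [0] else []) @ (if odd a1 then [1] else []) @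
     (if odd a2 then [2] else []) @ (if odd a3 then [3] else []) @ (if odd a4 then [4] else [])"

lemma oddlist: "distinct (oddlist e)" "set (oddlist e) \<subseteq> {..<5}"
proof -
  obtain a0 a1 a2 a3 a4 where e: "e = (a0, a1, a2, a3, a4)" by (metis prod_cases5)
  have s: "set (if b then [i] else []) = (if b then {i} else {})" "distinct (if b then [i] else [])"
    for b and i :: nat by simp_all
  show "distinct (oddlist e)" "set (oddlist e) \<subseteq> {..<5}"
    unfolding e oddlist.simps distinct_append set_append s by auto
qed

declare oddlist.simps [simp del]

lemma mx_split: "mx e = ind (set (oddlist e)) + (mx (half5 e) + mx (half5 e))"
proof (rule poly_mapping_eqI)
  fix i
  obtain a0 a1 a2 a3 a4 where e: "e = (a0, a1, a2, a3, a4)" by (metis prod_cases5)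
  have h: "a = a mod 2 + (a div 2 + a div 2)" for a :: nat by presburger
  have l: "lookup (mx (half5 e)) i = lookup (mx e) i div 2" by (simp add: e lookup_mx)
  have s: "set (if b then [k] else []) = (if b then {k} else {})" for b and k :: nat by simp
  have "i \<in> set (oddlist e) \<longleftrightarrow> odd (lookup (mx e) i)"
  proof (cases "i < 5")
    case True
    then show ?thesis
      unfolding less5 by (elim disjE) (simp_all only: e oddlist.simps set_append s lookup_mx, simp_all)
  next
    case False
    then have "i \<notin> set (oddlist e)" using oddlist(2)[of e] by blast
    moreover have "lookup (mx e) i = 0" unfolding e lookup_mx using False by simp
    ultimately show ?thesis by simp
  qed
  then have "lookup (ind (set (oddlist e))) i = lookup (mx e) i mod 2"
    by (simp add: lookup_ind mod2_eq_if)
  then show "lookup (mx e) i = lookup (ind (set (oddlist e)) + (mx (half5 e) + mx (half5 e))) i"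
    unfolding lookup_add l using h[of "lookup (mx e) i"] by simp
qed

lemma mono_split: "mono e = prod_list (map V (oddlist e)) * (mono (half5 e))\<^sup>2"
proof -
  have "mon (ind (set (oddlist e))) = prod_list (map V (oddlist e))"
    using oddlist(1)[of e] by (simp add: mon_ind prod.distinct_set_conv_list)
  then show ?thesis by (subst mx_split) (simp add: mon_add power2_eq_square)
qed

type_synonym gmat = "gf list list"

definition vmat :: "gmat \<Rightarrow> nat \<Rightarrow> nat \<Rightarrow> F" where "vmat G i j = val (G ! i ! j)"

fun gpermanent :: "gmat \<Rightarrow> nat list \<Rightarrow> nat list \<Rightarrow> gf" where
  "gpermanent G [] U = gone"
| "gpermanent G (r # rs) U =
     fold (\<lambda>c s. gadd (gmul (G ! r ! c) (gpermanent G rs (remove1 c U))) s) U gzero"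

lemma val_fold_gadd: "val (fold (\<lambda>c s. gadd (f c) s) U s) = (\<Sum>c\<leftarrow>U. val (f c)) + val s"
  by (induction U arbitrary: s) (simp_all add: val_gadd add_ac)

lemma val_gpermanent: "val (gpermanent G rs U) = permanent (vmat G) rs U"
  by (induction rs arbitrary: U) (simp_all add: val_fold_gadd val_gmul vmat_def)

text \<open>Recursion over binary digits: a monomial is its odd part times the square of its half,
  so the coefficient is a permanent times the square of the coefficient of the halves.\<close>

fun gcoeff :: "nat \<Rightarrow> gmat \<Rightarrow> e5 \<Rightarrow> e5 \<Rightarrow> gf" where
  "gcoeff 0 G e t = gone"
| "gcoeff (Suc n) G e t = (let v = gcoeff n G (half5 e) (half5 t) in
     gmul (gpermanent G (oddlist e) (oddlist t)) (gmul v v))"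

text \<open>Equality of weight vectors: at each of the \<open>n\<close> binary digits both exponent
  tuples have equally many ones. This is what makes the submatrices square at every level of
  \<open>gcoeff\<close>; the base case ensures that \<open>n\<close> digits are enough.\<close>

fun same_shape :: "nat \<Rightarrow> e5 \<Rightarrow> e5 \<Rightarrow> bool" where
  "same_shape 0 e t \<longleftrightarrow> e = (0, 0, 0, 0, 0) \<and> t = (0, 0, 0, 0, 0)"
| "same_shape (Suc n) e t \<longleftrightarrow> length (oddlist e) = length (oddlist t) \<and> same_shape n (half5 e) (half5 t)"

lemma val_gcoeff:
  "same_shape n e t \<Longrightarrow> lookup (subst (lsub (vmat G)) (mono e)) (mx t) = val (gcoeff n G e t)"
proof (induction n arbitrary: e t)
  case 0
  then have "mx e = 0" "mx t = 0" by (simp_all add: mx.simps)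
  then show ?case by simp
next
  case (Suc n)
  let ?L = "lsub (vmat G)"
  let ?M = "ind (set (oddlist t)) + (mx (half5 t) + mx (half5 t))"
  have "subst ?L (mono e) = subst ?L (prod_list (map V (oddlist e)) * (mono (half5 e))\<^sup>2)"
    by (rule arg_cong[OF mono_split])
  then have "lookup (subst ?L (mono e)) (mx t)
      = lookup (prod_list (map ?L (oddlist e)) * (subst ?L (mono (half5 e)))\<^sup>2) ?M"
    by (simp only: subst_mult subst_power prod_list_subst mx_split[of t])
  also have "\<dots> = permanent (vmat G) (oddlist e) (oddlist t) * (lookup (subst ?L (mono (half5 e))) (mx (half5 t)))\<^sup>2"
    using Suc.prems by (intro lookup_prod_square oddlist) simp
  also have "\<dots> = val (gcoeff (Suc n) G e t)"
    using Suc by (simp add: Let_def val_gmul val_gpermanent power2_eq_square)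
  finally show ?case .
qed

section \<open>The seventeen classes are detected\<close>

fun rots5 :: "e5 \<Rightarrow> e5 list" where
  "rots5 (a0, a1, a2, a3, a4) = [(a0, a1, a2, a3, a4), (a4, a0, a1, a2, a3), (a3, a4, a0, a1, a2),
     (a2, a3, a4, a0, a1), (a1, a2, a3, a4, a0)]"

lemma trace_mono: "trace (mono e) = (\<Sum>s\<leftarrow>rots5 e. mono s)"
  by (cases e) (simp add: trace_unfold shift_mono add_ac)

definition gvalue :: "gmat \<Rightarrow> e5 \<Rightarrow> e5 \<Rightarrow> gf" where
  "gvalue G t f = fold (\<lambda>e s. gadd (gcoeff 5 G e t) s) (rots5 (add_double (0, 1, 1, 1, 1) f)) gzero"

definition admissible :: "e5 \<Rightarrow> e5 \<Rightarrow> bool" where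
  "admissible t f \<longleftrightarrow> list_all (\<lambda>e. same_shape 5 e t) (rots5 (add_double (0, 1, 1, 1, 1) f))"

lemma val_gvalue:
  assumes "admissible t f"
  shows "lookup (subst (lsub (vmat G)) (cls f)) (mx t) = val (gvalue G t f)"
proof -
  have *: "lookup (subst (lsub (vmat G)) (\<Sum>s\<leftarrow>es. mono s)) (mx t) = val (fold (\<lambda>e s. gadd (gcoeff 5 G e t) s) es gzero)"
    if "list_all (\<lambda>e. same_shape 5 e t) es" for es
  proof -
    have "lookup (subst (lsub (vmat G)) (\<Sum>s\<leftarrow>es. mono s)) (mx t) = (\<Sum>e\<leftarrow>es. val (gcoeff 5 G e t))"
      using that by (induction es) (simp_all add: subst_add lookup_add val_gcoeff del: gcoeff.simps same_shape.simps)
    then show ?thesis by (simp add: val_fold_gadd)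
  qed
  show ?thesis
    unfolding cls_def trace_mono gvalue_def by (rule *) (use assms in \<open>simp only: admissible_def\<close>)
qed

definition conj5 :: "nat \<Rightarrow> gf" where "conj5 i = conjugates ! (i mod 5)"

lemma val_conj5: "val (conj5 i) = bt i"
  by (simp add: conj5_def bt_def)

definition four_mat :: gmat where
  "four_mat = map (\<lambda>i. map (\<lambda>k. conj5 (i + k)) [0..<5]) [0..<5]"

text \<open>The permutation matrix conjugated by the matrix of \<open>four\<close>, which is its own
  inverse.\<close>

definition perm_mat :: "nat list \<Rightarrow> gmat" where
  "perm_mat p = map (\<lambda>i. map (\<lambda>j. fold (\<lambda>l s. gadd (gmul (conj5 (i + l)) (conj5 (p ! l + j))) s) [0..<5] gzero) [0..<5]) [0..<5]"

definition bmat :: "bool list list \<Rightarrow> nat \<Rightarrow> nat \<Rightarrow> F" where "bmat A i j = of_bool (A ! i ! j)"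

definition permutation :: "nat list \<Rightarrow> bool list list" where
  "permutation p = map (\<lambda>i. map (\<lambda>j. p ! i = j) [0..<5]) [0..<5]"

lemma four_eq: "four = subst (lsub (vmat four_mat))"
  unfolding four_def
  by (intro arg_cong[of _ _ subst] lsub_cong) (simp add: vmat_def four_mat_def val_conj5)

lemma vmat_perm_mat:
  assumes "i < 5" "j < 5"
  shows "vmat (perm_mat p) i j = (\<Sum>l<5. bt (i + l) * bt (p ! l + j))"
proof -
  have "(\<Sum>l\<leftarrow>[0..<5]. bt (i + l) * bt (p ! l + j)) = (\<Sum>l<5. bt (i + l) * bt (p ! l + j))"
    by (simp only: interv_sum_list_conv_sum_set_nat set_upt atLeast0LessThan)
  then show ?thesis
    using assms by (simp add: vmat_def perm_mat_def val_fold_gadd val_gmul val_conj5)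
qed

lemma four_permutation_four:
  assumes p: "\<And>l. l < 5 \<Longrightarrow> p ! l < 5"
  shows "four (subst (lsub (bmat (permutation p))) (four v)) = subst (lsub (vmat (perm_mat p))) v"
proof -
  let ?g = "bmat (permutation p)" and ?M = "\<lambda>i k. bt (i + k)"
  have entry: "(\<Sum>k<5. (\<Sum>l<5. bt (i + l) * ?g l k) * bt (k + j)) = vmat (perm_mat p) i j"
    if ij: "i < 5" "j < 5" for i j
  proof -
    have "(\<Sum>k<5. (\<Sum>l<5. bt (i + l) * ?g l k) * bt (k + j))
        = (\<Sum>l<5. \<Sum>k<5. bt (i + l) * (?g l k * bt (k + j)))"
      by (subst sum.swap) (simp only: sum_distrib_right mult.assoc)
    also have "\<dots> = (\<Sum>l<5. bt (i + l) * bt (p ! l + j))"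
    proof (rule sum.cong[OF refl])
      fix l :: nat assume "l \<in> {..<5}"
      then have l: "l < 5" by simp
      have "(\<Sum>k<5. bt (i + l) * (?g l k * bt (k + j)))
          = (\<Sum>k<5. if k = p ! l then bt (i + l) * bt (k + j) else 0)"
        using l by (intro sum.cong) (auto simp: bmat_def permutation_def)
      also have "\<dots> = bt (i + l) * bt (p ! l + j)" using p[OF l] by simp
      finally show "(\<Sum>k<5. bt (i + l) * (?g l k * bt (k + j))) = bt (i + l) * bt (p ! l + j)" .
    qed
    finally show ?thesis using ij by (simp only: vmat_perm_mat)
  qed
  have "four (subst (lsub ?g) (four v)) =
      subst (lsub (\<lambda>i j. \<Sum>k<5. (\<Sum>l<5. bt (i + l) * ?g l k) * bt (k + j))) v"
    unfolding four_def subst_lsub_lsub[of ?g ?M v] by (rule subst_lsub_lsub)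
  also have "lsub (\<lambda>i j. \<Sum>k<5. (\<Sum>l<5. bt (i + l) * ?g l k) * bt (k + j)) = lsub (vmat (perm_mat p))"
    by (rule lsub_cong) (rule entry)
  finally show ?thesis .
qed

text \<open>Squaring the entries rotates both indices, the mark of a matrix that is defined over the
  field with two elements in the original coordinates.\<close>

lemma vmat_perm_mat_rot:
  assumes "i < 5" "j < 5"
  shows "vmat (perm_mat p) (rot i) (rot j) = vmat (perm_mat p) i j ^ 2"
proof -
  have r: "bt (rot i + l) = bt (i + l) ^ 2" for l
    using bt_rot[of i l] assms by (simp add: add.commute)
  have s: "bt (k + rot j) = bt (k + j) ^ 2" for k
    using bt_rot[of j k] assms by simp
  show ?thesis
    using assms by (simp add: vmat_perm_mat r s square_sum power_mult_distrib)
qed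

subsection \<open>Semilinearity\<close>

fun rot5 :: "e5 \<Rightarrow> e5" where "rot5 (a0, a1, a2, a3, a4) = (a4, a0, a1, a2, a3)"

lemma shift_proj: "proj (shift p) = shift (proj p)"
proof -
  have "subst (\<lambda>i. if i < 5 then V i else 0) (V (rot i)) = subst (\<lambda>i. V (rot i)) (if i < 5 then V i else 0)" for i
    by simp
  then show ?thesis by (simp only: proj_def shift_def subst_subst)
qed

lemma lookup_shift: "lookup (shift p) (mx (rot5 t)) = lookup p (mx t)"
proof (induction p rule: pol_induct)
  case (mon c m)
  have "lookup (shift (mon m)) (mx (rot5 t)) = lookup (mon m) (mx t)"
  proof (cases "keys m \<subseteq> {..<5}")
    case True
    then obtain a0 a1 a2 a3 a4 where "m = mx (a0, a1, a2, a3, a4)" using mx_lookup by blast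
    then show ?thesis by (cases t) (auto simp: shift_mono lookup_mon)
  next
    case False
    then have "proj (shift (mon m)) = 0"
      by (simp only: shift_proj proj_mon if_False) (simp add: shift_def)
    then have "lookup (shift (mon m)) (mx (rot5 t)) = 0"
      using lookup_proj[of "shift (mon m)" "mx (rot5 t)"] keys_mx[of "rot5 t"] by simp
    moreover have "m \<noteq> mx t" using False keys_mx[of t] by blast
    ultimately show ?thesis by (simp add: lookup_mon)
  qed
  then show ?case by (simp only: shift_C_mult lookup_C_mult)
qed (simp_all add: shift_add lookup_add, simp add: shift_def)

lemma lookup_double: "lookup (subst (\<lambda>i. V i ^ 2) p) (m + m) = lookup p m"
proof (induction p rule: pol_induct)
  case (mon c n)
  have "subst (\<lambda>i. V i ^ 2) (mon n) = mon (n + n)"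
  proof -
    have "mon (n + n) = (\<Prod>i\<in>keys n. V i ^ lookup n i) * (\<Prod>i\<in>keys n. V i ^ lookup n i)"
      by (simp only: mon_add mon_as_prod[of n])
    also have "\<dots> = (\<Prod>i\<in>keys n. (V i ^ 2) ^ lookup n i)"
      by (simp add: power_mult_distrib power2_eq_square flip: prod.distrib)
    finally show ?thesis using subst_mon[of "keys n" n "\<lambda>i. V i ^ 2"] by simp
  qed
  then show ?case by (simp add: subst_C_mult lookup_C_mult lookup_mon double_inject)
qed (simp_all add: subst_add lookup_add)

text \<open>The second condition on \<open>p\<close> says that its coefficients lie in the prime
  field. Hence squaring the transformed polynomial affects only \<open>g\<close> and the exponents,
  and on \<open>g\<close> it is a rotation, which the shift invariance of \<open>p\<close>
  absorbs.\<close>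

lemma lookup_semilinear:
  assumes g: "\<And>i j. i < 5 \<Longrightarrow> j < 5 \<Longrightarrow> g (rot i) (rot j) = g i j ^ 2"
    and p: "shift p = p" "p\<^sup>2 = subst (\<lambda>i. V i ^ 2) p"
  shows "lookup (subst (lsub g) p) (mx (rot5 t)) = (lookup (subst (lsub g) p) (mx t))\<^sup>2"
proof -
  let ?X = "subst (lsub g) p" and ?I = "subst (\<lambda>i. V (frob i))"
  have D: "(lsub g i)\<^sup>2 = subst (\<lambda>i. V (frob i) ^ 2) (lsub g (rot i))" for i
  proof (cases "i < 5")
    case True
    have "(lsub g i)\<^sup>2 = (\<Sum>k<5. C (g (rot i) (rot k)) * V k ^ 2)"
      using True by (simp add: lsub_def square_lform g)
    also have "\<dots> = (\<Sum>k<5. C (g (rot i) k) * V (frob k) ^ 2)"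
      by (simp add: lessThan5 add_ac)
    also have "\<dots> = subst (\<lambda>i. V (frob i) ^ 2) (lsub g (rot i))"
      using True by (simp add: lsub_def subst_lform)
    finally show ?thesis .
  qed (simp add: lsub_def rot_def frob_def)
  have "?X\<^sup>2 = subst (lsub g) (subst (\<lambda>i. V i ^ 2) p)" by (simp only: p(2)[symmetric] subst_power)
  also have "\<dots> = subst (\<lambda>i. V (frob i) ^ 2) (subst (lsub g) (shift p))"
    by (simp only: shift_def subst_subst subst_power subst_V D)
  also have "\<dots> = subst (\<lambda>i. V i ^ 2) (?I ?X)"
    by (simp only: p(1) subst_subst subst_V)
  finally have "(lookup ?X (mx t))\<^sup>2 = lookup (?I ?X) (mx t)"
    by (metis lookup_square lookup_double)
  also have "\<dots> = lookup (shift (?I ?X)) (mx (rot5 t))"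
    by (simp only: lookup_shift)
  also have "shift (?I ?X) = ?X"
    by (simp add: shift_def subst_subst)
  finally show ?thesis by simp
qed

lemma shift_trace: "shift (trace p) = trace p"
  by (simp add: trace_unfold shift_add shift_pow5 add_ac)

lemma square_cls: "(cls f)\<^sup>2 = subst (\<lambda>i. V i ^ 2) (cls f)"
proof -
  have m: "(mono s)\<^sup>2 = subst (\<lambda>i. V i ^ 2) (mono s)" for s
    by (cases s) (simp add: mono_eq subst_simps power_mult_distrib mult.commute flip: power_mult)
  have "(\<Sum>s\<leftarrow>es. mono s)\<^sup>2 = subst (\<lambda>i. V i ^ 2) (\<Sum>s\<leftarrow>es. mono s)" for es
    by (induction es) (simp_all add: square_add subst_add m)
  then show ?thesis by (simp only: cls_def trace_mono)
qed

subsection \<open>The linear system\<close>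

text \<open>The field trace in coordinates: 1, \<open>beta\<close>, \<open>beta ^ 2\<close> and
  \<open>beta ^ 4\<close> have trace 1, while \<open>beta ^ 3\<close> has trace 0.\<close>

fun gtr :: "gf \<Rightarrow> bool" where "gtr (a0, a1, a2, a3, a4) = (a0 \<noteq> (a1 \<noteq> (a2 \<noteq> a4)))"

definition gtrace :: "gf \<Rightarrow> gf" where
  "gtrace a = (let b = gmul a a; c = gmul b b; d = gmul c c; e = gmul d d in
     gadd a (gadd b (gadd c (gadd d e))))"

lemma gtrace_eq: "gtrace a = (if gtr a then gone else gzero)"
proof -
  have "list_all (\<lambda>a0. list_all (\<lambda>a1. list_all (\<lambda>a2. list_all (\<lambda>a3. list_all (\<lambda>a4.
      gtrace (a0, a1, a2, a3, a4) = (if gtr (a0, a1, a2, a3, a4) then gone else gzero))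
      [False, True]) [False, True]) [False, True]) [False, True]) [False, True]" by code_simp
  then have "gtrace (a0, a1, a2, a3, a4) = (if gtr (a0, a1, a2, a3, a4) then gone else gzero)" for a0 a1 a2 a3 a4
    by (cases a0; cases a1; cases a2; cases a3; cases a4) (simp_all only: list.pred_inject simp_thms)
  then show ?thesis by (cases a) simp
qed

lemma val_gtr: "(\<Sum>j<5. val a ^ 2 ^ j) = of_bool (gtr a)"
proof -
  have "(\<Sum>j<5. val a ^ 2 ^ j) = val (gtrace a)"
    by (simp add: lessThan5 gtrace_def Let_def val_gadd val_gmul eval_nat_numeral mult.assoc)
  then show ?thesis by (simp add: gtrace_eq)
qed

text \<open>Traces against the self-dual normal basis read off the coordinates of each coefficient,
  so one equation over the field with 32 elements becomes five rows over the prime field.\<close>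

definition twisted_rows :: "nat list \<Rightarrow> bool list list" where
  "twisted_rows p = (\<lambda>vs. map (\<lambda>i. map (\<lambda>v. gtr (gmul (conj5 i) v)) vs) [0..<5])
     ((\<lambda>G. map (gvalue G (1, 16, 15, 7, 3)) basis) (perm_mat p))"

definition spike_row :: "e5 \<Rightarrow> gf list" where
  "spike_row t = (\<lambda>G. map (gvalue G t) basis) four_mat"

text \<open>Columns correspond to \<open>basis\<close>. Five rows come from each of three
  permutations at the twisted spike, and the last two from the ordinary spikes.\<close>

definition system :: "bool list list" where
  "system = [[False, False, True, False, True, False, True, True, False, True, True, False, False, False, False, True, True],
     [False, False, True, False, False, False, True, False, True, False, True, True, True, True, False, True, False],
     [True, False, False, False, False, False, True, False, True, True, True, False, False, True, True, False, False],
     [False, False, False, False, True, False, False, False, True, False, True, True, False, True, True, False, False],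
     [True, True, False, False, False, False, False, True, False, False, False, True, False, True, True, True, True],
     [False, True, True, True, False, True, True, False, False, False, True, False, False, False, True, False, True],
     [True, False, True, True, False, False, True, True, False, True, False, True, False, True, False, False, True],
     [False, True, False, False, True, False, False, True, False, False, False, True, False, False, False, True, True],
     [True, False, False, False, False, True, False, True, True, True, True, False, True, True, True, True, False],
     [False, False, False, True, False, True, False, False, False, True, False, True, True, True, True, True, False],
     [False, False, True, False, False, False, False, True, True, False, True, True, False, False, True, False, True],
     [True, True, True, True, True, False, False, False, False, False, True, True, True, False, False, False, False],
     [False, True, False, True, True, False, True, True, False, False, True, False, False, True, True, False, True],
     [False, True, True, False, True, True, True, True, False, True, False, False, True, True, True, True, True],
     [True, True, True, False, True, False, False, True, True, True, False, False, False, True, True, False, True],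
     [True, False, False, False, False, True, False, False, True, True, True, True, False, True, False, False, True],
     [False, True, True, False, True, False, True, False, True, False, False, False, True, True, True, False, False]]"

lemma twisted_rows_1: "twisted_rows [0, 1, 2, 4, 3] = take 5 system" by code_simp
lemma twisted_rows_2: "twisted_rows [0, 1, 4, 3, 2] = take 5 (drop 5 system)" by code_simp
lemma twisted_rows_3: "twisted_rows [0, 2, 1, 4, 3] = take 5 (drop 10 system)" by code_simp
lemma spike_rows: "[spike_row (31, 7, 3, 0, 1), spike_row (31, 3, 7, 0, 1)] =
  map (map (\<lambda>b. if b then gone else gzero)) (drop 15 system)" by code_simp

lemma admissible_basis: "list_all (\<lambda>f. list_all (\<lambda>t. admissible t f)
    [(1, 16, 15, 7, 3), (31, 7, 3, 0, 1), (31, 3, 7, 0, 1)]) basis" by code_simp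

text \<open>The inverse matrix: the \<open>k\<close>-th list names the rows of \<open>system\<close>
  whose sum is the \<open>k\<close>-th unit vector. Being defined over the prime field, it also
  solves the system for unknowns in \<open>F\<close>.\<close>

definition selection :: "nat list list" where
  "selection = [[0, 1, 2, 5, 6, 9, 12, 13, 15, 16], [1, 2, 3, 6, 8, 9, 10, 13, 15], [1, 2, 3, 5, 6, 8, 10, 14], [2, 6, 10], [0, 3, 4, 6, 7, 8, 9, 13, 15, 16], [3, 5, 6, 7, 10, 11, 12, 13, 14, 15], [1, 4, 5, 6, 7, 8, 10, 11, 12, 16], [2, 3, 4, 6, 7, 8, 9, 10], [0, 1, 2, 3, 4, 5, 7, 10, 12, 14, 15, 16], [0, 1, 4, 8, 11, 12, 15, 16], [0, 1, 4, 8, 9, 12, 13, 14, 15], [0, 1, 4, 6, 8, 10, 12, 15], [1, 3, 4, 7, 8, 11, 12, 15], [0, 1, 5, 7, 8, 10, 11, 16], [0, 2, 3, 7, 10, 11, 12, 16], [3, 4, 6, 9, 10, 11, 12, 13, 14, 16], [6, 7, 11, 13, 14, 15]]"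

lemma selection_correct:
  "map (\<lambda>is. fold (\<lambda>i. map2 (\<noteq>) (system ! i)) is (replicate 17 False)) selection
    = map (\<lambda>k. map (\<lambda>l. l = k) [0..<17]) [0..<17]" by code_simp

lemma system_unique:
  assumes c: "\<And>r. r \<in> set system \<Longrightarrow> (\<Sum>k<17. c k * of_bool (r ! k)) = (0 :: F)" and k: "k < 17"
  shows "c k = 0"
proof -
  define dot where "dot r = (\<Sum>k<17. c k * of_bool (r ! k))" for r
  have len: "\<And>r. r \<in> set system \<Longrightarrow> length r = 17" "length system = 17" "length selection = 17"
    "\<And>is i. is \<in> set selection \<Longrightarrow> i \<in> set is \<Longrightarrow> i < 17"
    by (auto simp: system_def selection_def)
  have add: "dot (map2 (\<noteq>) r s) = dot r + dot s" if "length r = 17" "length s = 17" for r s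
  proof -
    have "dot (map2 (\<noteq>) r s) = (\<Sum>k<17. c k * of_bool (r ! k) + c k * of_bool (s ! k))"
      unfolding dot_def
    proof (rule sum.cong[OF refl])
      fix k :: nat assume "k \<in> {..<17}"
      then have "map2 (\<noteq>) r s ! k = (r ! k \<noteq> s ! k)" using that by simp
      then show "c k * of_bool (map2 (\<noteq>) r s ! k) = c k * of_bool (r ! k) + c k * of_bool (s ! k)"
        by (cases "r ! k"; cases "s ! k") simp_all
    qed
    then show ?thesis by (simp only: dot_def sum.distrib)
  qed
  have fold: "dot (fold (\<lambda>i. map2 (\<noteq>) (system ! i)) is s) = dot s"
    if "length s = 17" "\<forall>i\<in>set is. i < 17" for s "is"
    using that
  proof (induction "is" arbitrary: s)
    case (Cons i "is")
    have i: "system ! i \<in> set system" using Cons.prems len by simp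
    then have "dot (system ! i) = 0" unfolding dot_def by (rule c)
    moreover have "length (map2 (\<noteq>) (system ! i) s) = 17" using len(1)[OF i] Cons.prems by simp
    ultimately show ?case
      using Cons.IH[of "map2 (\<noteq>) (system ! i) s"] Cons.prems add[OF len(1)[OF i], of s] by simp
  qed simp
  have "fold (\<lambda>i. map2 (\<noteq>) (system ! i)) (selection ! k) (replicate 17 False) = map (\<lambda>l. l = k) [0..<17]"
    using arg_cong[OF selection_correct, of "\<lambda>xs. xs ! k"] k len(3) by simp
  moreover have "\<forall>i\<in>set (selection ! k). i < 17" using len(4)[of "selection ! k"] len(3) k by simp
  ultimately have "dot (map (\<lambda>l. l = k) [0..<17]) = dot (replicate 17 False)"
    using fold[of "replicate 17 False" "selection ! k"] by simp
  moreover have "dot (replicate 17 False) = 0" unfolding dot_def by (rule sum.neutral) simp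
  moreover have "dot (map (\<lambda>l. l = k) [0..<17]) = (\<Sum>l<17. if l = k then c l else 0)"
    unfolding dot_def by (rule sum.cong) simp_all
  ultimately show ?thesis using k by simp
qed

section \<open>Degree 42\<close>

definition cells :: "nat \<Rightarrow> pol \<Rightarrow> bool" where
  "cells n p \<longleftrightarrow> (\<forall>m\<in>keys p. keys m \<subseteq> {..<5} \<and> deg m = n)"

lemma proj_eq_self: "(\<forall>m\<in>keys p. keys m \<subseteq> {..<5}) \<Longrightarrow> proj p = p"
  by (rule poly_mapping_eqI) (auto simp: lookup_proj in_keys_iff)

lemma proj_eq_selfD: "proj p = p \<Longrightarrow> m \<in> keys p \<Longrightarrow> keys m \<subseteq> {..<5}"
proof (rule ccontr)
  assume p: "proj p = p" "m \<in> keys p" and m: "\<not> keys m \<subseteq> {..<5}"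
  have "lookup (proj p) m = 0" using m by (simp add: lookup_proj)
  then show False using p by (simp add: in_keys_iff)
qed

lemma cells_iff: "cells n p \<longleftrightarrow> proj p = p \<and> hom n p = p"
proof
  assume "cells n p"
  then show "proj p = p \<and> hom n p = p"
    unfolding cells_def by (intro conjI proj_eq_self hom_eq_self) auto
next
  assume *: "proj p = p \<and> hom n p = p"
  then have "deg m = n" if "m \<in> keys p" for m using that keys_hom[of n p] by auto
  then show "cells n p" unfolding cells_def using * proj_eq_selfD by blast
qed

lemma proj_subst_lsub: "proj (subst (lsub g) p) = subst (lsub g) (proj p)"
proof -
  have *: "subst (\<lambda>i. if i < 5 then V i else 0) (lsub g i) = subst (lsub g) (if i < 5 then V i else 0)" for i
  proof (cases "i < 5")
    case True
    then have "subst (\<lambda>i. if i < 5 then V i else 0) (lsub g i) = (\<Sum>k<5. C (g i k) * (if k < 5 then V k else 0))"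
      by (simp only: lsub_def subst_lform if_True)
    also have "\<dots> = lform 5 (g i)" unfolding lform_def by (intro sum.cong) simp_all
    finally have "subst (\<lambda>i. if i < 5 then V i else 0) (lsub g i) = lform 5 (g i)" .
    then show ?thesis using True by (simp add: lsub_def)
  qed (simp add: lsub_def)
  show ?thesis by (simp only: proj_def subst_subst *)
qed

lemma cells_subst_lsub: "cells n p \<Longrightarrow> cells n (subst (lsub g) p)"
  unfolding cells_iff by (simp add: proj_subst_lsub hom_subst[OF deg_lsub])

text \<open>Coefficients 0 and 1 equal their squares, so the substitution commutes with the
  untwisted total square.\<close>

lemma hit_bmat: "p \<in> hit id n \<Longrightarrow> subst (lsub (bmat A)) p \<in> hit id n"
proof (rule hit_subst)
  fix i
  have sq: "bmat A i k ^ 2 = bmat A i k" for k by (simp add: bmat_def)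
  show "lsub (bmat A) i + lsub (bmat A) (id i) ^ 2 = tsq id (lsub (bmat A) i)"
    by (cases "i < 5") (simp_all only: lsub_def id_apply if_True if_False square_lform tsq_lform sq, simp add: tsq_def)
qed (rule deg_lsub)

section \<open>The group elements used, in both coordinate systems\<close>

lemma lsub_permutation: 
  assumes "i < 5" "p ! i < 5"
  shows "lsub (bmat (permutation p)) i = V (p ! i)"
proof -
  have "lform 5 (bmat (permutation p) i) = (\<Sum>k<5. if k = p ! i then V k else 0)"
    unfolding lform_def using assms by (intro sum.cong) (auto simp: bmat_def permutation_def)
  then show ?thesis using assms by (simp add: lsub_def)
qed

text \<open>Multiplication by \<open>\<beta>\<close> in the normal basis \<open>\<beta>, \<beta>\<^sup>2, \<beta>\<^sup>4, \<beta>\<^sup>8, \<beta>\<^sup>1\<^sup>6\<close>.\<close>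

definition singer :: "bool list list" where
  "singer = [[False, True, False, False, False], [True, False, False, True, False],
     [False, False, False, True, True], [False, True, True, False, False], [False, False, True, False, True]]"

definition transvection :: "bool list list" where
  "transvection = [[True, False, False, False, False], [False, True, False, False, False],
     [False, False, True, False, False], [False, False, False, True, False], [False, False, False, True, True]]"

text \<open>The Singer cycle and the five-cycle serve for averaging; the transvection and the
  remaining three permutations supply the linear equations.\<close>

definition generators :: "bool list list list" where
  "generators = singer # transvection # map permutation
     [[4, 0, 1, 2, 3], [0, 1, 2, 4, 3], [0, 1, 4, 3, 2], [0, 2, 1, 4, 3]]"

text \<open>For \<open>j = 0\<close> this is multiplication by \<open>beta\<close> in the normal
  basis, and the other values of \<open>j\<close> are its conjugates. So the columns of the matrix
  of \<open>four\<close> are eigenvectors of the Singer cycle.\<close>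

lemma singer_row:
  assumes "i < 5" "j < 5"
  shows "(\<Sum>k<5. bmat singer i k * bt (k + j)) = bt (i + j) * bt j"
proof -
  have "\<forall>i\<in>set [0..<5]. \<forall>j\<in>set [0..<5]. fold (\<lambda>k s. gadd (if singer ! i ! k then conj5 (k + j) else gzero) s) [0..<5] gzero
      = gmul (conj5 (i + j)) (conj5 j)" by code_simp
  then have eq: "fold (\<lambda>k s. gadd (if singer ! i ! k then conj5 (k + j) else gzero) s) [0..<5] gzero
      = gmul (conj5 (i + j)) (conj5 j)" using assms by simp
  have v: "val (if singer ! i ! k then conj5 (k + j) else gzero) = bmat singer i k * bt (k + j)" for k
    by (simp add: bmat_def val_conj5)
  have "(\<Sum>k<5. bmat singer i k * bt (k + j)) = (\<Sum>k\<leftarrow>[0..<5]. bmat singer i k * bt (k + j))"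
    by (simp only: interv_sum_list_conv_sum_set_nat set_upt atLeast0LessThan)
  also have "\<dots> = val (gmul (conj5 (i + j)) (conj5 j))"
    unfolding eq[symmetric] val_fold_gadd v by simp
  finally show ?thesis by (simp add: val_gmul val_conj5)
qed

lemma four_singer: "four (subst (lsub (bmat singer)) q) = torus (four q)"
proof -
  have torus: "torus = subst (lsub (\<lambda>i j. if i = j then bt i else 0))"
  proof -
    have "lform 5 (\<lambda>j. if i = j then bt i else 0) = C (bt i) * V i" if "i < 5" for i
    proof -
      have "lform 5 (\<lambda>j. if i = j then bt i else 0) = (\<Sum>k<5. if k = i then C (bt i) * V i else 0)"
        unfolding lform_def by (intro sum.cong) auto
      then show ?thesis using that by simp
    qed
    then have "lsub (\<lambda>i j. if i = j then bt i else 0) = (\<lambda>i. if i < 5 then C (bt i) * V i else V i)"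
      by (auto simp: fun_eq_iff lsub_def)
    then show ?thesis by (simp only: torus_def)
  qed
  have "lsub (\<lambda>i j. \<Sum>k<5. bmat singer i k * bt (k + j)) = lsub (\<lambda>i j. \<Sum>k<5. bt (i + k) * (if k = j then bt k else 0))"
  proof (rule lsub_cong)
    fix i j :: nat assume ij: "i < 5" "j < 5"
    have "(\<Sum>k<5. bt (i + k) * (if k = j then bt k else 0)) = (\<Sum>k<5. if k = j then bt (i + j) * bt j else 0)"
      by (intro sum.cong) auto
    then show "(\<Sum>k<5. bmat singer i k * bt (k + j)) = (\<Sum>k<5. bt (i + k) * (if k = j then bt k else 0))"
      using ij by (simp add: singer_row)
  qed
  then show ?thesis unfolding torus four_def subst_lsub_lsub by simp
qed

text \<open>The substitution moves exponents from the last variable to the one before it and keeps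
  their sum. A target with sum 1 in these two variables has only two possible sources.\<close>

lemma subst_transvection:
  "lookup (subst (lsub (bmat transvection)) (mono (a0, a1, a2, a3, a4))) (mx (s0, s1, s2, 1, 0)) =
     of_bool ((a0, a1, a2, a3, a4) = (s0, s1, s2, 1, 0)) + of_bool ((a0, a1, a2, a3, a4) = (s0, s1, s2, 0, 1))"
proof -
  have L: "lsub (bmat transvection) 0 = V 0" "lsub (bmat transvection) 1 = V 1" "lsub (bmat transvection) 2 = V 2"
    "lsub (bmat transvection) 3 = V 3" "lsub (bmat transvection) 4 = V 4 + V 3"
    by (simp_all add: lsub_def lform_def lessThan5 bmat_def transvection_def add_ac)
  have "subst (lsub (bmat transvection)) (mono (a0, a1, a2, a3, a4)) =
      V 0 ^ a0 * V 1 ^ a1 * V 2 ^ a2 * V 3 ^ a3 * (V 4 + V 3) ^ a4"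
    unfolding mono_eq subst_mult subst_power subst_V L ..
  also have "\<dots> = (\<Sum>j\<leftarrow>odd_binomials a4. V 0 ^ a0 * V 1 ^ a1 * V 2 ^ a2 * V 3 ^ a3 * (V 4 ^ (a4 - j) * V 3 ^ j))"
    using power_add_char2[of a4 "V 4" "V 3"] by (simp only: sum_list_const_mult)
  also have "\<dots> = (\<Sum>j\<leftarrow>odd_binomials a4. mono (a0, a1, a2, a3 + j, a4 - j))"
    unfolding mono_eq power_add by (simp only: mult_ac)
  finally have eq: "subst (lsub (bmat transvection)) (mono (a0, a1, a2, a3, a4)) =
      (\<Sum>t\<leftarrow>map (\<lambda>j. (a0, a1, a2, a3 + j, a4 - j)) (odd_binomials a4). mono t)"
    by (simp add: o_def)
  show ?thesis
  proof (cases "a4 \<le> 1")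
    case True
    then consider "a4 = 0" | "a4 = 1" by linarith
    then show ?thesis
    proof cases
      case 1
      have o: "odd_binomials 0 = [0]" by code_simp
      show ?thesis unfolding eq unfolding 1 o by (auto simp: lookup_mon)
    next
      case 2
      have o: "odd_binomials 1 = [0, 1]" by code_simp
      show ?thesis unfolding eq unfolding 2 o by (auto simp: lookup_mon lookup_add)
    qed
  next
    case False
    have "(s0, s1, s2, 1, 0) \<notin> set (map (\<lambda>j. (a0, a1, a2, a3 + j, a4 - j)) (odd_binomials a4))"
      using False by auto
    then have "lookup (subst (lsub (bmat transvection)) (mono (a0, a1, a2, a3, a4))) (mx (s0, s1, s2, 1, 0)) = 0"
      unfolding eq by (rule lookup_mono_list)
    then show ?thesis using False by simp
  qed
qed

lemma lookup_transvection:
  "lookup (subst (lsub (bmat transvection)) (proj p)) (mx (s0, s1, s2, 1, 0)) =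
     lookup p (mx (s0, s1, s2, 1, 0)) + lookup p (mx (s0, s1, s2, 0, 1))"
proof (induction p rule: pol_induct)
  case (mon c m)
  have p: "proj (C c * mon m) = C c * proj (mon m)" by (simp add: proj_def subst_C_mult)
  have "lookup (subst (lsub (bmat transvection)) (proj (mon m))) (mx (s0, s1, s2, 1, 0)) =
     lookup (mon m) (mx (s0, s1, s2, 1, 0)) + lookup (mon m) (mx (s0, s1, s2, 0, 1))"
  proof (cases "keys m \<subseteq> {..<5}")
    case True
    then obtain a0 a1 a2 a3 a4 where m: "m = mx (a0, a1, a2, a3, a4)" using mx_lookup by blast
    show ?thesis unfolding proj_mon if_P[OF True] unfolding m subst_transvection lookup_mon mx_eq_iff by simp
  next
    case False
    then have "m \<noteq> mx t" for t using keys_mx[of t] by blast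
    then show ?thesis using False by (simp add: proj_mon lookup_mon)
  qed
  then show ?case by (simp only: p subst_C_mult lookup_C_mult distrib_left)
next
  case (add p q)
  have "proj (p + q) = proj p + proj q" by (simp add: proj_def subst_add)
  then show ?case using add by (simp add: subst_add lookup_add add_ac)
qed (simp add: proj_def)

lemma length_basis: "length basis = 17"
  by (simp add: basis_def)

lemma lookup_rot_iterate:
  assumes g: "\<And>i j. i < 5 \<Longrightarrow> j < 5 \<Longrightarrow> g (rot i) (rot j) = g i j ^ 2"
  shows "lookup (subst (lsub g) (cls f)) (mx ((rot5 ^^ j) t)) = lookup (subst (lsub g) (cls f)) (mx t) ^ 2 ^ j"
proof (induction j)
  case (Suc j)
  have p: "shift (cls f) = cls f" by (simp add: cls_def shift_trace)
  have "lookup (subst (lsub g) (cls f)) (mx ((rot5 ^^ Suc j) t)) = (lookup (subst (lsub g) (cls f)) (mx ((rot5 ^^ j) t)))\<^sup>2"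
    unfolding funpow.simps o_apply
    by (rule lookup_semilinear[OF _ p square_cls]) (erule (1) g)
  then show ?case unfolding Suc by (simp add: mult.commute flip: power_mult)
qed simp

text \<open>The unknowns \<open>c k\<close> lie in \<open>F\<close> and must not be raised to
  powers. The conjugate equations are therefore read off at the five rotated monomials instead of
  applying Frobenius to one equation; combined with conjugates of \<open>conj5 i\<close> they form a
  trace.\<close>

lemma twisted_row_zero:
  assumes p: "\<And>l. l < 5 \<Longrightarrow> p ! l < 5"
    and z: "\<And>j. lookup (subst (lsub (vmat (perm_mat p))) (\<Sum>k<17. C (c k) * cls (basis ! k))) (mx ((rot5 ^^ j) (1, 16, 15, 7, 3))) = 0"
    and r: "r \<in> set (twisted_rows p)"
  shows "(\<Sum>k<17. c k * of_bool (r ! k)) = 0"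
proof -
  let ?t = "(1, 16, 15, 7, 3) :: e5"
  define a where "a k = gvalue (perm_mat p) ?t (basis ! k)" for k
  obtain i where i: "i < 5" and r: "r = map (\<lambda>v. gtr (gmul (conj5 i) v)) (map (gvalue (perm_mat p) ?t) basis)"
    using r by (auto simp: twisted_rows_def)
  have rk: "r ! k = gtr (gmul (conj5 i) (a k))" if "k < 17" for k
    using that by (simp add: r a_def length_basis)
  have s: "(\<Sum>k<17. c k * val (a k) ^ 2 ^ j) = 0" for j
  proof -
    have "lookup (subst (lsub (vmat (perm_mat p))) (cls (basis ! k))) (mx ((rot5 ^^ j) ?t)) = val (a k) ^ 2 ^ j"
      if "k < 17" for k
    proof -
      have "admissible ?t (basis ! k)"
        using admissible_basis that nth_mem[of k basis] by (simp add: list_all_iff length_basis)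
      then have "lookup (subst (lsub (vmat (perm_mat p))) (cls (basis ! k))) (mx ?t) = val (a k)"
        unfolding a_def by (rule val_gvalue)
      moreover have "lookup (subst (lsub (vmat (perm_mat p))) (cls (basis ! k))) (mx ((rot5 ^^ j) ?t))
          = lookup (subst (lsub (vmat (perm_mat p))) (cls (basis ! k))) (mx ?t) ^ 2 ^ j"
        by (rule lookup_rot_iterate) (erule (1) vmat_perm_mat_rot)
      ultimately show ?thesis by (simp only:)
    qed
    then have "(\<Sum>k<17. c k * val (a k) ^ 2 ^ j) =
        (\<Sum>k<17. lookup (subst (lsub (vmat (perm_mat p))) (C (c k) * cls (basis ! k))) (mx ((rot5 ^^ j) ?t)))"
      by (intro sum.cong) (simp_all add: subst_C_mult lookup_C_mult)
    also have "\<dots> = 0" using z[of j] by (simp only: subst_sum lookup_sum)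
    finally show ?thesis .
  qed
  have "(\<Sum>k<17. c k * of_bool (r ! k)) = (\<Sum>k<17. \<Sum>j<5. val (conj5 i) ^ 2 ^ j * (c k * val (a k) ^ 2 ^ j))"
  proof (rule sum.cong[OF refl])
    fix k :: nat assume "k \<in> {..<17}"
    then have "of_bool (r ! k) = (\<Sum>j<5. val (gmul (conj5 i) (a k)) ^ 2 ^ j)" by (simp only: rk val_gtr lessThan_iff)
    then show "c k * of_bool (r ! k) = (\<Sum>j<5. val (conj5 i) ^ 2 ^ j * (c k * val (a k) ^ 2 ^ j))"
      by (simp only: val_gmul power_mult_distrib sum_distrib_left mult_ac)
  qed
  also have "\<dots> = (\<Sum>j<5. val (conj5 i) ^ 2 ^ j * (\<Sum>k<17. c k * val (a k) ^ 2 ^ j))"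
    by (subst sum.swap) (simp only: sum_distrib_left)
  finally show ?thesis by (simp only: s mult_zero_right sum.neutral_const)
qed

text \<open>In the original coordinates the classes have coefficients 0 or 1 at these spikes, so
  each spike gives an equation over the prime field directly.\<close>

lemma spike_row_zero:
  assumes z: "lookup (four (\<Sum>k<17. C (c k) * cls (basis ! k))) (mx t) = 0"
    and t: "t \<in> {(31, 7, 3, 0, 1), (31, 3, 7, 0, 1)}"
    and r: "map (\<lambda>b. if b then gone else gzero) r = spike_row t" "length r = 17"
  shows "(\<Sum>k<17. c k * of_bool (r ! k)) = 0"
proof -
  have *: "of_bool (r ! k) = lookup (four (cls (basis ! k))) (mx t)" if "k < 17" for k
  proof -
    have "admissible t (basis ! k)"
      using admissible_basis that t nth_mem[of k basis] by (auto simp: list_all_iff length_basis)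
    then have "lookup (four (cls (basis ! k))) (mx t) = val (gvalue four_mat t (basis ! k))"
      by (simp only: four_eq val_gvalue)
    also have "gvalue four_mat t (basis ! k) = spike_row t ! k"
      using that by (simp add: spike_row_def length_basis)
    also have "\<dots> = (if r ! k then gone else gzero)" unfolding r(1)[symmetric] using that r(2) by simp
    finally show ?thesis by simp
  qed
  have "(\<Sum>k<17. c k * of_bool (r ! k)) = (\<Sum>k<17. lookup (four (C (c k) * cls (basis ! k))) (mx t))"
    by (intro sum.cong refl) (simp only: * lessThan_iff four_C_mult lookup_C_mult)
  also have "\<dots> = 0" using z by (simp only: four_sum lookup_sum)
  finally show ?thesis .
qed

lemma system_split:
  "system = take 5 system @ take 5 (drop 5 system) @ take 5 (drop 10 system) @ drop 15 system"
  by code_simp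

lemma lookup_twisted_rot:
  assumes s: "shift q + q \<in> hit frob 42" and t: "torus q + q \<in> hit frob 42"
  shows "(\<forall>h\<in>hit frob 42. lookup h (mx ((rot5 ^^ j) (1, 16, 15, 7, 3))) = 0) \<and>
    lookup q (mx ((rot5 ^^ j) (1, 16, 15, 7, 3))) = 0"
proof (induction j)
  case 0
  let ?m = "mx (1, 16, 15, 7, 3)"
  \<comment> \<open>The weight is 1 + 2 * 16 + 4 * 15 + 8 * 7 + 16 * 3 = 197, which is 11 modulo 31.
    Being nonzero, it forces the coefficient of a torus-invariant class to vanish.\<close>
  have T: "lookup (torus p) ?m = beta ^ 197 * lookup p ?m" for p
  proof (induction p rule: pol_induct)
    case (mon c n)
    have "lookup (torus (mon n)) ?m = beta ^ 197 * lookup (mon n) ?m"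
    proof (cases "keys n \<subseteq> {..<5}")
      case True
      then obtain a0 a1 a2 a3 a4 where n: "n = mx (a0, a1, a2, a3, a4)" using mx_lookup by blast
      show ?thesis unfolding n torus_mono lookup_C_mult lookup_mon by auto
    next
      case False
      have "proj (torus (mon n)) = torus (proj (mon n))"
      proof -
        have "subst (\<lambda>i. if i < 5 then V i else 0) (if i < 5 then C (bt i) * V i else V i)
            = subst (\<lambda>i. if i < 5 then C (bt i) * V i else V i) (if i < 5 then V i else 0)" for i
          by (simp add: subst_C_mult)
        then show ?thesis by (simp only: proj_def torus_def subst_subst)
      qed
      then have "lookup (torus (mon n)) ?m = lookup (torus (proj (mon n))) ?m"
        using lookup_proj[of "torus (mon n)" ?m] keys_mx[of "(1, 16, 15, 7, 3)"] by simp
      moreover have "n \<noteq> ?m" using False keys_mx[of "(1, 16, 15, 7, 3)"] by blast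
      ultimately show ?thesis using False by (simp add: proj_mon torus_def lookup_mon)
    qed
    then show ?case by (simp only: torus_C_mult lookup_C_mult mult.left_commute)
  qed (simp_all add: torus_def subst_add lookup_add distrib_left)
  have "beta ^ 197 * lookup q ?m + lookup q ?m = 0"
    using lookup_hit_twisted[OF t] by (simp only: lookup_add T)
  moreover have "beta ^ 197 \<noteq> 1" by (simp add: beta_power_eq_1_iff)
  ultimately have "lookup q ?m = 0"
    by (simp add: add_eq_0_char2)
  then show ?case using lookup_hit_twisted by simp
next
  case (Suc j)
  let ?t = "(rot5 ^^ j) (1, 16, 15, 7, 3)"
  have h: "lookup h (mx (rot5 ?t)) = 0" if "h \<in> hit frob 42" for h
  proof -
    have "lookup h (mx (rot5 ?t)) = lookup (shift (shift (shift (shift h)))) (mx ?t)"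
      using lookup_shift[of "shift (shift (shift (shift h)))" ?t] by (simp only: shift_pow5)
    moreover have "shift (shift (shift (shift h))) \<in> hit frob 42"
      using that by (intro hit_shift)
    ultimately show ?thesis using Suc by simp
  qed
  moreover have "lookup q (mx (rot5 ?t)) = 0"
    using h[OF s] Suc by (simp add: lookup_add lookup_shift)
  ultimately show ?case by simp
qed

theorem invariant_hit_42:
  assumes q: "cells 42 q"
    and inv: "\<And>A. A \<in> set generators \<Longrightarrow> subst (lsub (bmat A)) q + q \<in> hit id 42"
  shows "q \<in> hit id 42"
proof -
  let ?t = "(1, 16, 15, 7, 3) :: e5"
  define q' where "q' = four q"
  have q4: "four q' = q" by (simp add: q'_def)
  have q': "cells 42 q'" unfolding q'_def four_def by (rule cells_subst_lsub[OF q])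
  have "four (subst (lsub (bmat singer)) q + q) \<in> hit frob 42"
    by (intro hit_four_frob inv) (simp add: generators_def)
  then have torus: "torus q' + q' \<in> hit frob 42"
    by (simp only: four_add four_singer q'_def)
  have "lsub (bmat (permutation [4, 0, 1, 2, 3])) = (\<lambda>i. V (frob i))"
  proof
    fix i
    show "lsub (bmat (permutation [4, 0, 1, 2, 3])) i = V (frob i)"
    proof (cases "i < 5")
      case True
      then have "[4, 0, 1, 2, 3] ! i = frob i" unfolding less5 by auto
      then show ?thesis using True lsub_permutation[of i "[4, 0, 1, 2, 3]"] by simp
    qed (simp add: lsub_def frob_def)
  qed
  moreover have "four (subst (lsub (bmat (permutation [4, 0, 1, 2, 3]))) q + q) \<in> hit frob 42"
    by (intro hit_four_frob inv) (simp add: generators_def)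
  ultimately have shift: "shift q' + q' \<in> hit frob 42"
    by (simp only: four_add four_shift q'_def)
  have "reducible q'"
    by (rule reducible_invariant[OF _ torus shift]) (use q' in \<open>simp add: cells_def\<close>)
  then obtain c where c: "q' + (\<Sum>k<17. C (c k) * cls (basis ! k)) \<in> hit frob 42"
    by (auto simp: reducible_def)
  define v where "v = (\<Sum>k<17. C (c k) * cls (basis ! k))"
  have qv: "q' + v \<in> hit frob 42" using c by (simp only: v_def)
  have twisted: "(\<Sum>k<17. c k * of_bool (r ! k)) = 0"
    if "permutation p \<in> set generators" and p: "\<And>l. l < 5 \<Longrightarrow> p ! l < 5" and r: "r \<in> set (twisted_rows p)" for p r
  proof (rule twisted_row_zero[OF p _ r])
    fix j
    let ?G = "subst (lsub (vmat (perm_mat p)))" and ?Q = "subst (lsub (bmat (permutation p)))"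
      and ?m = "mx ((rot5 ^^ j) ?t)"
    have G: "?G w = four (?Q (four w))" for w
      by (rule four_permutation_four[symmetric]) (rule p)
    have "?G (q' + v) \<in> hit frob 42"
      unfolding G by (intro hit_four_frob hit_bmat hit_four_id qv)
    moreover have "four (?Q (four q') + q) \<in> hit frob 42"
      unfolding q4 by (intro hit_four_frob inv) (use that(1) in simp)
    then have "?G q' + q' \<in> hit frob 42"
      by (simp only: four_add G q'_def)
    \<comment> \<open>The unknown \<open>?G q'\<close> cancels, which leaves
      \<open>?G v + q'\<close>; the coefficient of \<open>q'\<close> at the twisted spikes is
      zero.\<close>
    ultimately have "?G (q' + v) + (?G q' + q') \<in> hit frob 42" by (rule hit_add)
    then have "lookup (?G (q' + v) + (?G q' + q')) ?m = 0"
      using lookup_twisted_rot[OF shift torus, of j] by blast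
    then have "lookup (?G v) ?m + lookup q' ?m = 0"
      by (simp add: subst_add lookup_add add_ac)
    then show "lookup (?G (\<Sum>k<17. C (c k) * cls (basis ! k))) ?m = 0"
      using lookup_twisted_rot[OF shift torus, of j] by (simp add: v_def)
  qed
  have spike: "lookup (four v) (mx (s0, s1, s2, 0, 1)) = 0"
    if "(s0, s1, s2) \<in> {(31, 7, 3), (31, 3, 7)}" for s0 s1 s2
  proof -
    have h: "lookup h (mx (s0, s1, s2, b, 1 - b)) = 0" if "h \<in> hit id 42" "b \<le> 1" for h b
    proof -
      have b: "\<exists>k. b = 2 ^ k - 1" "\<exists>k. 1 - b = 2 ^ k - 1"
        using that(2) by (cases b; auto intro: exI[of _ 0] exI[of _ 1])+
      have s: "\<exists>k. s0 = 2 ^ k - 1" "\<exists>k. s1 = 2 ^ k - 1" "\<exists>k. s2 = 2 ^ k - 1"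
        using \<open>(s0, s1, s2) \<in> _\<close> by (auto intro: exI[of _ 5] exI[of _ 3] exI[of _ 2])
      have "42 = deg5 (s0, s1, s2, b, 1 - b)" using \<open>(s0, s1, s2) \<in> _\<close> that(2) by auto
      then show ?thesis using b s lookup_hit_spike[OF that(1)] by blast
    qed
    have "subst (lsub (bmat transvection)) q + q \<in> hit id 42"
      by (intro inv) (simp add: generators_def)
    then have "lookup (subst (lsub (bmat transvection)) q + q) (mx (s0, s1, s2, 1, 0)) = 0"
      using h[of _ 1] by simp
    moreover have "proj q = q" using q by (simp add: cells_iff)
    \<comment> \<open>The transvection adds the coefficient at the spike with last exponents 0, 1 to
      the one at 1, 0. Invariance modulo hits cancels the latter.\<close>
    ultimately have "lookup q (mx (s0, s1, s2, 0, 1)) = 0"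
      using lookup_transvection[of q s0 s1 s2] by (simp add: lookup_add add_ac)
    moreover have "q + four v \<in> hit id 42"
      using hit_four_id[OF qv] by (simp only: four_add q4)
    then have "lookup (q + four v) (mx (s0, s1, s2, 0, 1)) = 0" using h[of _ 0] by simp
    ultimately show ?thesis by (simp add: lookup_add)
  qed
  have c0: "c k = 0" if "k < 17" for k
  proof (rule system_unique[OF _ that])
    fix r assume r: "r \<in> set system"
    have p: "l < 5 \<Longrightarrow> [0, 1, 2, 4, 3] ! l < (5::nat)" "l < 5 \<Longrightarrow> [0, 1, 4, 3, 2] ! l < (5::nat)"
      "l < 5 \<Longrightarrow> [0, 2, 1, 4, 3] ! l < (5::nat)" for l :: nat
      unfolding less5[of l] by auto
    have g: "permutation [0, 1, 2, 4, 3] \<in> set generators" "permutation [0, 1, 4, 3, 2] \<in> set generators"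
      "permutation [0, 2, 1, 4, 3] \<in> set generators" by (simp_all add: generators_def)
    have "r \<in> set (take 5 system) \<or> r \<in> set (take 5 (drop 5 system)) \<or> r \<in> set (take 5 (drop 10 system)) \<or> r \<in> set (drop 15 system)"
      using r by (subst (asm) system_split) (simp only: set_append Un_iff)
    then show "(\<Sum>k<17. c k * of_bool (r ! k)) = 0"
    proof (elim disjE)
      assume "r \<in> set (drop 15 system)"
      then have "map (\<lambda>b. if b then gone else gzero) r \<in> set [spike_row (31, 7, 3, 0, 1), spike_row (31, 3, 7, 0, 1)]"
        unfolding spike_rows set_map by (rule imageI)
      then have "map (\<lambda>b. if b then gone else gzero) r = spike_row (31, 7, 3, 0, 1) \<or>
          map (\<lambda>b. if b then gone else gzero) r = spike_row (31, 3, 7, 0, 1)" by simp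
      then obtain t where t: "t \<in> {(31, 7, 3, 0, 1), (31, 3, 7, 0, 1)}"
        "map (\<lambda>b. if b then gone else gzero) r = spike_row t" by blast
      have "lookup (four (\<Sum>k<17. C (c k) * cls (basis ! k))) (mx t) = 0"
        unfolding v_def[symmetric] using spike t(1) by auto
      moreover have "length r = 17" using r by (auto simp: system_def)
      ultimately show ?thesis by (rule spike_row_zero[OF _ t])
    qed (use twisted[OF g(1) p(1)] twisted[OF g(2) p(2)] twisted[OF g(3) p(3)] in
        \<open>simp_all only: twisted_rows_1 twisted_rows_2 twisted_rows_3\<close>)
  qed
  have "v = 0" by (simp add: v_def c0)
  then have "q' \<in> hit frob 42" using qv by simp
  then show ?thesis using hit_four_id[of q' 42] q4 by simp
qed

section \<open>Kameko's squaring operation\<close>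

definition X1 :: pol where "X1 = mon (ind {..<5})"

text \<open>The span of the monomials in which not every one of the five exponents is odd: the
  complement of the image of Kameko's map.\<close>

definition few_odd :: "pol \<Rightarrow> bool" where
  "few_odd p \<longleftrightarrow> (\<forall>m\<in>keys p. odds m \<subset> {..<5})"

lemma few_odd_add: "few_odd p \<Longrightarrow> few_odd q \<Longrightarrow> few_odd (p + q)"
  unfolding few_odd_def by (rule ballI, drule keys_add_cases) blast

lemma few_odd_sum: "(\<And>a. a \<in> A \<Longrightarrow> few_odd (f a)) \<Longrightarrow> few_odd (sum f A)"
  unfolding few_odd_def by (rule ballI, drule keys_sum_cases) blast

lemma lookup_few_odd: "few_odd p \<Longrightarrow> lookup p (ind {..<5} + (m + m)) = 0"
proof (rule ccontr)
  assume p: "few_odd p" and "lookup p (ind {..<5} + (m + m)) \<noteq> 0"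
  then have "ind {..<5} + (m + m) \<in> keys p" by (simp add: in_keys_iff)
  then have "odds (ind {..<5} + (m + m)) \<subset> {..<5}" using p by (simp only: few_odd_def)
  moreover have "odds (ind {..<5}) = {..<5}" by (auto simp: odds_def lookup_ind)
  ultimately show False by simp
qed

lemma few_oddI:
  assumes "\<And>m. m \<in> keys p \<Longrightarrow> odds m \<subseteq> {..<5}" "\<And>m. lookup p (ind {..<5} + (m + m)) = 0"
  shows "few_odd p"
  unfolding few_odd_def
proof
  fix m assume m: "m \<in> keys p"
  obtain h where "m = ind (odds m) + (h + h)" by (rule monom_split)
  then have "odds m \<noteq> {..<5}" using m assms(2)[of h] by (metis in_keys_iff)
  then show "odds m \<subset> {..<5}" using assms(1)[OF m] by blast
qed

lemma keys_C_mult: "keys (C c * p) \<subseteq> keys p"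
  by (auto simp: in_keys_iff lookup_C_mult)

lemma square_root: obtains d where "d\<^sup>2 = (c :: F)"
proof -
  have "\<exists>d. (\<Sum>k\<le>2. (if k = 0 then c else if k = 1 then 0 else 1) * d ^ k) = (0 :: F)"
    by (rule alg_closed) simp_all
  then obtain d where "c + d\<^sup>2 = 0" by (auto simp: eval_nat_numeral)
  then show ?thesis using that by (simp add: add_eq_0_char2)
qed

text \<open>Monomials with five odd exponents are collected in the first summand. Since
  \<open>r\<close> enters squared, its coefficients are square roots, which exist in
  \<open>F\<close>.\<close>

lemma Kameko_decomposition:
  obtains r l where "proj p = X1 * r\<^sup>2 + l" "few_odd l"
proof -
  have "\<exists>r l. proj p = X1 * r\<^sup>2 + l \<and> few_odd l"
  proof (induction p rule: pol_induct)
    case zero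
    show ?case by (intro exI[of _ 0]) (simp add: few_odd_def proj_def)
  next
    case (add p q)
    then obtain r l r' l' where "proj p = X1 * r\<^sup>2 + l" "few_odd l" "proj q = X1 * r'\<^sup>2 + l'" "few_odd l'" by blast
    then have "proj (p + q) = X1 * (r + r')\<^sup>2 + (l + l') \<and> few_odd (l + l')"
      by (simp add: few_odd_add proj_def subst_add square_add distrib_left add_ac)
    then show ?case by blast
  next
    case (mon c m)
    have p: "proj (C c * mon m) = C c * proj (mon m)" by (simp add: proj_def subst_C_mult)
    show ?case
    proof (cases "keys m \<subseteq> {..<5}")
      case False
      then have "proj (C c * mon m) = X1 * 0\<^sup>2 + 0 \<and> few_odd 0" by (simp add: p proj_mon few_odd_def)
      then show ?thesis by blast
    next
      case True
      then have q: "proj (C c * mon m) = C c * mon m" by (simp add: p proj_mon)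
      show ?thesis
      proof (cases "odds m = {..<5}")
        case True
        obtain h where h: "m = ind (odds m) + (h + h)" by (rule monom_split)
        obtain d where d: "d\<^sup>2 = c" by (rule square_root)
        have "X1 * (C d * mon h)\<^sup>2 = C c * mon (ind {..<5} + (h + h))"
          unfolding square_term d X1_def mon_add by (simp only: mult_ac)
        then have "proj (C c * mon m) = X1 * (C d * mon h)\<^sup>2 + 0 \<and> few_odd 0"
          using q h True by (simp add: few_odd_def)
        then show ?thesis by blast
      next
        case False
        then have "odds m \<subset> {..<5}" using True odds_subset[of m] by blast
        then have "few_odd (C c * mon m)" using keys_C_mult[of c "mon m"] by (auto simp: few_odd_def)
        then have "proj (C c * mon m) = X1 * 0\<^sup>2 + C c * mon m \<and> few_odd (C c * mon m)" by (simp add: q)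
        then show ?thesis by blast
      qed
    qed
  qed
  then show ?thesis using that by blast
qed

subsection \<open>Compatibility with linear substitutions\<close>

fun bpermanent :: "bool list list \<Rightarrow> nat list \<Rightarrow> nat list \<Rightarrow> bool" where
  "bpermanent A [] U = True"
| "bpermanent A (r # rs) U = fold (\<lambda>c s. (A ! r ! c \<and> bpermanent A rs (remove1 c U)) \<noteq> s) U False"

lemma of_bool_fold_xor: "of_bool (fold (\<lambda>c s. f c \<noteq> s) U s) = (\<Sum>c\<leftarrow>U. of_bool (f c)) + (of_bool s :: 'a::char2)"
proof (induction U arbitrary: s)
  case (Cons c U)
  have "of_bool (fold (\<lambda>c s. f c \<noteq> s) (c # U) s) = (\<Sum>c\<leftarrow>U. of_bool (f c)) + (of_bool (f c \<noteq> s) :: 'a)"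
    using Cons[of "f c \<noteq> s"] by simp
  then show ?case by (simp only: of_bool_xor list.map sum_list.Cons add_ac)
qed simp

lemma of_bool_bpermanent: "of_bool (bpermanent A rs U) = permanent (bmat A) rs U"
proof (induction rs arbitrary: U)
  case (Cons r rs)
  have "of_bool (A ! r ! c \<and> bpermanent A rs V) = bmat A r c * permanent (bmat A) rs V" for c V
    by (simp add: of_bool_conj bmat_def flip: Cons)
  then show ?case by (simp only: bpermanent.simps permanent.simps of_bool_fold_xor of_bool_eq add_0_right)
qed simp

text \<open>Modulo two these are determinants of invertible matrices. The identity permutation is
  included so that the formula for \<open>X1\<close> itself becomes a special case.\<close>

lemma generators_bpermanent:
  "list_all (\<lambda>A. bpermanent A [0..<5] [0..<5]) (permutation [0, 1, 2, 3, 4] # generators)"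
  by code_simp

lemma lookup_generator:
  assumes "A \<in> set (permutation [0, 1, 2, 3, 4] # generators)"
  shows "lookup (prod_list (map (lsub (bmat A)) [0..<5]) * p\<^sup>2) (ind {..<5} + (m + m)) = (lookup p m)\<^sup>2"
proof -
  have "bpermanent A [0..<5] [0..<5]" using generators_bpermanent assms by (simp only: list_all_iff)
  then have "permanent (bmat A) [0..<5] [0..<5] = 1" by (simp only: of_bool_eq flip: of_bool_bpermanent)
  moreover have "set [0..<5] = {..<5::nat}" by auto
  ultimately show ?thesis
    using lookup_prod_square[of "[0..<5]" "[0..<5]" "bmat A" p m] by simp
qed

lemma X1_list: "X1 = prod_list (map V [0..<5])"
  using prod.distinct_set_conv_list[of "[0..<5]" V]
  by (simp only: X1_def mon_ind lessThan_atLeast0 set_upt distinct_upt)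

lemma lookup_X1_square: "lookup (X1 * p\<^sup>2) (ind {..<5} + (m + m)) = (lookup p m)\<^sup>2"
proof -
  have "lsub (bmat (permutation [0, 1, 2, 3, 4])) i = V i" if "i < 5" for i
  proof -
    have "[0, 1, 2, 3, 4] ! i = i" using that unfolding less5 by auto
    then show ?thesis using lsub_permutation[of i "[0, 1, 2, 3, 4]"] that by simp
  qed
  then have "map (lsub (bmat (permutation [0, 1, 2, 3, 4]))) [0..<5] = map V [0..<5]"
    by simp
  then show ?thesis
    using lookup_generator[of "permutation [0, 1, 2, 3, 4]" p m] by (simp only: X1_list list.set_intros)
qed

lemma odds_add: "odds (a + b) \<subseteq> odds a \<union> odds b"
  by (auto simp: odds_def lookup_add)

lemma odds_prod_list:
  fixes ps :: "pol list"
  assumes "\<And>p m. p \<in> set ps \<Longrightarrow> m \<in> keys p \<Longrightarrow> odds m \<subseteq> S" "m \<in> keys (prod_list ps * q\<^sup>2)"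
  shows "odds m \<subseteq> S"
  using assms
proof (induction ps arbitrary: m)
  case Nil
  then show ?case using keys_square[of m q] by auto
next
  case (Cons p ps)
  have "m \<in> keys (p * (prod_list ps * q\<^sup>2))" using Cons.prems(2) by (simp add: mult.assoc)
  then obtain a b where "a \<in> keys p" "b \<in> keys (prod_list ps * q\<^sup>2)" "m = a + b" by (rule keys_mult_cases)
  moreover have "odds b \<subseteq> S"
    by (rule Cons.IH[OF _ calculation(2)]) (erule (1) Cons.prems(1)[OF list.set_intros(2)])
  moreover have "odds a \<subseteq> S" using Cons.prems(1)[of p a] calculation(1) by simp
  ultimately show ?case using odds_add[of a b] by blast
qed

lemma odds_lsub: "i < 5 \<Longrightarrow> m \<in> keys (lsub g i) \<Longrightarrow> odds m \<subseteq> {..<5}"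
  by (auto simp: lsub_def odds_def lookup_single when_def dest!: keys_lform split: if_splits)

lemma odds_lsub_prod:
  assumes "set rs \<subseteq> {..<5}" "m \<in> keys (prod_list (map (lsub g) rs) * q\<^sup>2)"
  shows "odds m \<subseteq> {..<5}"
  by (rule odds_prod_list[OF _ assms(2)]) (use assms(1) odds_lsub in fastforce)

lemma odds_X1_square:
  assumes "m \<in> keys (X1 * q\<^sup>2)"
  shows "odds m \<subseteq> {..<5}"
proof (rule odds_prod_list[OF _ assms[unfolded X1_list]])
  fix p :: pol and m assume "p \<in> set (map V [0..<5])" "m \<in> keys p"
  then obtain i where "i < 5" "m = single i 1" by (auto simp: keys_V)
  then show "odds m \<subseteq> {..<5}" by (auto simp: odds_def lookup_single when_def split: if_splits)
qed

text \<open>The product of the five transformed variables is the determinant times \<open>X1\<close>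
  plus monomials with a repeated variable, and those have fewer odd exponents.\<close>

lemma subst_X1_square:
  assumes "A \<in> set generators"
  shows "few_odd (subst (lsub (bmat A)) (X1 * r\<^sup>2) + X1 * (subst (lsub (bmat A)) r)\<^sup>2)"
proof -
  let ?g = "subst (lsub (bmat A))"
  have eq: "?g (X1 * r\<^sup>2) = prod_list (map (lsub (bmat A)) [0..<5]) * (?g r)\<^sup>2"
    by (simp only: X1_list subst_mult subst_power prod_list_subst)
  show ?thesis
  proof (rule few_oddI)
    fix m assume "m \<in> keys (?g (X1 * r\<^sup>2) + X1 * (?g r)\<^sup>2)"
    then show "odds m \<subseteq> {..<5}"
      unfolding eq by (elim disjE[OF keys_add_cases] odds_X1_square odds_lsub_prod[rotated]) auto
  next
    fix m
    show "lookup (?g (X1 * r\<^sup>2) + X1 * (?g r)\<^sup>2) (ind {..<5} + (m + m)) = 0"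
      unfolding eq lookup_add lookup_X1_square using assms by (subst lookup_generator) simp_all
  qed
qed

text \<open>Fewer than five linear forms times a square cannot produce five odd exponents.\<close>

lemma few_odd_subst: "few_odd l \<Longrightarrow> few_odd (subst (lsub g) l)"
proof -
  assume l: "few_odd l"
  have "few_odd (C (lookup l m) * subst (lsub g) (mon m))" if m: "m \<in> keys l" for m
  proof -
    have o: "odds m \<subset> {..<5}" using l m by (simp only: few_odd_def)
    obtain h where h: "m = ind (odds m) + (h + h)" by (rule monom_split)
    define os where "os = sorted_list_of_set (odds m)"
    have os: "set os = odds m" "distinct os" by (simp_all add: os_def)
    have "mon (ind (odds m)) = prod_list (map V os)"
      using os by (simp add: mon_ind prod.distinct_set_conv_list flip: os(1))
    then have eq: "subst (lsub g) (mon m) = prod_list (map (lsub g) os) * (subst (lsub g) (mon h))\<^sup>2"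
      by (subst h) (simp only: mon_add subst_mult prod_list_subst power2_eq_square)
    have "length os < 5"
    proof -
      have "length os = card (odds m)" using os distinct_card by metis
      also have "\<dots> < card {..<5::nat}" using o by (intro psubset_card_mono) simp_all
      finally show ?thesis by simp
    qed
    have "odds n \<subset> {..<5}" if n: "n \<in> keys (subst (lsub g) (mon m))" for n
    proof -
      have "odds n \<subseteq> {..<5}" using n o unfolding eq by (intro odds_lsub_prod) (auto simp: os(1))
      moreover have "card (odds n) \<le> length os" using n unfolding eq by (rule odds_prod_list_square)
      then have "odds n \<noteq> {..<5}" using \<open>length os < 5\<close> by (metis card_lessThan not_less)
      ultimately show ?thesis by (rule psubsetI)
    qed
    then show ?thesis unfolding few_odd_def by (blast dest: keys_C_mult[THEN subsetD])
  qed
  then have "few_odd (\<Sum>m\<in>keys l. C (lookup l m) * subst (lsub g) (mon m))" by (rule few_odd_sum)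
  then show ?thesis by (subst pol_as_sum[of l]) (simp only: subst_sum subst_C_mult)
qed

subsection \<open>Compatibility with the total square\<close>

lemma odds_V_square: "m \<in> keys (V i + V i ^ 2) \<Longrightarrow> odds m \<subseteq> {i}"
proof -
  assume "m \<in> keys (V i + V i ^ 2)"
  then have "m \<in> keys (V i) \<or> m \<in> keys (V i ^ 2)" by (rule keys_add_cases)
  then show ?thesis
  proof
    assume "m \<in> keys (V i)"
    then show ?thesis by (auto simp: keys_V odds_def lookup_single when_def split: if_splits)
  next
    assume "m \<in> keys (V i ^ 2)"
    then show ?thesis using keys_square[of m "V i"] by auto
  qed
qed

lemma odds_tsq_prod:
  assumes "m \<in> keys (prod_list (map (\<lambda>i. V i + V i ^ 2) rs) * p\<^sup>2)"
  shows "odds m \<subseteq> set rs"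
  by (rule odds_prod_list[OF _ assms]) (use odds_V_square in fastforce)

text \<open>An odd exponent at \<open>i\<close> can arise only from the summand \<open>V i\<close>
  of its factor, because the square summand and the remaining factors contribute even exponents
  there.\<close>

lemma lookup_tsq_prod:
  "distinct rs \<Longrightarrow>
    lookup (prod_list (map (\<lambda>i. V i + V i ^ 2) rs) * p\<^sup>2) (ind (set rs) + (m + m)) = (lookup p m)\<^sup>2"
proof (induction rs)
  case Nil
  then show ?case by (simp add: lookup_square ind_def)
next
  case (Cons i rs)
  let ?Z = "prod_list (map (\<lambda>i. V i + V i ^ 2) rs) * p\<^sup>2" and ?M = "ind (set rs) + (m + m)"
  have eq: "prod_list (map (\<lambda>i. V i + V i ^ 2) (i # rs)) * p\<^sup>2 = V i * (?Z + V i * ?Z)"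
    by (simp add: algebra_simps power2_eq_square)
  have M: "ind (set (i # rs)) + (m + m) = single i 1 + ?M"
    using Cons.prems by (simp add: ind_def add.assoc)
  have "lookup (V i * ?Z) ?M = 0"
  proof (rule ccontr)
    assume "lookup (V i * ?Z) ?M \<noteq> 0"
    then have "?M \<in> keys (V i * ?Z)" by (simp add: in_keys_iff)
    then obtain a b where ab: "a \<in> keys (V i)" "b \<in> keys ?Z" "?M = a + b" by (rule keys_mult_cases)
    have "i \<notin> odds b" using odds_tsq_prod[OF ab(2)] Cons.prems by auto
    then have "odd (lookup (a + b) i)" using ab(1) by (simp add: keys_V lookup_add odds_def)
    moreover have "even (lookup ?M i)" using Cons.prems by (simp add: lookup_add lookup_ind)
    ultimately show False using ab(3) by simp
  qed
  moreover have "lookup ?Z ?M = (lookup p m)\<^sup>2" using Cons by simp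
  ultimately show ?case unfolding eq M lookup_V_mult lookup_add by simp
qed

lemma tsq_X1_square: "tsq id (X1 * w\<^sup>2) = prod_list (map (\<lambda>i. V i + V i ^ 2) [0..<5]) * (tsq id w)\<^sup>2"
  by (simp only: tsq_def X1_list subst_mult subst_power prod_list_subst id_apply)

lemma lookup_tsq_X1_square: "lookup (tsq id (X1 * w\<^sup>2)) (ind {..<5} + (m + m)) = (lookup (tsq id w) m)\<^sup>2"
  using lookup_tsq_prod[of "[0..<5]" "tsq id w" m] by (simp only: tsq_X1_square set_upt atLeast0LessThan distinct_upt)

lemma odds_tsq_X1_square: "m \<in> keys (tsq id (X1 * w\<^sup>2)) \<Longrightarrow> odds m \<subseteq> {..<5}"
  using odds_tsq_prod[of m "[0..<5]" "tsq id w"] by (simp only: tsq_X1_square set_upt atLeast0LessThan)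

text \<open>The untwisted total square of a monomial is a product of factors for its odd variables
  and a square, so no new odd variable appears.\<close>

lemma few_odd_tsq: "few_odd l \<Longrightarrow> few_odd (tsq id l)"
proof -
  assume l: "few_odd l"
  have "few_odd (C (lookup l m) * tsq id (mon m))" if m: "m \<in> keys l" for m
  proof -
    have o: "odds m \<subset> {..<5}" using l m by (simp only: few_odd_def)
    obtain h where h: "m = ind (odds m) + (h + h)" by (rule monom_split)
    define os where "os = sorted_list_of_set (odds m)"
    have os: "set os = odds m" "distinct os" by (simp_all add: os_def)
    have "mon (ind (odds m)) = prod_list (map V os)"
      using os by (simp add: mon_ind prod.distinct_set_conv_list flip: os(1))
    then have eq: "tsq id (mon m) = prod_list (map (\<lambda>i. V i + V i ^ 2) os) * (tsq id (mon h))\<^sup>2"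
      by (subst h) (simp only: mon_add tsq_def subst_mult prod_list_subst power2_eq_square id_apply)
    have "odds n \<subset> {..<5}" if n: "n \<in> keys (tsq id (mon m))" for n
      using odds_tsq_prod[of n os] n o unfolding eq os(1) by blast
    then show ?thesis unfolding few_odd_def by (blast dest: keys_C_mult[THEN subsetD])
  qed
  then have "few_odd (\<Sum>m\<in>keys l. C (lookup l m) * tsq id (mon m))" by (rule few_odd_sum)
  then show ?thesis by (simp only: tsq_as_sum[of id l])
qed

text \<open>The degree is odd, so a monomial has one or three odd exponents. Adding this to the
  degree and halving gives \<open>n + 3\<close> or \<open>n + 4\<close>, and the two bounds are
  Wood's criterion for these cases.\<close>

lemma hit_few_odd:
  assumes l: "few_odd l" "\<And>m. m \<in> keys l \<Longrightarrow> deg m = 2 * n + 5"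
    and pc: "1 < popcount (n + 3)" "3 < popcount (n + 4)"
  shows "l \<in> hit id (2 * n + 5)"
proof -
  have "(\<Sum>m\<in>keys l. C (lookup l m) * mon m) \<in> hit id (2 * n + 5)"
  proof (intro hit_sum hit_C_mult)
    fix m assume m: "m \<in> keys l"
    have "card (odds m) < card {..<5::nat}"
      using l(1) m by (intro psubset_card_mono) (simp_all add: few_odd_def)
    moreover have "odd (card (odds m))"
      using even_deg_odds[of m] l(2)[OF m] by simp
    ultimately have "card (odds m) = 1 \<or> card (odds m) = 3"
      unfolding card_lessThan by presburger
    then have "card (odds m) < popcount ((deg m + card (odds m)) div 2)"
    proof
      assume c: "card (odds m) = 1"
      have "(deg m + card (odds m)) div 2 = n + 3" unfolding c l(2)[OF m] by simp
      then show ?thesis using pc c by (simp only:)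
    next
      assume c: "card (odds m) = 3"
      have "(deg m + card (odds m)) div 2 = n + 4" unfolding c l(2)[OF m] by simp
      then show ?thesis using pc c by (simp only:)
    qed
    from hit_mon[OF bij_id this] show "mon m \<in> hit id (2 * n + 5)" unfolding l(2)[OF m] .
  qed
  then show ?thesis by (simp only: flip: pol_as_sum)
qed

lemma deg_X1_index: "deg (ind {..<5} + (m + m)) = 2 * deg m + 5"
  by (simp add: deg_add deg_ind)

lemma keys_X1: "keys X1 = {ind {..<5}}"
  by (simp add: X1_def)

lemma deg_X1_square: "(\<And>m. m \<in> keys r \<Longrightarrow> deg m = n) \<Longrightarrow> m \<in> keys (X1 * r\<^sup>2) \<Longrightarrow> deg m = 2 * n + 5"
proof -
  assume r: "\<And>m. m \<in> keys r \<Longrightarrow> deg m = n" and "m \<in> keys (X1 * r\<^sup>2)"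
  then obtain a b where "a \<in> keys X1" "b \<in> keys (r\<^sup>2)" "m = a + b" by (elim keys_mult_cases)
  moreover from this(2) obtain c where "c \<in> keys r" "b = c + c" using keys_square by blast
  ultimately show ?thesis using r by (simp add: keys_X1 deg_add deg_ind)
qed

text \<open>Kameko's map commutes with the total square up to polynomials with few odd exponents,
  and those are hit in this degree.\<close>

lemma hit_X1_square:
  assumes r: "r \<in> hit id n" and pc: "1 < popcount (n + 3)" "3 < popcount (n + 4)"
  shows "X1 * r\<^sup>2 \<in> hit id (2 * n + 5)"
proof -
  let ?N = "2 * n + 5"
  obtain w where w: "\<forall>m\<in>keys w. deg m < n" and r: "r = hom n (tsq id w)" using r by (auto simp: hit_def)
  have X: "X1 * r\<^sup>2 = hom ?N (X1 * (tsq id w)\<^sup>2)"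
    using hom_mult_left[of X1 5 "2 * n" "(tsq id w)\<^sup>2"] by (simp add: r hom_square keys_X1 deg_ind add.commute)
  let ?D = "tsq id (X1 * w\<^sup>2) + X1 * (tsq id w)\<^sup>2"
  have "few_odd ?D"
  proof (rule few_oddI)
    fix m assume "m \<in> keys ?D"
    then have "m \<in> keys (tsq id (X1 * w\<^sup>2)) \<or> m \<in> keys (X1 * (tsq id w)\<^sup>2)" by (rule keys_add_cases)
    then show "odds m \<subseteq> {..<5}" by (elim disjE odds_tsq_X1_square odds_X1_square)
  qed (simp only: lookup_add lookup_tsq_X1_square lookup_X1_square add_self)
  then have "few_odd (hom ?N ?D)" by (auto simp: few_odd_def keys_hom)
  then have "hom ?N ?D \<in> hit id ?N" by (rule hit_few_odd) (use pc in \<open>auto simp: keys_hom\<close>)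
  moreover have "hom ?N (tsq id (X1 * w\<^sup>2)) \<in> hit id ?N"
  proof (rule hitI[OF _ refl])
    fix m assume "m \<in> keys (X1 * w\<^sup>2)"
    then obtain a b where "a \<in> keys X1" "b \<in> keys (w\<^sup>2)" "m = a + b" by (elim keys_mult_cases)
    moreover from this(2) obtain c where "c \<in> keys w" "b = c + c" using keys_square by blast
    ultimately show "deg m < ?N" using w by (auto simp: keys_X1 deg_add deg_ind)
  qed
  ultimately have "hom ?N ?D + hom ?N (tsq id (X1 * w\<^sup>2)) \<in> hit id ?N" by (rule hit_add)
  then show ?thesis by (simp add: X hom_add add_ac)
qed

text \<open>The inverse direction reads off coefficients at exponents that are all odd. The total
  square preserves this part, so the part \<open>w\<close> of a witness upstairs is a witness for
  \<open>s\<close>, after taking square roots of coefficients and discarding extra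
  variables.\<close>

lemma hit_X1_squareD:
  assumes h: "X1 * s\<^sup>2 + l \<in> hit id (2 * n + 5)" and l: "few_odd l"
    and s: "cells n s"
  shows "s \<in> hit id n"
proof -
  let ?N = "2 * n + 5"
  obtain u where u: "\<forall>m\<in>keys u. deg m < ?N" and eq: "X1 * s\<^sup>2 + l = hom ?N (tsq id u)"
    using h by (auto simp: hit_def)
  obtain w k where wk: "proj u = X1 * w\<^sup>2 + k" "few_odd k" by (rule Kameko_decomposition)
  have w: "2 * deg m + 5 < ?N" if "m \<in> keys w" for m
  proof -
    have "lookup (proj u) (ind {..<5} + (m + m)) = (lookup w m)\<^sup>2"
      by (simp only: wk(1) lookup_add lookup_X1_square lookup_few_odd[OF wk(2)] add_0_right)
    then have "lookup (proj u) (ind {..<5} + (m + m)) \<noteq> 0" using that by (simp add: in_keys_iff)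
    then have "ind {..<5} + (m + m) \<in> keys u" by (auto simp: lookup_proj in_keys_iff split: if_splits)
    then show ?thesis using u by (simp only: flip: deg_X1_index) 
  qed
  have pw: "lookup (hom n (tsq id (proj w))) m = (if deg m = n \<and> keys m \<subseteq> {..<5} then lookup (tsq id w) m else 0)" for m
    by (simp add: lookup_hom lookup_proj flip: proj_tsq)
  have "s = hom n (tsq id (proj w))"
  proof (rule poly_mapping_eqI)
    fix m
    show "lookup s m = lookup (hom n (tsq id (proj w))) m"
    proof (cases "deg m = n \<and> keys m \<subseteq> {..<5}")
      case True
      let ?M = "ind {..<5} + (m + m)"
      have M: "keys ?M \<subseteq> {..<5}"
      proof
        fix i assume "i \<in> keys ?M"
        then have "i < 5 \<or> i \<in> keys m" by (auto simp: in_keys_iff lookup_add lookup_ind split: if_splits)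
        then show "i \<in> {..<5}" using True by blast
      qed
      have "(lookup s m)\<^sup>2 = lookup (X1 * s\<^sup>2 + l) ?M"
        by (simp only: lookup_add lookup_X1_square lookup_few_odd[OF l] add_0_right)
      also have "\<dots> = lookup (tsq id u) ?M"
        unfolding eq lookup_hom using True by (simp add: deg_X1_index)
      also have "\<dots> = lookup (proj (tsq id u)) ?M" using M by (simp only: lookup_proj if_True)
      also have "proj (tsq id u) = tsq id (X1 * w\<^sup>2) + tsq id k"
        unfolding proj_tsq[of id, simplified] wk(1) by (simp add: tsq_def subst_add)
      also have "lookup \<dots> ?M = (lookup (tsq id w) m)\<^sup>2"
        by (simp only: lookup_add lookup_tsq_X1_square lookup_few_odd[OF few_odd_tsq[OF wk(2)]] add_0_right)
      finally have "(lookup s m + lookup (tsq id w) m)\<^sup>2 = 0" by (simp add: square_add)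
      then show ?thesis using True by (simp add: pw add_eq_0_char2)
    next
      case False
      then have "m \<notin> keys s" using s by (auto simp: cells_def)
      then show ?thesis by (simp only: pw if_not_P[OF False] in_keys_iff not_not)
    qed
  qed
  moreover have "deg m < n" if "m \<in> keys (proj w)" for m
    using w[of m] that by (auto simp: lookup_proj in_keys_iff split: if_splits)
  ultimately show ?thesis by (intro hitI)
qed

text \<open>Up to polynomials with few odd exponents, \<open>q\<close> is the image of some
  \<open>r\<close>, and the generators commute with Kameko's map. So invariance descends to
  \<open>r\<close>, and hitness of \<open>r\<close> ascends to \<open>q\<close>.\<close>

lemma Kameko_step:
  assumes IH: "\<And>r. cells n r \<Longrightarrow> (\<And>A. A \<in> set generators \<Longrightarrow> subst (lsub (bmat A)) r + r \<in> hit id n) \<Longrightarrow> r \<in> hit id n"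
    and pc: "1 < popcount (n + 3)" "3 < popcount (n + 4)"
    and q: "cells (2 * n + 5) q"
    and inv: "\<And>A. A \<in> set generators \<Longrightarrow> subst (lsub (bmat A)) q + q \<in> hit id (2 * n + 5)"
  shows "q \<in> hit id (2 * n + 5)"
proof -
  obtain r l where rl: "proj q = X1 * r\<^sup>2 + l" "few_odd l" by (rule Kameko_decomposition)
  have eq: "q = X1 * r\<^sup>2 + l" using q rl(1) by (simp add: cells_iff)
  have r: "cells n r"
    unfolding cells_def
  proof
    fix m assume "m \<in> keys r"
    moreover have "lookup q (ind {..<5} + (m + m)) = (lookup r m)\<^sup>2"
      unfolding eq by (simp only: lookup_add lookup_X1_square lookup_few_odd[OF rl(2)] add_0_right)
    ultimately have "ind {..<5} + (m + m) \<in> keys q" by (simp add: in_keys_iff)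
    then have k: "keys (ind {..<5} + (m + m)) \<subseteq> {..<5}" "2 * deg m + 5 = 2 * n + 5"
      using q unfolding cells_def by (auto simp only: deg_X1_index)
    have "lookup m i = 0" if "\<not> i < 5" for i
    proof -
      have "i \<notin> keys (ind {..<5} + (m + m))" using k(1) that by auto
      then show ?thesis by (simp add: in_keys_iff lookup_add)
    qed
    then have "keys m \<subseteq> {..<5}" by (auto simp: in_keys_iff)
    then show "keys m \<subseteq> {..<5} \<and> deg m = n" using k(2) by simp
  qed
  have "r \<in> hit id n"
  proof (rule IH[OF r])
    fix A assume A: "A \<in> set generators"
    let ?g = "subst (lsub (bmat A))"
    define k where "k = ?g (X1 * r\<^sup>2) + X1 * (?g r)\<^sup>2 + ?g l + l"
    have k: "few_odd k"
      unfolding k_def by (intro few_odd_add subst_X1_square few_odd_subst rl(2) A)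
    have "?g q + q = X1 * (?g r + r)\<^sup>2 + k"
      by (simp add: eq k_def subst_add square_add distrib_left add_ac)
    then have h: "X1 * (?g r + r)\<^sup>2 + k \<in> hit id (2 * n + 5)" using inv[OF A] by (simp only:)
    have "cells n (?g r + r)"
      unfolding cells_def
    proof
      fix m assume "m \<in> keys (?g r + r)"
      then show "keys m \<subseteq> {..<5} \<and> deg m = n"
        using cells_subst_lsub[OF r, of "bmat A"] r unfolding cells_def by (elim disjE[OF keys_add_cases]) blast+
    qed
    then show "?g r + r \<in> hit id n" by (rule hit_X1_squareD[OF h k])
  qed
  then have X: "X1 * r\<^sup>2 \<in> hit id (2 * n + 5)" using pc by (rule hit_X1_square)
  have "l = q + X1 * r\<^sup>2" by (simp add: eq add.commute)
  have "l \<in> hit id (2 * n + 5)"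
  proof (rule hit_few_odd[OF rl(2) _ pc])
    fix m assume "m \<in> keys l"
    then have "m \<in> keys q \<or> m \<in> keys (X1 * r\<^sup>2)"
      unfolding \<open>l = _\<close> by (rule keys_add_cases)
    then show "deg m = 2 * n + 5"
    proof
      assume "m \<in> keys q"
      then show ?thesis using q by (simp add: cells_def)
    next
      assume "m \<in> keys (X1 * r\<^sup>2)"
      then show ?thesis by (rule deg_X1_square[rotated]) (use r in \<open>simp add: cells_def\<close>)
    qed
  qed
  then show ?thesis unfolding eq by (intro hit_add X)
qed

text \<open>For \<open>n = 47 * 2 ^ s - 5\<close> these are \<open>n + 4\<close> and
  \<open>n + 3\<close>. They start at 46 = 32 + 8 + 4 + 2 and 45 = 32 + 8 + 4 + 1, and both
  successors end in the doubled first number, so no binary one is lost.\<close>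

lemma popcount_degrees: "4 \<le> popcount (47 * 2 ^ s - 1) \<and> 4 \<le> popcount (47 * 2 ^ s - 2)"
proof (induction s)
  case 0
  have "popcount 46 = 4" "popcount 45 = 4" by code_simp+
  then show ?case by simp
next
  case (Suc s)
  have p: "47 * 2 ^ s \<ge> (47 :: nat)" by simp
  have "47 * 2 ^ Suc s - 1 = Suc (2 * (47 * 2 ^ s - 1))" "47 * 2 ^ Suc s - 2 = 2 * (47 * 2 ^ s - 1 :: nat)"
    using p unfolding power_Suc by linarith+
  then show ?case using Suc by (simp only: popcount_Suc_double popcount_double) simp
qed

text \<open>The degree \<open>5 * (2 ^ s - 1) + 42 * 2 ^ s\<close> in the form that exhibits the
  recursion from \<open>n\<close> to \<open>2 * n + 5\<close>.\<close>

theorem invariant_hit: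
  assumes "cells (47 * 2 ^ s - 5) q"
    and "\<And>A. A \<in> set generators \<Longrightarrow> subst (lsub (bmat A)) q + q \<in> hit id (47 * 2 ^ s - 5)"
  shows "q \<in> hit id (47 * 2 ^ s - 5)"
  using assms
proof (induction s arbitrary: q)
  case 0
  have "47 * 2 ^ 0 - 5 = (42 :: nat)" by simp
  then show ?case using invariant_hit_42[of q] 0 by (simp only:)
next
  case (Suc s)
  let ?n = "47 * 2 ^ s - 5 :: nat"
  have p: "47 * 2 ^ s \<ge> (47 :: nat)" by simp
  have n: "47 * 2 ^ Suc s - 5 = 2 * ?n + 5" "?n + 3 = 47 * 2 ^ s - 2" "?n + 4 = 47 * 2 ^ s - 1"
    using p unfolding power_Suc by linarith+
  show ?case
    unfolding n(1)
  proof (rule Kameko_step[OF Suc.IH])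
    show "1 < popcount (?n + 3)" "3 < popcount (?n + 4)"
      unfolding n using popcount_degrees[of s] by linarith+
  qed (use Suc.prems in \<open>simp_all only: n\<close>)
qed

section \<open>Passage to the Laurent polynomials over the field with two elements\<close>

definition blin :: "('a \<Rightarrow> 'b::char2) \<Rightarrow> ('a \<Rightarrow>\<^sub>0 bit) \<Rightarrow> 'b" where
  "blin f p = (\<Sum>m\<in>keys p. f m)"

lemma blin_superset:
  "finite A \<Longrightarrow> keys p \<subseteq> A \<Longrightarrow> blin f p = (\<Sum>m\<in>A. if lookup p m = 1 then f m else 0)"
  unfolding blin_def by (intro sum.mono_neutral_cong_left) (auto simp: in_keys_iff)

lemma blin_0 [simp]: "blin f 0 = 0"
  by (simp add: blin_def)

lemma blin_add: "blin f (p + q) = blin f p + blin f q"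
proof -
  let ?A = "keys p \<union> keys q"
  have "(if lookup (p + q) m = 1 then f m else 0) = (if lookup p m = 1 then f m else 0) + (if lookup q m = 1 then f m else 0)" for m
    by (cases "lookup p m"; cases "lookup q m") (simp_all add: lookup_add)
  moreover have "keys (p + q) \<subseteq> ?A" by (rule Poly_Mapping.keys_add)
  ultimately show ?thesis
    by (simp only: blin_superset[of ?A] finite_Un finite_keys Un_upper1 Un_upper2 sum.distrib)
qed

lemma blin_sum: "blin f (sum g A) = (\<Sum>a\<in>A. blin f (g a))"
  by (induction A rule: infinite_finite_induct) (simp_all add: blin_add)

lemma blin_single: "blin f (single m c) = (if c = 1 then f m else 0)"
  by (simp add: blin_def)

lemma laurent_as_sum: "p = (\<Sum>m\<in>keys p. single m 1)" for p :: "'a \<Rightarrow>\<^sub>0 bit"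
  by (rule poly_mapping_eqI) (auto simp: lookup_sum lookup_single when_def in_keys_iff)

definition iota :: "bit \<Rightarrow> F" where "iota b = (if b = 1 then 1 else 0)"

lemma iota_mult: "iota (a * b) = iota a * iota b" and iota_of_nat: "iota (of_nat k) = of_nat k"
  and iota_1: "iota 1 = 1"
  by (simp_all add: iota_def of_nat_char2)

lemma iota_prod: "iota (prod f A) = (\<Prod>a\<in>A. iota (f a))"
  by (induction A rule: infinite_finite_induct) (simp_all only: prod.infinite prod.empty prod.insert iota_mult iota_1 simp_thms)

text \<open>Negative exponents are truncated to 0, so \<open>im\<close> inverts this only on
  monomials with nonnegative exponents; \<open>nonneg\<close> records that condition later.\<close>

definition nm :: "monom \<Rightarrow> nat \<Rightarrow>\<^sub>0 nat" where "nm m = Poly_Mapping.map nat m"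
definition im :: "(nat \<Rightarrow>\<^sub>0 nat) \<Rightarrow> monom" where "im e = Poly_Mapping.map int e"

lemma lookup_nm: "lookup (nm m) i = nat (lookup m i)" and lookup_im: "lookup (im e) i = int (lookup e i)"
  by (simp_all add: nm_def im_def Poly_Mapping.map.rep_eq when_def)

lemma nm_im [simp]: "nm (im e) = e"
  by (rule poly_mapping_eqI) (simp add: lookup_nm lookup_im)

lemma im_nm: "\<forall>j. 0 \<le> lookup m j \<Longrightarrow> im (nm m) = m"
  by (rule poly_mapping_eqI) (simp add: lookup_nm lookup_im)

lemma keys_im: "keys (im e) = keys e"
  by (auto simp: in_keys_iff lookup_im)

lemma keys_nm: "\<forall>j. 0 \<le> lookup m j \<Longrightarrow> keys (nm m) = keys m"
  by (metis im_nm keys_im)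

lemma monom_deg_im: "monom_deg (im e) = int (deg e)"
  by (simp add: monom_deg_def deg_def keys_im lookup_im)

lemma nm_add: "\<forall>j. 0 \<le> lookup m j \<Longrightarrow> \<forall>j. 0 \<le> lookup k j \<Longrightarrow> nm (m + k) = nm m + nm k"
  by (rule poly_mapping_eqI) (simp add: lookup_nm lookup_add nat_add_distrib)

definition emb :: "laurent \<Rightarrow> pol" where "emb = blin (\<lambda>m. mon (nm m))"

lemma emb_single: "emb (single m c) = C (iota c) * mon (nm m)"
  by (simp add: emb_def blin_single iota_def)

lemma emb_add: "emb (p + q) = emb p + emb q" and emb_0 [simp]: "emb 0 = 0"
  and emb_sum: "emb (sum f A) = (\<Sum>a\<in>A. emb (f a))"
  by (simp_all add: emb_def blin_add blin_sum)

subsection \<open>Steenrod squares\<close>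

lemma int_choose_binomial: "int_choose (int a) k = int (a choose k)"
  by (simp add: int_choose_def int_binomial gbinomial_prod_rev lessThan_atLeast0)

lemma C_of_nat: "C (of_nat k) = of_nat k"
  by (simp add: of_nat_char2)

lemma power_V_square:
  assumes "a \<le> N"
  shows "(V j + V j ^ 2) ^ a = (\<Sum>k\<le>N. C (of_nat (a choose k)) * V j ^ (a + k))"
proof -
  have "(V j + V j ^ 2) ^ a = (\<Sum>k\<le>a. of_nat (a choose k) * (V j ^ 2) ^ k * V j ^ (a - k))"
    by (subst add.commute) (rule binomial_ring)
  also have "\<dots> = (\<Sum>k\<le>a. C (of_nat (a choose k)) * V j ^ (a + k))"
  proof (rule sum.cong[OF refl])
    fix k assume "k \<in> {..a}"
    then have "2 * k + (a - k) = a + k" by simp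
    then show "of_nat (a choose k) * (V j ^ 2) ^ k * V j ^ (a - k) = C (of_nat (a choose k)) * V j ^ (a + k)"
      by (simp only: C_of_nat mult.assoc flip: power_mult power_add)
  qed
  also have "\<dots> = (\<Sum>k\<le>N. C (of_nat (a choose k)) * V j ^ (a + k))"
    using assms by (intro sum.mono_neutral_left) (auto simp: not_le binomial_eq_0)
  finally show ?thesis .
qed

lemma C_prod: "C (prod f A) = (\<Prod>a\<in>A. C (f a))"
  by (induction A rule: infinite_finite_induct) (simp_all add: C_mult)

definition of_exps :: "nat set \<Rightarrow> (nat \<Rightarrow> nat) \<Rightarrow> (nat \<Rightarrow>\<^sub>0 nat)" where
  "of_exps K g = (\<Sum>j\<in>K. single j (g j))"

lemma lookup_of_exps: "finite K \<Longrightarrow> lookup (of_exps K g) i = (if i \<in> K then g i else 0)"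
  by (simp add: of_exps_def lookup_sum lookup_single when_def)

lemma tsq_mon_expand:
  assumes "\<And>j. lookup e j \<le> N"
  shows "tsq id (mon e) = (\<Sum>g\<in>keys e \<rightarrow>\<^sub>E {..N}.
    C (\<Prod>j\<in>keys e. of_nat (lookup e j choose g j)) * mon (e + of_exps (keys e) g))"
proof -
  have "tsq id (mon e) = (\<Prod>j\<in>keys e. \<Sum>k\<le>N. C (of_nat (lookup e j choose k)) * V j ^ (lookup e j + k))"
    using power_V_square[OF assms] by (simp add: tsq_def subst_mon[of "keys e"])
  also have "\<dots> = (\<Sum>g\<in>keys e \<rightarrow>\<^sub>E {..N}. \<Prod>j\<in>keys e. C (of_nat (lookup e j choose g j)) * V j ^ (lookup e j + g j))"
    by (rule prod_sum_PiE) simp_all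
  also have "\<dots> = (\<Sum>g\<in>keys e \<rightarrow>\<^sub>E {..N}. C (\<Prod>j\<in>keys e. of_nat (lookup e j choose g j)) * mon (e + of_exps (keys e) g))"
  proof (rule sum.cong[OF refl])
    fix g
    have "mon (e + of_exps (keys e) g) = mon e * (\<Prod>j\<in>keys e. V j ^ g j)"
      by (simp add: mon_add of_exps_def mon_sum mon_single)
    also have "\<dots> = (\<Prod>j\<in>keys e. V j ^ (lookup e j + g j))"
      by (simp add: mon_as_prod[of e] power_add prod.distrib)
    finally show "(\<Prod>j\<in>keys e. C (of_nat (lookup e j choose g j)) * V j ^ (lookup e j + g j)) =
        C (\<Prod>j\<in>keys e. of_nat (lookup e j choose g j)) * mon (e + of_exps (keys e) g)"
      by (simp only: prod.distrib C_prod)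
  qed
  finally show ?thesis .
qed

text \<open>The component of degree \<open>i\<close> above the bottom of the expanded product is the
  Cartan formula: choices of a binomial index for each variable correspond to the distributions of
  \<open>i\<close> over the variables.\<close>

lemma emb_sq_monom: "emb (sq_monom i (im e)) = hom (deg e + i) (tsq id (mon e))"
proof -
  \<comment> \<open>Large enough for every exponent of \<open>e\<close> and every share of
    \<open>i\<close>, so that all variables have a common finite index range.\<close>
  define N where "N = deg e + i"
  let ?K = "keys e"
  let ?T = "{f. keys f \<subseteq> keys (im e) \<and> (\<forall>j. 0 \<le> lookup f j) \<and> monom_deg f = int i}"
  let ?G = "{g \<in> ?K \<rightarrow>\<^sub>E {..N}. deg (of_exps ?K g) = i}"
  have le: "lookup e j \<le> deg e" for e j
  proof (cases "j \<in> keys e")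
    case True
    then show ?thesis unfolding deg_def by (intro member_le_sum) simp_all
  qed (simp add: in_keys_iff)
  have h: "hom (deg e + i) (C c * mon (e + of_exps ?K g)) = (if deg (of_exps ?K g) = i then C c * mon (e + of_exps ?K g) else 0)"
    for c g
  proof -
    have k: "deg m = deg e + deg (of_exps ?K g)" if "m \<in> keys (C c * mon (e + of_exps ?K g))" for m
    proof -
      have "m = e + of_exps ?K g" using that by (auto simp: C_mult_mon split: if_splits)
      then show ?thesis by (simp only: deg_add)
    qed
    show ?thesis
    proof (cases "deg (of_exps ?K g) = i")
      case True
      show ?thesis unfolding if_P[OF True] by (rule hom_eq_self) (simp only: k True)
    next
      case False
      show ?thesis unfolding if_not_P[OF False]
        by (rule hom_eq_0) (simp only: k add_left_cancel False not_False_eq_True)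
    qed
  qed
  have "hom (deg e + i) (tsq id (mon e)) =
      (\<Sum>g\<in>?K \<rightarrow>\<^sub>E {..N}. if deg (of_exps ?K g) = i then
        C (\<Prod>j\<in>?K. of_nat (lookup e j choose g j)) * mon (e + of_exps ?K g) else 0)"
  proof -
    have N: "lookup e j \<le> N" for j using le[of e j] by (simp add: N_def)
    show ?thesis by (subst tsq_mon_expand[of e N]) (simp_all only: N hom_sum h)
  qed
  also have "\<dots> = (\<Sum>g\<in>?G. C (\<Prod>j\<in>?K. of_nat (lookup e j choose g j)) * mon (e + of_exps ?K g))"
    by (rule sum.inter_filter[symmetric]) (simp add: finite_PiE)
  also have "\<dots> = (\<Sum>f\<in>?T. C (\<Prod>j\<in>?K. of_nat (lookup e j choose nat (lookup f j))) * mon (e + nm f))"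
  proof (rule sum.reindex_bij_witness[where j = "\<lambda>g. im (of_exps ?K g)"
        and i = "\<lambda>f. restrict (\<lambda>j. nat (lookup f j)) ?K"])
    fix g assume g: "g \<in> ?G"
    have l: "lookup (of_exps ?K g) j = (if j \<in> ?K then g j else 0)" for j by (simp add: lookup_of_exps)
    show "restrict (\<lambda>j. nat (lookup (im (of_exps ?K g)) j)) ?K = g"
      using g by (auto simp: lookup_im l fun_eq_iff restrict_def PiE_def extensional_def)
    have "keys (of_exps ?K g) \<subseteq> ?K" by (auto simp: in_keys_iff[of _ "of_exps ?K g"] l split: if_splits)
    then show "im (of_exps ?K g) \<in> ?T" using g by (simp add: keys_im monom_deg_im lookup_im)
    show "C (\<Prod>j\<in>?K. of_nat (lookup e j choose nat (lookup (im (of_exps ?K g)) j))) * mon (e + nm (im (of_exps ?K g))) =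
        C (\<Prod>j\<in>?K. of_nat (lookup e j choose g j)) * mon (e + of_exps ?K g)"
      by (simp add: lookup_im l)
  next
    fix f assume f: "f \<in> ?T"
    let ?g = "restrict (\<lambda>j. nat (lookup f j)) ?K"
    have "keys (nm f) \<subseteq> ?K" using f by (simp add: keys_nm keys_im)
    then have o: "of_exps ?K ?g = nm f"
      by (intro poly_mapping_eqI) (auto simp: lookup_of_exps lookup_nm in_keys_iff[of _ "nm f"])
    then show "im (of_exps ?K ?g) = f" using f by (simp add: im_nm)
    have d: "deg (nm f) = i" using f monom_deg_im[of "nm f"] by (simp add: im_nm)
    have "?g j \<le> N" if "j \<in> ?K" for j
      using that le[of "nm f" j] by (simp add: d N_def lookup_nm)
    then show "?g \<in> ?G" using o d by auto
  qed
  also have "\<dots> = (\<Sum>f\<in>?T. emb (single (im e + f) (\<Prod>j\<in>keys (im e). of_int (int_choose (lookup (im e) j) (nat (lookup f j))))))"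
  proof (rule sum.cong[OF refl])
    fix f assume "f \<in> ?T"
    then have "nm (im e + f) = e + nm f" by (simp add: nm_add lookup_im)
    then show "C (\<Prod>j\<in>?K. of_nat (lookup e j choose nat (lookup f j))) * mon (e + nm f) =
        emb (single (im e + f) (\<Prod>j\<in>keys (im e). of_int (int_choose (lookup (im e) j) (nat (lookup f j)))))"
      by (simp add: emb_single iota_prod iota_of_nat keys_im lookup_im int_choose_binomial)
  qed
  finally show ?thesis by (simp add: sq_monom_def emb_sum)
qed

lemma poly_comp_cells: "p \<in> poly_comp 5 (int n) \<Longrightarrow> cells n (emb p)"
proof -
  assume p: "p \<in> poly_comp 5 (int n)"
  show ?thesis unfolding cells_def
  proof
    fix e assume "e \<in> keys (emb p)"
    then have "e \<in> keys (\<Sum>m\<in>keys p. mon (nm m))" by (simp only: emb_def blin_def)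
    then have "\<exists>m\<in>keys p. e \<in> keys (mon (nm m))" by (rule keys_sum_cases)
    then obtain m where m: "m \<in> keys p" "e \<in> keys (mon (nm m))" by blast
    have *: "keys m \<subseteq> {..<5}" "\<forall>j. 0 \<le> lookup m j" "monom_deg m = int n"
      using p m(1) by (auto simp: poly_comp_def)
    have "keys (nm m) \<subseteq> {..<5}" using * by (simp add: keys_nm)
    moreover have "deg (nm m) = n" using *(3) monom_deg_im[of "nm m"] im_nm[OF *(2)] by simp
    ultimately show "keys e \<subseteq> {..<5} \<and> deg e = n" using m(2) by simp
  qed
qed

lemma emb_hits:
  assumes "p \<in> hits 5 (int n)"
  shows "emb p \<in> hit id n"
  using assms unfolding hits_def
proof (induction rule: group_closure.induct)
  case (base s)
  show ?case
  proof (cases "s = 0")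
    case False
    then obtain i u where i: "0 < i" and u: "u \<in> poly_comp 5 (int n - int i)" and s: "s = Sq i u"
      using base by auto
    have "emb s = (\<Sum>m\<in>keys u. emb (sq_monom i m))" by (simp add: s Sq_def emb_sum)
    also have "\<dots> \<in> hit id n"
    proof (rule hit_sum)
      fix m assume "m \<in> keys u"
      then have m: "\<forall>j. 0 \<le> lookup m j" "monom_deg m = int n - int i" using u by (auto simp: poly_comp_def)
      then have d: "deg (nm m) + i = n" using monom_deg_im[of "nm m"] im_nm[OF m(1)] by simp
      have "emb (sq_monom i m) = hom n (tsq id (mon (nm m)))"
        using emb_sq_monom[of i "nm m"] by (simp only: im_nm[OF m(1)] d)
      then show "emb (sq_monom i m) \<in> hit id n"
        by (rule hitI[rotated]) (use d i in auto)
    qed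
    finally show ?thesis .
  qed simp
next
  case (diff s t)
  then show ?case by (simp add: emb_add hit_add)
qed

subsection \<open>Descent of scalars\<close>

text \<open>Completing 1 to a basis of \<open>F\<close> over the prime field gives a linear
  functional that splits the inclusion of scalars.\<close>

lemma bit_functional: "\<exists>\<phi>::F \<Rightarrow> bit. (\<forall>x y. \<phi> (x + y) = \<phi> x + \<phi> y) \<and> \<phi> 1 = 1"
proof -
  let ?s = "\<lambda>b x. iota b * x"
  have i: "iota (a + b) = iota a + iota b" for a b
    by (cases a; cases b) (simp_all add: iota_def)
  interpret vector_space_pair ?s "(*) :: bit \<Rightarrow> bit \<Rightarrow> bit"
    by standard (simp_all only: i iota_mult iota_1 distrib_left distrib_right mult.assoc mult_1_left)
  have "vs1.independent {1 :: F}" by (simp add: vs1.dependent_single)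
  then obtain \<phi> where \<phi>: "Vector_Spaces.linear ?s (*) \<phi>" "\<phi> 1 = (1 :: bit)"
    using linear_independent_extend[of "{1}" "\<lambda>_. 1"] by blast
  then show ?thesis using linear_add[OF \<phi>(1)] by blast
qed

definition functional :: "F \<Rightarrow> bit" where
  "functional = (SOME \<phi>. (\<forall>x y. \<phi> (x + y) = \<phi> x + \<phi> y) \<and> \<phi> 1 = 1)"

lemma functional_add: "functional (x + y) = functional x + functional y" and functional_1: "functional 1 = 1"
  using someI_ex[OF bit_functional] by (simp_all add: functional_def)

lemma functional_0 [simp]: "functional 0 = 0"
  using functional_add[of 0 0] by simp

text \<open>Applies the functional to coefficients: a retraction of \<open>emb\<close> that is
  linear over the prime field.\<close>

definition descend :: "pol \<Rightarrow> laurent" where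
  "descend q = (\<Sum>m\<in>keys q. single (im m) (functional (lookup q m)))"

lemma descend_superset:
  "finite A \<Longrightarrow> keys q \<subseteq> A \<Longrightarrow> descend q = (\<Sum>m\<in>A. single (im m) (functional (lookup q m)))"
  unfolding descend_def by (intro sum.mono_neutral_left) (auto simp: in_keys_iff)

lemma descend_add: "descend (p + q) = descend p + descend q"
proof -
  let ?A = "keys p \<union> keys q"
  have "keys (p + q) \<subseteq> ?A" by (rule Poly_Mapping.keys_add)
  then show ?thesis
    by (simp only: descend_superset[of ?A] finite_Un finite_keys Un_upper1 Un_upper2 lookup_add
        functional_add single_add sum.distrib)
qed

lemma descend_sum: "descend (sum f A) = (\<Sum>a\<in>A. descend (f a))"
  by (induction A rule: infinite_finite_induct) (simp_all add: descend_add, simp_all add: descend_def)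

lemma descend_C_mon: "descend (C c * mon m) = single (im m) (functional c)"
  by (subst descend_superset[of "{m}"]) (auto simp: in_keys_iff lookup_C_mult lookup_mon split: if_splits)

definition nonneg :: "laurent \<Rightarrow> bool" where
  "nonneg p \<longleftrightarrow> (\<forall>m\<in>keys p. \<forall>j. 0 \<le> lookup m j)"

lemma descend_emb:
  assumes "nonneg p"
  shows "descend (C c * emb p) = (if functional c = 1 then p else 0)"
proof -
  have "descend (C c * emb p) = (\<Sum>m\<in>keys p. single (im (nm m)) (functional c))"
    by (simp add: emb_def blin_def sum_distrib_left descend_sum descend_C_mon)
  also have "\<dots> = (\<Sum>m\<in>keys p. single m (functional c))"
    using assms by (intro sum.cong) (simp_all add: nonneg_def im_nm)
  finally show ?thesis by (cases "functional c") (simp_all flip: laurent_as_sum)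
qed

lemma nonneg_add: "nonneg p \<Longrightarrow> nonneg q \<Longrightarrow> nonneg (p + q)"
  unfolding nonneg_def using Poly_Mapping.keys_add[of p q] by blast

lemma nonneg_sum: "(\<And>a. a \<in> A \<Longrightarrow> nonneg (f a)) \<Longrightarrow> nonneg (sum f A)"
  by (induction A rule: infinite_finite_induct) (simp_all add: nonneg_add, simp_all add: nonneg_def)

lemma nonneg_single: "(\<And>j. 0 \<le> lookup m j) \<Longrightarrow> nonneg (single m c)"
  by (simp add: nonneg_def)

lemma nonneg_sq_monom: "(\<And>j. 0 \<le> lookup m j) \<Longrightarrow> nonneg (sq_monom i m)"
  unfolding sq_monom_def by (intro nonneg_sum nonneg_single) (auto simp: lookup_add)

lemma hits_add: "p \<in> hits t n \<Longrightarrow> q \<in> hits t n \<Longrightarrow> p + q \<in> hits t n"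
  unfolding hits_def by (rule group_closure_add)

lemma hits_0 [simp]: "0 \<in> hits t n"
  by (simp add: hits_def)

lemma hits_sum: "(\<And>a. a \<in> A \<Longrightarrow> f a \<in> hits t n) \<Longrightarrow> sum f A \<in> hits t n"
  by (induction A rule: infinite_finite_induct) (simp_all add: hits_add)

text \<open>A witness over \<open>F\<close> writes \<open>emb p\<close> as a combination of squares
  of monomials with coefficients in \<open>F\<close>. Applying the functional to these coefficients
  turns it into such a combination over the prime field, and on the left it gives back
  \<open>p\<close>.\<close>

lemma hits_emb:
  assumes p: "p \<in> poly_comp 5 (int n)" and h: "emb p \<in> hit id n"
  shows "p \<in> hits 5 (int n)"
proof -
  have np: "nonneg p" using p by (auto simp: poly_comp_def nonneg_def)
  obtain u where u: "\<forall>m\<in>keys u. deg m < n" and eq: "emb p = hom n (tsq id u)"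
    using h by (auto simp: hit_def)
  have pu: "m \<in> keys (proj u) \<Longrightarrow> keys m \<subseteq> {..<5} \<and> deg m < n" for m
    using u by (auto simp: in_keys_iff[of _ "proj u"] lookup_proj in_keys_iff[of _ u] split: if_splits)
  have "proj (hom n (tsq id u)) = hom n (tsq id (proj u))"
    by (rule poly_mapping_eqI) (simp add: lookup_proj lookup_hom flip: proj_tsq)
  moreover have "proj (emb p) = emb p" using poly_comp_cells[OF p] by (simp add: cells_iff)
  ultimately have "emb p = hom n (tsq id (proj u))" by (simp only: eq)
  also have "\<dots> = (\<Sum>m\<in>keys (proj u). C (lookup (proj u) m) * hom n (tsq id (mon m)))"
    by (subst tsq_as_sum) (simp only: hom_sum hom_C_mult)
  also have "\<dots> = (\<Sum>m\<in>keys (proj u). C (lookup (proj u) m) * emb (sq_monom (n - deg m) (im m)))"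
    using pu by (intro sum.cong refl) (simp add: emb_sq_monom less_imp_le)
  finally have sum: "descend (C 1 * emb p) = (\<Sum>m\<in>keys (proj u). descend (C (lookup (proj u) m) * emb (sq_monom (n - deg m) (im m))))"
    by (simp add: descend_sum)
  have p': "p = descend (C 1 * emb p)" unfolding descend_emb[OF np] functional_1 by simp
  have "descend (C c * emb (sq_monom (n - deg m) (im m))) \<in> hits 5 (int n)"
    if m: "m \<in> keys (proj u)" for c m
  proof -
    have "single (im m) 1 \<in> poly_comp 5 (int n - int (n - deg m))"
      using pu[OF m] by (simp add: poly_comp_def keys_im lookup_im monom_deg_im of_nat_diff)
    moreover have "Sq (n - deg m) (single (im m) 1) = sq_monom (n - deg m) (im m)" by (simp add: Sq_def)
    moreover have "0 < n - deg m" using pu[OF m] by simp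
    ultimately have "sq_monom (n - deg m) (im m) \<in> hits 5 (int n)"
      unfolding hits_def by (intro group_closure.base insertI2 CollectI exI conjI) (simp_all only:)
    then show ?thesis by (simp add: descend_emb nonneg_sq_monom lookup_im)
  qed
  then show ?thesis by (subst p') (simp only: sum hits_sum)
qed

subsection \<open>Linear substitutions\<close>

lemma nonneg_mult: "nonneg p \<Longrightarrow> nonneg q \<Longrightarrow> nonneg (p * q)"
  unfolding nonneg_def
proof (intro ballI allI)
  fix m j
  assume p: "\<forall>m\<in>keys p. \<forall>j. 0 \<le> lookup m j" "\<forall>m\<in>keys q. \<forall>j. 0 \<le> lookup m j"
    and "m \<in> keys (p * q)"
  then obtain a b where "a \<in> keys p" "b \<in> keys q" "m = a + b"
    using Poly_Mapping.keys_mult[of p q] by blast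
  then show "0 \<le> lookup m j" using p by (simp add: lookup_add)
qed

lemma emb_mult:
  assumes "nonneg p" "nonneg q"
  shows "emb (p * q) = emb p * emb q"
proof -
  have "p * q = (\<Sum>m\<in>keys p. \<Sum>k\<in>keys q. single (m + k) 1)"
    by (subst laurent_as_sum[of p], subst laurent_as_sum[of q]) (simp only: sum_product mult_single mult_1_left)
  then have "emb (p * q) = (\<Sum>m\<in>keys p. \<Sum>k\<in>keys q. mon (nm (m + k)))"
    by (simp add: emb_sum emb_single iota_1)
  also have "\<dots> = (\<Sum>m\<in>keys p. \<Sum>k\<in>keys q. mon (nm m) * mon (nm k))"
    using assms by (intro sum.cong refl) (simp add: nonneg_def nm_add mon_add)
  finally show ?thesis by (simp add: emb_def blin_def sum_product)
qed

lemma nonneg_1: "nonneg 1"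
  using nonneg_single[of 0 1] by (simp only: single_one lookup_zero order_refl)

lemma emb_1: "emb 1 = 1"
proof -
  have "nm 0 = 0" by (rule poly_mapping_eqI) (simp add: lookup_nm)
  then show ?thesis using emb_single[of 0 1] by (simp add: iota_1)
qed

lemma emb_power: "nonneg p \<Longrightarrow> nonneg (p ^ k) \<and> emb (p ^ k) = emb p ^ k"
  by (induction k) (simp_all add: nonneg_1 emb_1 nonneg_mult emb_mult)

lemma emb_prod: "(\<And>a. a \<in> A \<Longrightarrow> nonneg (f a)) \<Longrightarrow> nonneg (prod f A) \<and> emb (prod f A) = (\<Prod>a\<in>A. emb (f a))"
  by (induction A rule: infinite_finite_induct) (simp_all add: nonneg_1 emb_1 nonneg_mult emb_mult)

lemma emb_lin_subst:
  assumes p: "p \<in> poly_comp 5 n"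
  shows "emb (lin_subst 5 g p) = subst (lsub (\<lambda>i j. iota (g $$ (i, j)))) (emb p)"
proof -
  let ?G = "\<lambda>i j. iota (g $$ (i, j))"
  let ?L = "\<lambda>i. (\<Sum>j<5. single (single j 1) (g $$ (i, j))) :: laurent"
  have nL: "nonneg (?L i)" for i
    by (intro nonneg_sum nonneg_single) (simp add: lookup_single when_def)
  have "nm (single j 1) = single j 1" for j
    by (rule poly_mapping_eqI) (simp add: lookup_nm lookup_single when_def)
  then have eL: "emb (?L i) = lform 5 (?G i)" for i
    by (simp add: emb_sum emb_single lform_def V_def mon_def)
  have "emb (lin_subst 5 g p) = (\<Sum>m\<in>keys p. emb (\<Prod>i<5. ?L i ^ nat (lookup m i)))"
    by (simp add: lin_subst_def emb_sum)
  also have "\<dots> = (\<Sum>m\<in>keys p. subst (lsub ?G) (mon (nm m)))"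
  proof (rule sum.cong[OF refl])
    fix m assume "m \<in> keys p"
    then have m: "keys m \<subseteq> {..<5}" "\<forall>j. 0 \<le> lookup m j" using p by (auto simp: poly_comp_def)
    have "emb (\<Prod>i<5. ?L i ^ nat (lookup m i)) = (\<Prod>i<5. emb (?L i ^ nat (lookup m i)))"
      using emb_prod[of "{..<5}" "\<lambda>i. ?L i ^ nat (lookup m i)"] emb_power[OF nL] by blast
    also have "\<dots> = (\<Prod>i<5. lsub ?G i ^ lookup (nm m) i)"
    proof (rule prod.cong[OF refl])
      fix i :: nat assume "i \<in> {..<5}"
      then show "emb (?L i ^ nat (lookup m i)) = lsub ?G i ^ lookup (nm m) i"
        using emb_power[OF nL, of i] by (simp only: eL lookup_nm lsub_def lessThan_iff if_True)
    qed
    also have "\<dots> = subst (lsub ?G) (mon (nm m))"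
      using m by (subst subst_mon[of "{..<5}"]) (simp_all add: keys_nm)
    finally show "emb (\<Prod>i<5. ?L i ^ nat (lookup m i)) = subst (lsub ?G) (mon (nm m))" .
  qed
  finally show ?thesis by (simp add: emb_def blin_def subst_sum)
qed

section \<open>Invertibility of the matrices used\<close>

definition bool_mat :: "bool list list \<Rightarrow> bit mat" where
  "bool_mat A = mat 5 5 (\<lambda>(i, j). of_bool (A ! i ! j))"

text \<open>In the order of \<open>generators\<close>. The transvection and the last three
  permutations are involutions, so only the first matrix and the five-cycle change.\<close>

definition inverses :: "bool list list list" where
  "inverses = [[True, True, True, True, True], [True, False, False, False, False], [True, False, False, True, False],
     [True, False, True, True, True], [True, False, False, True, True]] # transvection #
     map permutation [[1, 2, 3, 4, 0], [0, 1, 2, 4, 3], [0, 1, 4, 3, 2], [0, 2, 1, 4, 3]]"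

definition inverse_to :: "bool list list \<Rightarrow> bool list list \<Rightarrow> bool" where
  "inverse_to A B \<longleftrightarrow> list_all (\<lambda>i. list_all (\<lambda>j.
     fold (\<lambda>k s. (A ! i ! k \<and> B ! k ! j) \<noteq> s) [0..<5] False = (i = j)) [0..<5]) [0..<5]"

lemma inverses_correct:
  "list_all2 inverse_to generators inverses \<and> list_all2 inverse_to inverses generators"
  by code_simp

lemma bool_mat_mult:
  assumes "inverse_to A B"
  shows "bool_mat A * bool_mat B = one_mat 5"
proof (rule eq_matI)
  fix i j assume "i < dim_row (one_mat 5 :: bit mat)" "j < dim_col (one_mat 5 :: bit mat)"
  then have ij: "i < 5" "j < 5" by simp_all
  have "(bool_mat A * bool_mat B) $$ (i, j) = (\<Sum>k\<in>{0..<5}. of_bool (A ! i ! k) * of_bool (B ! k ! j))"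
    using ij by (simp add: bool_mat_def scalar_prod_def del: of_bool_eq_iff)
  also have "\<dots> = (\<Sum>k\<leftarrow>[0..<5]. of_bool (A ! i ! k \<and> B ! k ! j))"
    by (simp only: interv_sum_list_conv_sum_set_nat set_upt of_bool_conj)
  also have "\<dots> = of_bool (fold (\<lambda>k s. (A ! i ! k \<and> B ! k ! j) \<noteq> s) [0..<5] False)"
    unfolding of_bool_fold_xor by simp
  also have "fold (\<lambda>k s. (A ! i ! k \<and> B ! k ! j) \<noteq> s) [0..<5] False = (i = j)"
    using assms ij unfolding inverse_to_def list_all_iff by (simp only: set_upt atLeastLessThan_iff Ball_def simp_thms zero_le)
  finally show "(bool_mat A * bool_mat B) $$ (i, j) = one_mat 5 $$ (i, j)" using ij by simp
qed (simp_all add: bool_mat_def)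

lemma bool_mat_GL:
  assumes "A \<in> set generators"
  shows "bool_mat A \<in> GL 5"
proof -
  obtain k where k: "k < length generators" "A = generators ! k"
    using assms by (metis in_set_conv_nth)
  have "inverse_to A (inverses ! k)"
    unfolding k(2) by (rule list_all2_nthD[OF inverses_correct[THEN conjunct1] k(1)])
  moreover have "inverse_to (inverses ! k) A"
    unfolding k(2) by (rule list_all2_nthD2[OF inverses_correct[THEN conjunct2] k(1)])
  ultimately have "inverts_mat (bool_mat A) (bool_mat (inverses ! k))" "inverts_mat (bool_mat (inverses ! k)) (bool_mat A)"
    by (simp_all add: inverts_mat_def bool_mat_mult, simp_all add: bool_mat_def)
  moreover have "bool_mat A \<in> carrier_mat 5 5" by (simp add: bool_mat_def)
  ultimately show ?thesis
    unfolding GL_def invertible_mat_def by auto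
qed

lemma lsub_bool_mat: "lsub (\<lambda>i j. iota (bool_mat A $$ (i, j))) = lsub (bmat A)"
  by (rule lsub_cong) (simp add: bool_mat_def bmat_def iota_def)

section \<open>The invariants vanish\<close>

lemma QP_inv_hits:
  assumes K: "K \<in> QP_inv 5 (int (47 * 2 ^ s - 5))" and p: "p \<in> K"
  shows "p \<in> hits 5 (int (47 * 2 ^ s - 5))"
proof -
  let ?N = "47 * 2 ^ s - 5 :: nat"
  from K obtain r where r: "K = hit_eq 5 (int ?N) `` {r}"
    by (auto simp: QP_inv_def QP_def quotient_def)
  have pc: "p \<in> poly_comp 5 (int ?N)" and rp: "r - p \<in> hits 5 (int ?N)"
    using p by (auto simp: r cong_mod_def)
  have "emb p \<in> hit id ?N"
  proof (rule invariant_hit)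
    show "cells ?N (emb p)" using pc by (rule poly_comp_cells)
    fix A assume "A \<in> set generators"
    then have "lin_subst 5 (bool_mat A) p \<in> K"
      using K p bool_mat_GL by (auto simp: QP_inv_def)
    then have "r - lin_subst 5 (bool_mat A) p \<in> hits 5 (int ?N)"
      by (auto simp: r cong_mod_def)
    \<comment> \<open>The representative \<open>r\<close> occurs twice and cancels.\<close>
    then have "(r - lin_subst 5 (bool_mat A) p) + (r - p) \<in> hits 5 (int ?N)" using rp by (rule hits_add)
    then have "lin_subst 5 (bool_mat A) p + p \<in> hits 5 (int ?N)" by (simp add: add_ac)
    then have "emb (lin_subst 5 (bool_mat A) p + p) \<in> hit id ?N" by (rule emb_hits)
    then show "subst (lsub (bmat A)) (emb p) + emb p \<in> hit id ?N"
      by (simp only: emb_add emb_lin_subst[OF pc] lsub_bool_mat)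
  qed
  with pc show ?thesis by (rule hits_emb)
qed

lemma QP_inv_trivial:
  assumes K: "K \<in> QP_inv 5 (int (47 * 2 ^ s - 5))"
  shows "K = hit_eq 5 (int (47 * 2 ^ s - 5)) `` {0}"
proof -
  let ?n = "int (47 * 2 ^ s - 5)"
  from K obtain r where r: "r \<in> poly_comp 5 ?n" "K = hit_eq 5 ?n `` {r}"
    by (auto simp: QP_inv_def QP_def quotient_def)
  have z: "0 \<in> poly_comp 5 ?n" by (simp add: poly_comp_def)
  have "r \<in> K" using r by (simp add: cong_mod_def)
  then have h: "r \<in> hits 5 ?n" using K by (rule QP_inv_hits[rotated])
  have "r - q \<in> hits 5 ?n \<longleftrightarrow> 0 - q \<in> hits 5 ?n" for q
  proof
    assume "r - q \<in> hits 5 ?n"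
    then have "r + (r - q) \<in> hits 5 ?n" by (rule hits_add[OF h])
    then show "0 - q \<in> hits 5 ?n" by simp
  next
    assume "0 - q \<in> hits 5 ?n"
    then have "r + (0 - q) \<in> hits 5 ?n" by (rule hits_add[OF h])
    then show "r - q \<in> hits 5 ?n" by simp
  qed
  then show ?thesis using r z by (auto simp: cong_mod_def)
qed

text \<open>Additivity at \<open>0 + 0\<close> makes \<open>l\<close> vanish on the class of 0, the
  only invariant, and \<open>extensional\<close> fixes all other values.\<close>

lemma QP_inv_dual_zero:
  assumes l: "l \<in> QP_inv_dual 5 (int (47 * 2 ^ s - 5))"
  shows "l = (\<lambda>K\<in>QP_inv 5 (int (47 * 2 ^ s - 5)). 0)"
proof
  fix K
  let ?n = "int (47 * 2 ^ s - 5)"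
  show "l K = (\<lambda>K\<in>QP_inv 5 ?n. 0) K"
  proof (cases "K \<in> QP_inv 5 ?n")
    case True
    then have K: "K = hit_eq 5 ?n `` {0}" by (rule QP_inv_trivial)
    with True have "hit_eq 5 ?n `` {0} \<in> QP_inv 5 ?n" by (simp only:)
    then have "l (hit_eq 5 ?n `` {0 + 0}) = l (hit_eq 5 ?n `` {0}) + l (hit_eq 5 ?n `` {0})"
      using l unfolding QP_inv_dual_def by blast
    then have "l K = 0" by (simp only: K add_0_left add_self)
    then show ?thesis using True by simp
  next
    case False
    have "l \<in> extensional (QP_inv 5 ?n)" using l by (simp only: QP_inv_dual_def mem_Collect_eq)
    then have "l K = undefined" using False by (rule extensional_arb)
    then show ?thesis by (simp only: restrict_apply if_not_P[OF False])
  qed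
qed

theorem corollary3p8:
  fixes s :: nat and n :: int
  assumes "n = 5 * (2 ^ s - 1) + 42 * 2 ^ s"
  shows "inj_on (cohomological_transfer 5 n) (QP_inv_dual 5 n)"
proof -
  \<comment> \<open>Guards the subtraction of 5 in the natural numbers against truncation.\<close>
  have "(1::nat) \<le> 2 ^ s" by simp
  then have "(5::nat) \<le> 47 * 2 ^ s" by linarith
  then have n: "n = int (47 * 2 ^ s - 5)" by (simp add: assms of_nat_diff)
  show ?thesis unfolding n
  proof (rule inj_onI)
    fix l k assume "l \<in> QP_inv_dual 5 (int (47 * 2 ^ s - 5))" "k \<in> QP_inv_dual 5 (int (47 * 2 ^ s - 5))"
    then show "l = k" by (rule QP_inv_dual_zero[THEN trans, OF _ QP_inv_dual_zero[symmetric]])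
  qed
qed

end
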